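(* Let $a>0$ be an integer with $a\neq 3$ such that $a^2+16$ is not divisible by any odd square greater than $1$. Let $\xi$ be a root of $$f(x)=x^4-ax^3-6x^2+ax+1,$$ and let $L=\mathbb{Q}(\xi)$ with discriminant $D_L$. Let $d$ be a square-free positive integer, let $M=\mathbb{Q}(i\sqrt d)$ with discriminant $D_M$, and assume $\gcd(D_M,D_L)=1$. Let $K=LM$ be the composite field. If $d\neq 3$, then the field $K$ is not monogenic.
   Context: A number field $K$ with ring of integers $\mathbb{Z}_K$ is monogenic if there exists $\alpha\in\mathbb{Z}_K$ with $\mathbb{Z}_K=\mathbb{Z}[\alpha]$. For an integer $a>0$, $a\ne 3$, the polynomial $f$ is irreducible over $\mathbb{Q}$; the fields $L=\mathbb{Q}(\xi)$ are called the simplest quartic fields. *)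

theory Defs
  imports
    Complex_Main
    "HOL-Library.FuncSet"
    "HOL-Computational_Algebra.Polynomial"
    "HOL-Computational_Algebra.Squarefree"
    "Jordan_Normal_Form.Determinant"
begin

text \<open>
  Number fields are represented as subfields of the complex numbers, i.e. as sets of type
  \<^typ>\<open>complex set\<close>.
\<close>

definition is_subfield :: "complex set \<Rightarrow> bool" where
  "is_subfield K \<longleftrightarrow> 1 \<in> K \<and>
     (\<forall>x\<in>K. \<forall>y\<in>K. x - y \<in> K \<and> x * y \<in> K) \<and> (\<forall>x\<in>K. inverse x \<in> K)"

text \<open>The field generated over the rationals by a set of complex numbers.\<close>

definition field_adjoin :: "complex set \<Rightarrow> complex set" where
  "field_adjoin S = is_subfield hull S"

definition composite_field :: "complex set \<Rightarrow> complex set \<Rightarrow> complex set" where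
  "composite_field L M = field_adjoin (L \<union> M)"

definition ring_of_integers :: "complex set \<Rightarrow> complex set" where
  "ring_of_integers K = {x \<in> K. algebraic_int x}"

definition int_adjoin :: "complex \<Rightarrow> complex set" where
  "int_adjoin \<alpha> = range (\<lambda>p :: int poly. poly (map_poly of_int p) \<alpha>)"

definition monogenic :: "complex set \<Rightarrow> bool" where
  "monogenic K \<longleftrightarrow> (\<exists>\<alpha>\<in>ring_of_integers K. ring_of_integers K = int_adjoin \<alpha>)"

text \<open>
  The embeddings of \<open>K\<close> into the complex numbers. They are taken to be \<^const>\<open>undefined\<close> outside
  of \<open>K\<close>, so that each embedding corresponds to exactly one HOL function.
\<close>

definition embeddings :: "complex set \<Rightarrow> (complex \<Rightarrow> complex) set" where
  "embeddings K = {\<sigma> \<in> extensional K. \<sigma> 1 = 1 \<and>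
     (\<forall>x\<in>K. \<forall>y\<in>K. \<sigma> (x + y) = \<sigma> x + \<sigma> y \<and> \<sigma> (x * y) = \<sigma> x * \<sigma> y)}"

definition field_trace :: "complex set \<Rightarrow> complex \<Rightarrow> complex" where
  "field_trace K x = (\<Sum>\<sigma>\<in>embeddings K. \<sigma> x)"

definition integral_basis :: "complex set \<Rightarrow> complex list \<Rightarrow> bool" where
  "integral_basis K ws \<longleftrightarrow> set ws \<subseteq> ring_of_integers K \<and>
     (\<forall>x\<in>ring_of_integers K. \<exists>!cs :: int list. length cs = length ws \<and>
        x = (\<Sum>i<length ws. of_int (cs ! i) * ws ! i))"

text \<open>
  The discriminant of a number field is the determinant of the trace form with respect to an
  integral basis. It is a rational integer which does not depend on the choice of the basis.
\<close>

definition field_discriminant :: "complex set \<Rightarrow> int" where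
  "field_discriminant K = (THE D. \<exists>ws. integral_basis K ws \<and>
     of_int D = det (mat (length ws) (length ws) (\<lambda>(i, j). field_trace K (ws ! i * ws ! j))))"

end

theory Submission
  imports Defs "Jordan_Normal_Form.Char_Poly"
begin

text \<open>
  Let \<open>m = a\<^sup>2 + 16\<close>. The field \<open>L\<close> is real and cyclic of degree 4; its Galois group is generated by \<open>\<sigma>\<close>
  with \<open>\<sigma> \<xi> = (\<xi> - 1)/(\<xi> + 1)\<close>, and its quadratic subfield \<open>\<rat>(\<surd>m)\<close> is generated by \<open>\<eta> = \<xi> - 1/\<xi>\<close>.
  Let \<open>\<delta> = \<i> \<surd>d\<close>. The Galois group of \<open>K\<close> is generated by complex conjugation and by the extension
  \<open>\<phi>\<close> of \<open>\<sigma>\<close> that fixes \<open>\<delta>\<close>.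

  Suppose that the ring of integers of \<open>K\<close> is \<open>\<int>[\<alpha>]\<close>. Every integer \<open>x\<close> of \<open>K\<close> is then a polynomial in
  \<open>\<alpha>\<close>, so for each automorphism \<open>g\<close> the difference \<open>\<alpha> - g \<alpha>\<close> divides \<open>x - g x\<close>
  (\<open>generator_diff_divides\<close>). Two or three well chosen \<open>x\<close> show that certain such differences are units,
  or units modulo 2. This is contradictory, for different reasons in two cases.

  If \<open>d \<equiv> 3\<close> modulo 4, then \<open>d \<ge> 7\<close>, and the obstruction is archimedean (\<open>not_monogenic_if_3_mod_4\<close>). For
  \<open>g = cnj \<circ> \<phi>\<^sup>2\<close> the difference \<open>\<epsilon> = \<alpha> - g \<alpha>\<close> is a unit with \<open>4 |\<epsilon>|\<^sup>2 = b\<^sup>2 + d c\<^sup>2\<close>, where \<open>b\<^sup>2\<close> and \<open>c\<close> lie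
  in the quadratic subfield, \<open>c = \<gamma> + \<sigma>\<^sup>2 \<gamma>\<close>, and \<open>\<gamma> = (\<alpha> - cnj \<alpha>)/\<delta>\<close> is a unit of \<open>L\<close>. Both conjugates of
  \<open>b\<^sup>2 + d c\<^sup>2\<close> are nonnegative and their product is 16, whereas \<open>d\<^sup>2 \<ge> 49\<close>; this forces \<open>c = 0\<close>, and then
  the unit \<open>\<gamma> \<cdot> \<sigma> \<gamma>\<close> would be \<open>\<plusminus> 1\<close> and at the same time change its sign under \<open>\<sigma>\<close>.

  If \<open>d \<equiv> 1\<close> or \<open>d \<equiv> 2\<close> modulo 4, the discriminant of \<open>M\<close> is even, so that of \<open>L\<close> is odd and \<open>a\<close> is odd.
  The obstruction now lies above 2 (\<open>not_monogenic_if_1_2_mod_4\<close>). Since 2 splits in the quadratic subfield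
  and the resulting primes are inert in \<open>L\<close>, there are two primes of \<open>K\<close> above 2, and both have a residue
  field with four elements. A generator would have to satisfy two different irreducible quadratic
  polynomials over the field with two elements, but only \<open>x\<^sup>2 + x + 1\<close> exists. The formal argument
  avoids prime ideals and calculates modulo the radical of 2 in the ring of all algebraic integers.

  The discriminants enter only through the criterion \<open>prime_dvd_discriminant\<close>: a prime \<open>p\<close> divides the
  discriminant of a field if some integer of the field is nilpotent modulo \<open>p\<close> but not divisible by \<open>p\<close>.
  For \<open>L\<close> such elements are \<open>\<xi> + 1\<close> if \<open>p = 2\<close> and \<open>a\<close> is even, and \<open>4 \<xi> - a\<close> if \<open>p\<close> is an odd prime
  dividing \<open>m\<close> exactly once. So coprime discriminants make \<open>d\<close> coprime to \<open>m\<close> when \<open>d \<equiv> 3\<close> modulo 4. The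
  criterion requires integral bases to exist and the determinant of the trace form to be independent of
  the basis, and it rests on the fact that the algebraic integers form a ring.
\<close>

section \<open>The ring of algebraic integers\<close>

definition int_span :: "complex set \<Rightarrow> complex set" where
  "int_span B = {\<Sum>b\<in>B. of_int (c b) * b | c. True}"

lemma int_span_zero: "0 \<in> int_span B"
  unfolding int_span_def by (rule CollectI, rule exI[of _ "\<lambda>_. 0"]) simp

lemma int_span_add: "x \<in> int_span B \<Longrightarrow> y \<in> int_span B \<Longrightarrow> x + y \<in> int_span B"
proof -
  assume "x \<in> int_span B" "y \<in> int_span B"
  then obtain c c' where "x = (\<Sum>b\<in>B. of_int (c b) * b)" "y = (\<Sum>b\<in>B. of_int (c' b) * b)"
    unfolding int_span_def by blast
  then have "x + y = (\<Sum>b\<in>B. of_int (c b + c' b) * b)"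
    by (simp add: sum.distrib ring_distribs)
  then show ?thesis unfolding int_span_def by (intro CollectI exI[of _ "\<lambda>b. c b + c' b"]) simp
qed

lemma int_span_scale: "x \<in> int_span B \<Longrightarrow> of_int k * x \<in> int_span B"
proof -
  assume "x \<in> int_span B"
  then obtain c where "x = (\<Sum>b\<in>B. of_int (c b) * b)"
    unfolding int_span_def by blast
  then have "of_int k * x = (\<Sum>b\<in>B. of_int (k * c b) * b)"
    by (simp add: sum_distrib_left mult.assoc)
  then show ?thesis unfolding int_span_def by (intro CollectI exI[of _ "\<lambda>b. k * c b"]) simp
qed

lemma int_span_base: "finite B \<Longrightarrow> x \<in> B \<Longrightarrow> x \<in> int_span B"
proof -
  assume "finite B" "x \<in> B"
  then have "x = (\<Sum>b\<in>B. of_int (if b = x then 1 else 0) * b)"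
    by (simp add: if_distrib[of of_int] if_distrib[of "\<lambda>z. z * _"] cong: if_cong)
  then show ?thesis unfolding int_span_def by (intro CollectI exI[of _ "\<lambda>b. if b = x then 1 else 0"]) auto
qed

lemma int_span_sum: "(\<And>i. i \<in> I \<Longrightarrow> f i \<in> int_span B) \<Longrightarrow> sum f I \<in> int_span B"
  by (induction I rule: infinite_finite_induct) (auto intro: int_span_zero int_span_add)

lemma int_span_mult_closed:
  assumes "\<And>b. b \<in> B \<Longrightarrow> z * b \<in> int_span B" and "x \<in> int_span B"
  shows "z * x \<in> int_span B"
proof -
  obtain c where x: "x = (\<Sum>b\<in>B. of_int (c b) * b)"
    using assms(2) unfolding int_span_def by blast
  have "z * x = (\<Sum>b\<in>B. of_int (c b) * (z * b))"
    unfolding x by (simp add: sum_distrib_left mult_ac)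
  also have "\<dots> \<in> int_span B"
    by (intro int_span_sum int_span_scale assms(1))
  finally show ?thesis .
qed

text \<open>
  The determinant trick: multiplication by \<open>z\<close> acts on the generators \<open>B\<close> of a finitely generated
  group by an integer matrix, and \<open>z\<close> is an eigenvalue of this matrix, hence a root of its
  characteristic polynomial, which is monic with integer coefficients.
\<close>

lemma algebraic_int_if_stable:
  assumes fin: "finite B" and one: "1 \<in> B" and stab: "\<And>b. b \<in> B \<Longrightarrow> z * b \<in> int_span B"
  shows "algebraic_int z"
proof -
  obtain bs where bs: "set bs = B" "distinct bs" using finite_distinct_list[OF fin] by blast
  define n where "n = length bs"
  have "\<forall>b\<in>B. \<exists>c. z * b = (\<Sum>b'\<in>B. of_int (c b') * b')"
    using stab unfolding int_span_def by blast
  then obtain c :: "complex \<Rightarrow> complex \<Rightarrow> int"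
    where c: "\<And>b. b \<in> B \<Longrightarrow> z * b = (\<Sum>b'\<in>B. of_int (c b b') * b')" by metis
  define A :: "int mat" where "A = mat n n (\<lambda>(i, j). c (bs ! i) (bs ! j))"
  have A: "A \<in> carrier_mat n n" unfolding A_def by simp
  define A' :: "complex mat" where "A' = map_mat of_int A"
  have A': "A' \<in> carrier_mat n n" using A unfolding A'_def by simp
  define v where "v = vec_of_list bs"
  have v: "v \<in> carrier_vec n" unfolding v_def n_def by (simp add: carrier_vecI)
  have reidx: "(\<Sum>b'\<in>B. f b') = (\<Sum>j = 0..<n. f (bs ! j))" for f :: "complex \<Rightarrow> complex"
    using sum.reindex_bij_betw[OF bij_betw_nth[OF bs(2), of "{0..<n}" B], of f] bs(1)
    by (simp add: n_def lessThan_atLeast0)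
  have "A' *\<^sub>v v = z \<cdot>\<^sub>v v"
  proof (rule eq_vecI)
    fix i assume "i < dim_vec (z \<cdot>\<^sub>v v)"
    then have i: "i < n" using v by simp
    then have iB: "bs ! i \<in> B" using bs by (auto simp: n_def)
    have "(A' *\<^sub>v v) $ i = (\<Sum>j = 0..<n. of_int (c (bs ! i) (bs ! j)) * bs ! j)"
      using i by (simp add: A'_def A_def scalar_prod_def v_def vec_of_list_index n_def)
    also have "\<dots> = z * bs ! i" unfolding c[OF iB] reidx ..
    finally show "(A' *\<^sub>v v) $ i = (z \<cdot>\<^sub>v v) $ i" using i v
      by (simp add: v_def[symmetric]) (simp add: v_def vec_of_list_index)
  qed (use A' v in auto)
  moreover have "v \<noteq> 0\<^sub>v n"
  proof
    assume "v = 0\<^sub>v n"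
    moreover obtain i where "i < n" "bs ! i = 1" using one bs by (metis in_set_conv_nth n_def)
    ultimately show False unfolding v_def by (metis index_zero_vec(1) vec_of_list_index zero_neq_one)
  qed
  ultimately have "eigenvalue A' z"
    unfolding eigenvalue_def eigenvector_def using v A' by auto
  then have "poly (char_poly A') z = 0"
    using eigenvalue_root_char_poly[OF A'] by simp
  moreover have "char_poly A' = map_poly of_int (char_poly A)"
    unfolding A'_def by (rule of_int_hom.char_poly_hom[OF A])
  moreover have "lead_coeff (char_poly A) = 1"
    using degree_monic_char_poly[OF A] by simp
  ultimately show ?thesis unfolding algebraic_int_altdef_ipoly by metis
qed

lemma algebraic_int_power_relation:
  assumes "algebraic_int (x::complex)"
  obtains n c where "x ^ n = (\<Sum>i<n. of_int (c i) * x ^ i)" "n > 0"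
proof -
  obtain p where p: "poly (map_poly of_int p) x = 0" "lead_coeff p = (1::int)"
    using assms unfolding algebraic_int_altdef_ipoly by blast
  define n where "n = degree p"
  have deg: "degree (map_poly of_int p :: complex poly) = n" unfolding n_def by simp
  have "(\<Sum>i\<le>n. of_int (coeff p i) * x ^ i) = 0"
    using p(1) unfolding poly_altdef deg by (simp add: coeff_map_poly)
  then have *: "(\<Sum>i<n. of_int (coeff p i) * x ^ i) + x ^ n = 0"
    using p(2) by (simp add: lessThan_Suc_atMost[symmetric] n_def)
  then have rel: "x ^ n = (\<Sum>i<n. of_int (- coeff p i) * x ^ i)"
    by (simp add: sum_negf eq_neg_iff_add_eq_0 add.commute)
  have "n > 0" using * by (cases n) auto
  show ?thesis by (rule that[OF rel \<open>n > 0\<close>])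
qed

text \<open>
  The monomials of bounded degree in two algebraic integers span a group that is stable under
  multiplication by both, hence by their sum and their product.
\<close>

lemma common_stable_group:
  assumes "algebraic_int (x::complex)" "algebraic_int (y::complex)"
  obtains B where "finite B" "1 \<in> B" "\<And>b. b \<in> B \<Longrightarrow> x * b \<in> int_span B"
    "\<And>b. b \<in> B \<Longrightarrow> y * b \<in> int_span B"
proof -
  obtain n c where n: "x ^ n = (\<Sum>i<n. of_int (c i) * x ^ i)" "n > 0"
    using algebraic_int_power_relation[OF assms(1)] by blast
  obtain m e where m: "y ^ m = (\<Sum>i<m. of_int (e i) * y ^ i)" "m > 0"
    using algebraic_int_power_relation[OF assms(2)] by blast
  define B where "B = (\<lambda>(i, j). x ^ i * y ^ j) ` ({..<n} \<times> {..<m})"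
  have fin: "finite B" unfolding B_def by simp
  have mem: "x ^ i * y ^ j \<in> int_span B" if "i < n" "j < m" for i j
    by (rule int_span_base[OF fin]) (use that in \<open>auto simp: B_def\<close>)
  have "x * b \<in> int_span B" if bB: "b \<in> B" for b
  proof -
    obtain i j where b: "b = x ^ i * y ^ j" "i < n" "j < m" using bB unfolding B_def by auto
    show ?thesis
    proof (cases "Suc i < n")
      case True
      then show ?thesis using mem[of "Suc i" j] b by (simp add: mult.assoc)
    next
      case False
      with b have "Suc i = n" by simp
      then have "x * b = x ^ n * y ^ j" using b by (metis mult.assoc power_Suc)
      also have "\<dots> = (\<Sum>i<n. of_int (c i) * (x ^ i * y ^ j))"
        unfolding n(1) by (simp add: sum_distrib_right mult.assoc)
      also have "\<dots> \<in> int_span B"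
        by (intro int_span_sum int_span_scale mem) (use b in auto)
      finally show ?thesis .
    qed
  qed
  moreover have "y * b \<in> int_span B" if bB: "b \<in> B" for b
  proof -
    obtain i j where b: "b = x ^ i * y ^ j" "i < n" "j < m" using bB unfolding B_def by auto
    show ?thesis
    proof (cases "Suc j < m")
      case True
      then show ?thesis using mem[of i "Suc j"] b by (simp add: mult_ac)
    next
      case False
      with b have "Suc j = m" by simp
      then have "y * b = x ^ i * y ^ m" using b by (metis mult.left_commute power_Suc)
      also have "\<dots> = (\<Sum>j<m. of_int (e j) * (x ^ i * y ^ j))"
        unfolding m(1) by (simp add: sum_distrib_left mult_ac)
      also have "\<dots> \<in> int_span B"
        by (intro int_span_sum int_span_scale mem) (use b in auto)
      finally show ?thesis .
    qed
  qed
  moreover have "1 \<in> B" unfolding B_def using n(2) m(2) by (intro image_eqI[of _ _ "(0, 0)"]) auto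
  ultimately show ?thesis using that fin by blast
qed

lemma algebraic_int_add [intro]:
  assumes "algebraic_int (x::complex)" "algebraic_int (y::complex)"
  shows "algebraic_int (x + y)"
proof -
  obtain B where "finite B" "1 \<in> B" "\<And>b. b \<in> B \<Longrightarrow> x * b \<in> int_span B"
    "\<And>b. b \<in> B \<Longrightarrow> y * b \<in> int_span B"
    using common_stable_group[OF assms] by blast
  then show ?thesis
    by (intro algebraic_int_if_stable[of B]) (auto simp: ring_distribs intro: int_span_add)
qed

lemma algebraic_int_mult [intro]:
  assumes "algebraic_int (x::complex)" "algebraic_int (y::complex)"
  shows "algebraic_int (x * y)"
proof -
  obtain B where "finite B" "1 \<in> B" "\<And>b. b \<in> B \<Longrightarrow> x * b \<in> int_span B"
    "\<And>b. b \<in> B \<Longrightarrow> y * b \<in> int_span B"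
    using common_stable_group[OF assms] by blast
  then show ?thesis
    by (intro algebraic_int_if_stable[of B]) (auto simp: mult.assoc intro: int_span_mult_closed)
qed

lemma algebraic_int_diff [intro]:
  "algebraic_int (x::complex) \<Longrightarrow> algebraic_int (y::complex) \<Longrightarrow> algebraic_int (x - y)"
  using algebraic_int_add[of x "- y"] by simp

lemma algebraic_int_pow [intro]: "algebraic_int (x::complex) \<Longrightarrow> algebraic_int (x ^ n)"
  by (induction n) auto

lemma algebraic_int_sum [intro]:
  "(\<And>i. i \<in> I \<Longrightarrow> algebraic_int (f i :: complex)) \<Longrightarrow> algebraic_int (sum f I)"
  by (induction I rule: infinite_finite_induct) auto

lemma algebraic_int_quadratic:
  "x ^ 2 = of_int b * x + of_int c \<Longrightarrow> algebraic_int (x::complex)"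
  unfolding algebraic_int_altdef_ipoly
  by (intro exI[of _ "[:-c, -b, 1:]"]) (simp add: map_poly_pCons algebra_simps power2_eq_square)

lemma algebraic_int_sqrt_complex:
  assumes "algebraic_int (x ^ 2 :: complex)"
  shows "algebraic_int x"
  by (rule algebraic_int_root[OF assms, of "monom 1 2"])
    (auto simp: poly_monom degree_monom_eq)

lemma algebraic_int_poly [intro]:
  "algebraic_int (x::complex) \<Longrightarrow> algebraic_int (poly (map_poly of_int p) x)"
  by (induction p) (auto simp: map_poly_pCons)

text \<open>
  The quotient is a polynomial in \<open>x\<close> and \<open>y\<close> with integer coefficients. The lemma is used with
  conjugates \<open>x\<close> and \<open>y\<close>, and with a rational integer \<open>y\<close>.
\<close>

lemma poly_diff_divisible:
  assumes "algebraic_int (x::complex)" "algebraic_int (y::complex)"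
  shows "\<exists>q. algebraic_int q \<and>
    poly (map_poly of_int p) x - poly (map_poly of_int p) y = (x - y) * q"
proof (induction p)
  case 0
  show ?case by (intro exI[of _ 0]) auto
next
  case (pCons k p)
  then obtain q where q: "algebraic_int q"
    "poly (map_poly of_int p) x - poly (map_poly of_int p) y = (x - y) * q" by blast
  have "poly (map_poly of_int (pCons k p)) x - poly (map_poly of_int (pCons k p)) y =
      x * (poly (map_poly of_int p) x - poly (map_poly of_int p) y)
        + (x - y) * poly (map_poly of_int p) y"
    by (simp add: of_int_hom.map_poly_pCons_hom algebra_simps)
  also have "\<dots> = (x - y) * (x * q + poly (map_poly of_int p) y)"
    unfolding q(2) by (simp add: algebra_simps)
  finally show ?case
    by (intro exI[of _ "x * q + poly (map_poly of_int p) y"]) (use assms q in auto)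
qed

section \<open>Elements that are nilpotent modulo a rational integer\<close>

text \<open>For \<open>p \<noteq> 0\<close> this is the radical of the ideal generated by \<open>p\<close> in the ring of all algebraic
  integers.\<close>

definition nil_mod :: "int \<Rightarrow> complex \<Rightarrow> bool" where
  "nil_mod p x \<longleftrightarrow> algebraic_int x \<and> (\<exists>n. algebraic_int (x ^ n / of_int p))"

lemma nil_mod_algebraic_int: "nil_mod p x \<Longrightarrow> algebraic_int x"
  by (simp add: nil_mod_def)

lemma nil_mod_add:
  assumes "nil_mod p x" "nil_mod p y"
  shows "nil_mod p (x + y)"
proof -
  obtain n m where n: "algebraic_int (x ^ n / of_int p)" and m: "algebraic_int (y ^ m / of_int p)"
    using assms unfolding nil_mod_def by blast
  have x: "algebraic_int x" and y: "algebraic_int y" using assms by (auto simp: nil_mod_def)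
  \<comment> \<open>each term of the binomial expansion of \<open>(x + y)\<^bsup>n + m\<^esup>\<close> contains \<open>x\<^bsup>n\<^esup>\<close> or \<open>y\<^bsup>m\<^esup>\<close>\<close>
  have "algebraic_int (of_nat (n + m choose k) * x ^ k * y ^ (n + m - k) / of_int p)"
    if "k \<le> n + m" for k
  proof (cases "n \<le> k")
    case True
    then have "x ^ k = x ^ n * x ^ (k - n)" by (simp flip: power_add)
    then have "of_nat (n + m choose k) * x ^ k * y ^ (n + m - k) / of_int p =
        of_nat (n + m choose k) * (x ^ n / of_int p) * x ^ (k - n) * y ^ (n + m - k)" by simp
    also have "algebraic_int \<dots>" using n x y by (intro algebraic_int_mult algebraic_int_pow) auto
    finally show ?thesis .
  next
    case False
    then have "n + m - k = m + (n - k)" by simp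
    then have "y ^ (n + m - k) = y ^ m * y ^ (n - k)" by (simp add: power_add)
    then have "of_nat (n + m choose k) * x ^ k * y ^ (n + m - k) / of_int p =
        of_nat (n + m choose k) * (y ^ m / of_int p) * y ^ (n - k) * x ^ k" by simp
    also have "algebraic_int \<dots>" using m x y by (intro algebraic_int_mult algebraic_int_pow) auto
    finally show ?thesis .
  qed
  then have "algebraic_int (\<Sum>k\<le>n + m. of_nat (n + m choose k) * x ^ k * y ^ (n + m - k) / of_int p)"
    by (intro algebraic_int_sum) auto
  also have "(\<Sum>k\<le>n + m. of_nat (n + m choose k) * x ^ k * y ^ (n + m - k) / of_int p) =
      (x + y) ^ (n + m) / of_int p"
    by (simp add: binomial_ring sum_divide_distrib)
  finally show ?thesis using x y unfolding nil_mod_def by blast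
qed

lemma nil_mod_mult:
  assumes "nil_mod p x" "algebraic_int y"
  shows "nil_mod p (y * x)"
proof -
  obtain n where n: "algebraic_int (x ^ n / of_int p)" using assms unfolding nil_mod_def by blast
  have "algebraic_int (y ^ n * (x ^ n / of_int p))"
    using n assms by (intro algebraic_int_mult algebraic_int_pow)
  then show ?thesis using assms unfolding nil_mod_def by (auto simp: power_mult_distrib)
qed

lemma nil_mod_minus: "nil_mod p x \<Longrightarrow> nil_mod p (- x)"
  using nil_mod_mult[of p x "-1"] by simp

lemma nil_mod_diff: "nil_mod p x \<Longrightarrow> nil_mod p y \<Longrightarrow> nil_mod p (x - y)"
  using nil_mod_add[of p x "- y"] nil_mod_minus by simp

lemma nil_mod_zero: "nil_mod p 0"
  unfolding nil_mod_def by (auto intro: exI[of _ 1])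

lemma nil_mod_sum: "(\<And>i. i \<in> I \<Longrightarrow> nil_mod p (f i)) \<Longrightarrow> nil_mod p (sum f I)"
  by (induction I rule: infinite_finite_induct) (auto intro: nil_mod_zero nil_mod_add)

lemma nil_mod_multiple:
  assumes "algebraic_int x"
  shows "nil_mod p (of_int p * x)"
proof (cases "p = 0")
  case False
  then have "(of_int p * x) ^ 1 / of_int p = x" by simp
  then show ?thesis using assms unfolding nil_mod_def by (metis algebraic_int_mult algebraic_int_of_int)
qed (auto intro: nil_mod_zero)

text \<open>The radical meets the rational integers in \<open>p \<int>\<close>, since rational algebraic integers are integers.\<close>

lemma nil_mod_of_intD:
  assumes "prime p" "nil_mod p (of_int k)"
  shows "p dvd k"
proof -
  obtain n where "algebraic_int (of_int k ^ n / of_int p :: complex)"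
    using assms(2) unfolding nil_mod_def by blast
  moreover have "of_int k ^ n / of_int p \<in> (\<rat> :: complex set)" by (intro Rats_divide Rats_power) auto
  ultimately have "of_int k ^ n / of_int p \<in> (\<int> :: complex set)"
    by (rule rational_algebraic_int_is_int)
  then obtain l where "of_int k ^ n / of_int p = (of_int l :: complex)" by (auto elim: Ints_cases)
  moreover have "p \<noteq> 0" using assms(1) by auto
  ultimately have "(of_int (k ^ n) :: complex) = of_int (l * p)" by (simp add: field_simps)
  then have "p dvd k ^ n" by (metis dvd_triv_right of_int_eq_iff)
  then show ?thesis using assms(1) prime_dvd_power by blast
qed

lemma rational_algebraic_int_obtain:
  assumes "algebraic_int (x :: complex)" "x \<in> \<rat>"
  obtains k where "x = of_int k"
  using rational_algebraic_int_is_int[OF assms] by (auto elim: Ints_cases)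

section \<open>Integral bases and the discriminant\<close>

abbreviation int_comb :: "(nat \<Rightarrow> int) \<Rightarrow> complex list \<Rightarrow> complex" where
  "int_comb c ws \<equiv> \<Sum>i<length ws. of_int (c i) * ws ! i"

lemma int_subgroup_cyclic:
  fixes J :: "int set"
  assumes "0 \<in> J" "\<And>x y. x \<in> J \<Longrightarrow> y \<in> J \<Longrightarrow> x - y \<in> J"
  obtains g where "g \<in> J" "\<And>x. x \<in> J \<Longrightarrow> g dvd x"
proof (cases "J = {0}")
  case True
  then show ?thesis using that[of 0] by auto
next
  case False
  have neg: "- x \<in> J" if "x \<in> J" for x using assms(2)[OF assms(1) that] by simp
  have add: "x + y \<in> J" if "x \<in> J" "y \<in> J" for x y using assms(2)[OF that(1) neg[OF that(2)]] by simp
  obtain z where "z \<in> J" "z \<noteq> 0" using False assms(1) by blast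
  then have "\<exists>n. n > 0 \<and> int n \<in> J"
    using neg[of z] by (intro exI[of _ "nat \<bar>z\<bar>"]) (auto simp: abs_if)
  define n where "n = (LEAST n. n > 0 \<and> int n \<in> J)"
  have n: "n > 0" "int n \<in> J"
    using LeastI_ex[OF \<open>\<exists>n. n > 0 \<and> int n \<in> J\<close>] by (auto simp: n_def)
  have least: "\<not> (k > 0 \<and> int k \<in> J)" if "k < n" for k
    using not_less_Least that unfolding n_def by blast
  have mult_nat: "int k * int n \<in> J" for k
    by (induction k) (auto simp: assms(1) ring_distribs intro: add n(2))
  have mult: "k * int n \<in> J" for k :: int
    using mult_nat[of "nat k"] neg[OF mult_nat[of "nat (- k)"]] by (cases "k \<ge> 0") auto
  have "int n dvd x" if "x \<in> J" for x
  proof -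
    define r where "r = nat (x mod int n)"
    have r: "int r = x mod int n" using n(1) unfolding r_def by simp
    have "x mod int n = x - (x div int n) * int n" by (simp add: minus_div_mult_eq_mod)
    then have "x mod int n \<in> J" using assms(2)[OF that mult] by metis
    then have "int r \<in> J" unfolding r .
    moreover have "int r < int n" unfolding r using n(1) by (intro pos_mod_bound) simp
    ultimately have "r = 0" using least[of r] by (metis neq0_conv of_nat_less_iff)
    then show ?thesis using r by (simp add: dvd_eq_mod_eq_0)
  qed
  then show ?thesis using that n(2) by blast
qed

text \<open>
  A subgroup of a free abelian group of finite rank is free; the induction on the rank adjoins one
  element whose last coordinate generates the group of all last coordinates.
\<close>

lemma subgroup_of_free_group_free:
  fixes v :: "nat \<Rightarrow> complex"
  assumes "\<And>c. (\<Sum>i<n. of_int (c i) * v i) = 0 \<Longrightarrow> \<forall>i<n. c i = 0"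
    and "0 \<in> G" "\<And>x y. x \<in> G \<Longrightarrow> y \<in> G \<Longrightarrow> x - y \<in> G"
    and "\<And>x. x \<in> G \<Longrightarrow> \<exists>c. x = (\<Sum>i<n. of_int (c i) * v i)"
  shows "\<exists>ws. set ws \<subseteq> G \<and> (\<forall>x\<in>G. \<exists>c. x = int_comb c ws) \<and>
    (\<forall>c. int_comb c ws = 0 \<longrightarrow> (\<forall>i<length ws. c i = 0))"
  using assms
proof (induction n arbitrary: G)
  case 0
  then show ?case by (intro exI[of _ "[]"]) auto
next
  case (Suc n)
  note indep = Suc.prems(1) and zero = Suc.prems(2) and diff = Suc.prems(3) and span = Suc.prems(4)
  have add: "x + y \<in> G" if "x \<in> G" "y \<in> G" for x y
    using diff[OF that(1) diff[OF zero that(2)]] by simp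
  have mult_nat: "of_nat k * x \<in> G" if "x \<in> G" for x k
    by (induction k) (auto simp: zero ring_distribs intro: add that)
  have mult: "of_int k * x \<in> G" if "x \<in> G" for x k
    using mult_nat[OF that, of "nat k"] diff[OF zero mult_nat[OF that, of "nat (- k)"]]
    by (cases "k \<ge> 0") auto
  define S where "S = {\<Sum>i<n. of_int (c i) * v i | c. True}"
  have S_diff: "x - y \<in> S" if xy: "x \<in> S" "y \<in> S" for x y
  proof -
    obtain c c' where "x = (\<Sum>i<n. of_int (c i) * v i)" "y = (\<Sum>i<n. of_int (c' i) * v i)"
      using xy unfolding S_def by blast
    then have "x - y = (\<Sum>i<n. of_int (c i - c' i) * v i)"
      by (simp add: sum_subtractf left_diff_distrib)
    then show ?thesis unfolding S_def by (intro CollectI exI[of _ "\<lambda>i. c i - c' i"]) simp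
  qed
  have S_zero: "0 \<in> S" unfolding S_def by (intro CollectI exI[of _ "\<lambda>i. 0"]) simp
  have indep_n: "\<forall>i<n. c i = 0" if "(\<Sum>i<n. of_int (c i) * v i) = 0" for c
    using indep[of "\<lambda>i. if i < n then c i else 0"] that by (auto dest: less_SucI)
  have S_coord: "k = 0" if k: "of_int k * v n \<in> S" for k
  proof -
    obtain c where "of_int k * v n = (\<Sum>i<n. of_int (c i) * v i)" using k unfolding S_def by blast
    then have "(\<Sum>i<Suc n. of_int (if i < n then - c i else k) * v i) = 0"
      by (simp add: sum_negf)
    from indep[OF this] show ?thesis by (metis lessI less_irrefl)
  qed
  have "\<exists>ws. set ws \<subseteq> G \<inter> S \<and> (\<forall>x\<in>G \<inter> S. \<exists>c. x = int_comb c ws) \<and>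
    (\<forall>c. int_comb c ws = 0 \<longrightarrow> (\<forall>i<length ws. c i = 0))"
    by (rule Suc.IH[OF indep_n]) (auto simp: zero S_zero diff S_diff, auto simp: S_def)
  then obtain ws where ws: "set ws \<subseteq> G" "set ws \<subseteq> S" "\<forall>x\<in>G \<inter> S. \<exists>c. x = int_comb c ws"
    "\<forall>c. int_comb c ws = 0 \<longrightarrow> (\<forall>i<length ws. c i = 0)" by blast
  define J where "J = {k. \<exists>x\<in>G. x - of_int k * v n \<in> S}"
  have "0 \<in> J" unfolding J_def using zero S_zero by auto
  moreover have "k - l \<in> J" if kl: "k \<in> J" "l \<in> J" for k l
  proof -
    obtain x y where "x \<in> G" "y \<in> G" "x - of_int k * v n \<in> S" "y - of_int l * v n \<in> S"
      using kl unfolding J_def by blast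
    then have "x - y \<in> G" "(x - y) - of_int (k - l) * v n \<in> S"
      using diff S_diff[of "x - of_int k * v n" "y - of_int l * v n"] by (auto simp: algebra_simps)
    then show ?thesis unfolding J_def by blast
  qed
  ultimately obtain g where g: "g \<in> J" "\<And>k. k \<in> J \<Longrightarrow> g dvd k"
    using int_subgroup_cyclic by blast
  have coord: "\<exists>k. x - of_int k * v n \<in> S" if x: "x \<in> G" for x
  proof -
    obtain c where "x = (\<Sum>i<Suc n. of_int (c i) * v i)" using span[OF x] by blast
    then have "x - of_int (c n) * v n = (\<Sum>i<n. of_int (c i) * v i)" by simp
    then show ?thesis unfolding S_def by blast
  qed
  obtain w where w: "w \<in> G" "w - of_int g * v n \<in> S" using g(1) unfolding J_def by blast
  have S_mult: "of_int k * x \<in> S" if x: "x \<in> S" for k x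
  proof -
    obtain c where "x = (\<Sum>i<n. of_int (c i) * v i)" using x unfolding S_def by blast
    then have "of_int k * x = (\<Sum>i<n. of_int (k * c i) * v i)" by (simp add: sum_distrib_left mult.assoc)
    then show ?thesis unfolding S_def by (intro CollectI exI[of _ "\<lambda>i. k * c i"]) simp
  qed
  have S_add: "x + y \<in> S" if "x \<in> S" "y \<in> S" for x y
    using S_diff[OF that(1) S_diff[OF S_zero that(2)]] by simp
  show ?case
  proof (cases "g = 0")
    case True
    then have "G \<subseteq> S" using g(2) coord unfolding J_def by fastforce
    then show ?thesis using ws by blast
  next
    case False
    define us where "us = ws @ [w]"
    have us: "int_comb c us = int_comb c ws + of_int (c (length ws)) * w" for c
      unfolding us_def by (simp add: nth_append)
    have "\<exists>c. x = int_comb c us" if x: "x \<in> G" for x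
    proof -
      obtain k where k: "x - of_int k * v n \<in> S" using coord[OF x] by blast
      then have "g dvd k" using g(2) x unfolding J_def by blast
      then obtain l where l: "k = g * l" by blast
      have "(x - of_int k * v n) - of_int l * (w - of_int g * v n) \<in> S"
        by (intro S_diff S_mult k w)
      then have "x - of_int l * w \<in> S" by (simp add: l algebra_simps)
      then obtain c where c: "x - of_int l * w = int_comb c ws"
        using ws(3) diff[OF x mult[OF w(1)]] by blast
      have "x = int_comb (\<lambda>i. if i < length ws then c i else l) us"
        using c unfolding us by (simp add: algebra_simps)
      then show ?thesis by (intro exI[of _ "\<lambda>i. if i < length ws then c i else l"])
    qed
    moreover have "\<forall>i<length us. c i = 0" if c: "int_comb c us = 0" for c
    proof -
      let ?k = "c (length ws)"
      have "int_comb c ws \<in> S"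
      proof -
        have "(\<Sum>i\<in>I. of_int (c i) * ws ! i) \<in> S" if "I \<subseteq> {..<length ws}" for I
          using that ws(2)
          by (induction I rule: infinite_finite_induct) (auto intro!: S_zero S_add S_mult)
        then show ?thesis by blast
      qed
      moreover have "int_comb c ws = - of_int ?k * w" using c unfolding us by (simp add: add_eq_0_iff)
      ultimately have "(- of_int ?k * w) + of_int ?k * (w - of_int g * v n) \<in> S"
        by (intro S_add S_mult w) simp
      then have "of_int (- (?k * g)) * v n \<in> S" by (simp add: algebra_simps)
      then have "?k = 0" using S_coord False by fastforce
      moreover from this have "\<forall>i<length ws. c i = 0" using c ws(4) unfolding us by simp
      ultimately show ?thesis unfolding us_def by (auto simp: less_Suc_eq)
    qed
    moreover have "set us \<subseteq> G" unfolding us_def using ws(1) w(1) by simp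
    ultimately show ?thesis by blast
  qed
qed

lemma integral_basisI:
  assumes "set ws \<subseteq> ring_of_integers K"
    and "\<And>x. x \<in> ring_of_integers K \<Longrightarrow> \<exists>c. x = int_comb c ws"
    and "\<And>c. int_comb c ws = 0 \<Longrightarrow> \<forall>i<length ws. c i = 0"
  shows "integral_basis K ws"
  unfolding integral_basis_def
proof (intro conjI ballI assms(1))
  fix x assume "x \<in> ring_of_integers K"
  then obtain c where c: "x = int_comb c ws" using assms(2) by blast
  show "\<exists>!cs. length cs = length ws \<and> x = (\<Sum>i<length ws. of_int (cs ! i) * ws ! i)"
  proof (rule ex1I[of _ "map c [0..<length ws]"])
    show "length (map c [0..<length ws]) = length ws \<and>
        x = (\<Sum>i<length ws. of_int (map c [0..<length ws] ! i) * ws ! i)" using c by simp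
  next
    fix cs assume cs: "length cs = length ws \<and> x = (\<Sum>i<length ws. of_int (cs ! i) * ws ! i)"
    then have "int_comb (\<lambda>i. cs ! i - c i) ws = 0"
      using c by (simp add: left_diff_distrib sum_subtractf)
    from assms(3)[OF this] cs show "cs = map c [0..<length ws]" by (intro nth_equalityI) auto
  qed
qed

lemma integral_basis_repr:
  "integral_basis K ws \<Longrightarrow> x \<in> ring_of_integers K \<Longrightarrow> \<exists>c. x = int_comb c ws"
  unfolding integral_basis_def by (metis (no_types))

lemma integral_basis_unique:
  assumes "integral_basis K ws" "int_comb c ws \<in> ring_of_integers K" "int_comb c ws = int_comb e ws"
    and "i < length ws"
  shows "c i = e i"
proof -
  have "\<exists>!cs. length cs = length ws \<and> int_comb c ws = (\<Sum>i<length ws. of_int (cs ! i) * ws ! i)"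
    using assms(1,2) unfolding integral_basis_def by blast
  moreover have "length (map c [0..<length ws]) = length ws \<and>
      int_comb c ws = (\<Sum>i<length ws. of_int (map c [0..<length ws] ! i) * ws ! i)" by simp
  moreover have "length (map e [0..<length ws]) = length ws \<and>
      int_comb c ws = (\<Sum>i<length ws. of_int (map e [0..<length ws] ! i) * ws ! i)"
    using assms(3) by simp
  ultimately have "map c [0..<length ws] = map e [0..<length ws]" by blast
  then show ?thesis using assms(4) by (metis nth_map_upt add_0 diff_zero)
qed

lemma subfield_closed:
  assumes "is_subfield F"
  shows subfield_one: "1 \<in> F"
    and subfield_diff: "\<And>x y. x \<in> F \<Longrightarrow> y \<in> F \<Longrightarrow> x - y \<in> F"
    and subfield_mult: "\<And>x y. x \<in> F \<Longrightarrow> y \<in> F \<Longrightarrow> x * y \<in> F"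
    and subfield_inverse: "\<And>x. x \<in> F \<Longrightarrow> inverse x \<in> F"
  using assms unfolding is_subfield_def by auto

lemma subfield_zero: "is_subfield F \<Longrightarrow> 0 \<in> F"
  using subfield_diff[OF _ subfield_one subfield_one] by fastforce

lemma subfield_minus: "is_subfield F \<Longrightarrow> x \<in> F \<Longrightarrow> - x \<in> F"
  using subfield_diff[OF _ subfield_zero, of F x] by simp

lemma subfield_add: "is_subfield F \<Longrightarrow> x \<in> F \<Longrightarrow> y \<in> F \<Longrightarrow> x + y \<in> F"
  using subfield_diff[of F x "- y"] subfield_minus by simp

lemma subfield_of_nat: "is_subfield F \<Longrightarrow> of_nat n \<in> F"
  by (induction n) (auto intro: subfield_zero subfield_one subfield_add)

lemma subfield_of_int: "is_subfield F \<Longrightarrow> of_int n \<in> F"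
  by (cases n) (auto intro!: subfield_minus subfield_of_nat simp del: of_nat_Suc)

lemma subfield_divide: "is_subfield F \<Longrightarrow> x \<in> F \<Longrightarrow> y \<in> F \<Longrightarrow> x / y \<in> F"
  by (simp add: divide_inverse subfield_mult subfield_inverse)

lemma subfield_of_rat: "is_subfield F \<Longrightarrow> of_rat r \<in> F"
  by (cases r) (simp add: of_rat_rat subfield_divide subfield_of_int)

lemma subfield_Rats: "is_subfield F \<Longrightarrow> x \<in> \<rat> \<Longrightarrow> x \<in> F"
  by (auto elim!: Rats_cases intro: subfield_of_rat)

lemma subfield_power: "is_subfield F \<Longrightarrow> x \<in> F \<Longrightarrow> x ^ n \<in> F"
  by (induction n) (auto intro: subfield_one subfield_mult)

lemma subfield_sum: "is_subfield F \<Longrightarrow> (\<And>i. i \<in> I \<Longrightarrow> f i \<in> F) \<Longrightarrow> sum f I \<in> F"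
  by (induction I rule: infinite_finite_induct) (auto intro: subfield_zero subfield_add)

lemma integers_closed:
  assumes "is_subfield F"
  shows integers_diff: "\<And>x y. x \<in> ring_of_integers F \<Longrightarrow> y \<in> ring_of_integers F \<Longrightarrow>
      x - y \<in> ring_of_integers F"
    and integers_mult: "\<And>x y. x \<in> ring_of_integers F \<Longrightarrow> y \<in> ring_of_integers F \<Longrightarrow>
      x * y \<in> ring_of_integers F"
    and integers_of_int: "\<And>k. of_int k \<in> ring_of_integers F"
  unfolding ring_of_integers_def
  using assms by (auto intro: subfield_diff subfield_mult subfield_of_int)

locale subfield_hom =
  fixes F :: "complex set" and g :: "complex \<Rightarrow> complex"
  assumes F: "is_subfield F" and hom_one: "g 1 = 1"
    and hom_add: "\<And>x y. x \<in> F \<Longrightarrow> y \<in> F \<Longrightarrow> g (x + y) = g x + g y"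
    and hom_mult: "\<And>x y. x \<in> F \<Longrightarrow> y \<in> F \<Longrightarrow> g (x * y) = g x * g y"
begin

lemma hom_zero: "g 0 = 0"
  using hom_add[of 0 0] subfield_zero[OF F] by simp

lemma hom_minus: "x \<in> F \<Longrightarrow> g (- x) = - g x"
  using hom_add[of x "- x"] subfield_minus[OF F] hom_zero by (simp add: minus_unique)

lemma hom_diff: "x \<in> F \<Longrightarrow> y \<in> F \<Longrightarrow> g (x - y) = g x - g y"
  using hom_add[of x "- y"] hom_minus[of y] subfield_minus[OF F] by simp

lemma hom_of_nat: "g (of_nat n) = of_nat n"
  by (induction n) (auto simp: hom_zero hom_one hom_add subfield_one[OF F] subfield_of_nat[OF F])

lemma hom_of_int: "g (of_int k) = of_int k"
  by (cases k rule: int_cases2) (auto simp: hom_of_nat hom_minus subfield_of_nat[OF F])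

lemma hom_power: "x \<in> F \<Longrightarrow> g (x ^ n) = g x ^ n"
  by (induction n) (auto simp: hom_one hom_mult subfield_power[OF F])

lemma hom_sum: "(\<And>i. i \<in> I \<Longrightarrow> f i \<in> F) \<Longrightarrow> g (sum f I) = (\<Sum>i\<in>I. g (f i))"
  by (induction I rule: infinite_finite_induct) (auto simp: hom_zero hom_add subfield_sum[OF F])

lemma int_poly_in_subfield: "x \<in> F \<Longrightarrow> poly (map_poly of_int p) x \<in> F"
  by (induction p) (auto simp: of_int_hom.map_poly_pCons_hom
    intro!: subfield_zero F subfield_add subfield_mult subfield_of_int)

lemma hom_of_int_poly: "x \<in> F \<Longrightarrow> g (poly (map_poly of_int p) x) = poly (map_poly of_int p) (g x)"
  by (induction p) (auto simp: of_int_hom.map_poly_pCons_hom hom_zero hom_add hom_mult hom_of_int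
    int_poly_in_subfield subfield_mult[OF F] subfield_of_int[OF F])

lemma hom_algebraic_int: "x \<in> F \<Longrightarrow> algebraic_int x \<Longrightarrow> algebraic_int (g x)"
  unfolding algebraic_int_altdef_ipoly using hom_of_int_poly hom_zero by metis

lemma hom_nil_mod:
  assumes x: "x \<in> F" "nil_mod p x"
  shows "nil_mod p (g x)"
proof -
  obtain n where n: "algebraic_int (x ^ n / of_int p)" using x(2) unfolding nil_mod_def by blast
  have xn: "x ^ n / of_int p \<in> F" by (intro subfield_divide subfield_power subfield_of_int F x(1))
  then have "g (x ^ n / of_int p * of_int p) = g (x ^ n / of_int p) * of_int p"
    by (simp only: hom_mult[OF _ subfield_of_int[OF F]] hom_of_int)
  then have "p \<noteq> 0 \<Longrightarrow> g (x ^ n / of_int p) = g x ^ n / of_int p"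
    by (simp add: field_simps hom_power x(1))
  moreover have "algebraic_int (g (x ^ n / of_int p))"
    by (rule hom_algebraic_int[OF xn n])
  ultimately have "algebraic_int (g x ^ n / of_int p)" by (cases "p = 0") auto
  then show ?thesis using hom_algebraic_int[OF x(1)] x(2) unfolding nil_mod_def by blast
qed

end

lemma embedding_subfield_hom: "is_subfield F \<Longrightarrow> \<sigma> \<in> embeddings F \<Longrightarrow> subfield_hom F \<sigma>"
  unfolding embeddings_def subfield_hom_def by auto

lemma field_trace_int_linear:
  assumes F: "is_subfield F" and f: "\<And>i. i \<in> I \<Longrightarrow> f i \<in> F"
  shows "field_trace F (\<Sum>i\<in>I. of_int (c i) * f i) = (\<Sum>i\<in>I. of_int (c i) * field_trace F (f i))"
proof -
  have "\<sigma> (\<Sum>i\<in>I. of_int (c i) * f i) = (\<Sum>i\<in>I. of_int (c i) * \<sigma> (f i))"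
    if "\<sigma> \<in> embeddings F" for \<sigma>
  proof -
    interpret subfield_hom F \<sigma> by (rule embedding_subfield_hom[OF F that])
    have "\<sigma> (\<Sum>i\<in>I. of_int (c i) * f i) = (\<Sum>i\<in>I. \<sigma> (of_int (c i) * f i))"
      by (rule hom_sum) (auto intro: subfield_mult subfield_of_int F f)
    also have "\<dots> = (\<Sum>i\<in>I. of_int (c i) * \<sigma> (f i))"
      by (intro sum.cong) (auto simp: hom_mult subfield_of_int[OF F] f hom_of_int)
    finally show ?thesis .
  qed
  then have "field_trace F (\<Sum>i\<in>I. of_int (c i) * f i) =
      (\<Sum>\<sigma>\<in>embeddings F. \<Sum>i\<in>I. of_int (c i) * \<sigma> (f i))"
    unfolding field_trace_def by (intro sum.cong) auto
  also have "\<dots> = (\<Sum>i\<in>I. \<Sum>\<sigma>\<in>embeddings F. of_int (c i) * \<sigma> (f i))"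
    by (rule sum.swap)
  finally show ?thesis unfolding field_trace_def by (simp add: sum_distrib_left)
qed

lemma field_trace_algebraic_int:
  assumes F: "is_subfield F" and x: "x \<in> ring_of_integers F"
  shows "algebraic_int (field_trace F x)"
  unfolding field_trace_def
proof (rule algebraic_int_sum)
  fix \<sigma> assume "\<sigma> \<in> embeddings F"
  then show "algebraic_int (\<sigma> x)"
    using subfield_hom.hom_algebraic_int[OF embedding_subfield_hom[OF F]] x
    by (auto simp: ring_of_integers_def)
qed

lemma field_trace_nil_mod:
  assumes F: "is_subfield F" and x: "x \<in> F" "nil_mod p x"
  shows "nil_mod p (field_trace F x)"
  unfolding field_trace_def
  using subfield_hom.hom_nil_mod[OF embedding_subfield_hom[OF F] x] by (intro nil_mod_sum)

abbreviation trace_matrix :: "complex set \<Rightarrow> complex list \<Rightarrow> complex mat" where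
  "trace_matrix F ws \<equiv>
    mat (length ws) (length ws) (\<lambda>(i, j). field_trace F (ws ! i * ws ! j))"

lemma integral_basis_nth:
  "integral_basis F ws \<Longrightarrow> i < length ws \<Longrightarrow> ws ! i \<in> ring_of_integers F"
  unfolding integral_basis_def by (meson nth_mem subsetD)

lemma integral_basis_change:
  assumes "integral_basis F ws" "integral_basis F ws'"
  obtains P where "\<And>i. i < length ws \<Longrightarrow> ws ! i = int_comb (P i) ws'"
proof -
  have "\<forall>i. \<exists>c. i < length ws \<longrightarrow> ws ! i = int_comb c ws'"
    using integral_basis_repr[OF assms(2) integral_basis_nth[OF assms(1)]] by blast
  then show ?thesis using that by metis
qed

lemma integral_basis_change_inverse:
  assumes F: "is_subfield F" and ws: "integral_basis F ws"
    and P: "\<And>i. i < length ws \<Longrightarrow> ws ! i = int_comb (P i) ws'"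
    and Q: "\<And>j. j < length ws' \<Longrightarrow> ws' ! j = int_comb (Q j) ws"
    and i: "i < length ws" and k: "k < length ws"
  shows "(\<Sum>j<length ws'. P i j * Q j k) = (if i = k then 1 else 0)"
proof (rule integral_basis_unique[OF ws _ _ k])
  have "int_comb (\<lambda>k. \<Sum>j<length ws'. P i j * Q j k) ws =
      (\<Sum>j<length ws'. \<Sum>k<length ws. of_int (P i j * Q j k) * ws ! k)"
    by (simp add: sum_distrib_right) (rule sum.swap)
  also have "\<dots> = (\<Sum>j<length ws'. of_int (P i j) * ws' ! j)"
    by (intro sum.cong refl) (simp add: Q sum_distrib_left mult.assoc)
  also have "\<dots> = ws ! i" using P[OF i] ..
  finally have *: "int_comb (\<lambda>k. \<Sum>j<length ws'. P i j * Q j k) ws = ws ! i" .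
  then show "int_comb (\<lambda>k. \<Sum>j<length ws'. P i j * Q j k) ws \<in> ring_of_integers F"
    using integral_basis_nth[OF ws i] by simp
  have "int_comb (\<lambda>k. if i = k then 1 else 0) ws = (\<Sum>k<length ws. if i = k then ws ! k else 0)"
    by (intro sum.cong) auto
  also have "\<dots> = ws ! i" using i by simp
  finally show "int_comb (\<lambda>k. \<Sum>j<length ws'. P i j * Q j k) ws =
      int_comb (\<lambda>k. if i = k then 1 else 0) ws" using * by simp
qed

text \<open>
  Two bases are related by integer matrices \<open>P\<close> and \<open>Q\<close> that are inverse to each other. The equality
  of the traces of \<open>P Q\<close> and \<open>Q P\<close> forces the bases to have equal length, and then \<open>det P = \<plusminus>1\<close>
  enters the determinant of the trace form squared.
\<close>

lemma det_trace_matrix_unique: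
  assumes F: "is_subfield F" and ws: "integral_basis F ws" and ws': "integral_basis F ws'"
  shows "det (trace_matrix F ws) = det (trace_matrix F ws')"
proof -
  define n where "n = length ws"
  obtain P where P: "\<And>i. i < length ws \<Longrightarrow> ws ! i = int_comb (P i) ws'"
    using integral_basis_change[OF ws ws'] by blast
  obtain Q where Q: "\<And>i. i < length ws' \<Longrightarrow> ws' ! i = int_comb (Q i) ws"
    using integral_basis_change[OF ws' ws] by blast
  have "int (length ws) = (\<Sum>i<length ws. \<Sum>j<length ws'. P i j * Q j i)"
    by (simp add: integral_basis_change_inverse[OF F ws P Q])
  also have "\<dots> = (\<Sum>j<length ws'. \<Sum>i<length ws. Q j i * P i j)"
    by (subst sum.swap) (simp add: mult.commute)
  also have "\<dots> = int (length ws')"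
    by (simp add: integral_basis_change_inverse[OF F ws' Q P])
  finally have n': "length ws' = n" unfolding n_def by simp
  define MP where "MP = mat n n (\<lambda>(i, j). P i j)"
  define MQ where "MQ = mat n n (\<lambda>(i, j). Q i j)"
  have carr: "MP \<in> carrier_mat n n" "MQ \<in> carrier_mat n n" unfolding MP_def MQ_def by auto
  have "MP * MQ = 1\<^sub>m n"
    using integral_basis_change_inverse[OF F ws P Q] n'
    by (intro eq_matI) (auto simp: MP_def MQ_def scalar_prod_def n_def lessThan_atLeast0)
  then have "det MP * det MQ = 1" using det_mult[OF carr] by simp
  then have sq: "det MP * det MP = 1"
    by (metis zmult_eq_1_iff mult_minus_left mult_minus_right mult_1 minus_minus)
  define MP' :: "complex mat" where "MP' = map_mat of_int MP"
  have MP': "MP' \<in> carrier_mat n n" using carr unfolding MP'_def by simp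
  have det': "det MP' = of_int (det MP)" unfolding MP'_def by simp
  have T': "trace_matrix F ws' \<in> carrier_mat n n" using n' by simp
  have wsF: "ws' ! j * ws' ! l \<in> F" if "j < n" "l < n" for j l
    using integral_basis_nth[OF ws'] that n' F
    by (auto simp: ring_of_integers_def intro: subfield_mult)
  have "trace_matrix F ws = MP' * (trace_matrix F ws' * transpose_mat MP')"
  proof (rule eq_matI)
    fix i k assume "i < dim_row (MP' * (trace_matrix F ws' * transpose_mat MP'))"
      "k < dim_col (MP' * (trace_matrix F ws' * transpose_mat MP'))"
    then have ik: "i < n" "k < n" using MP' by auto
    have "ws ! i * ws ! k = (\<Sum>j<n. of_int (P i j) * ws' ! j) * (\<Sum>l<n. of_int (P k l) * ws' ! l)"
      using P[of i] P[of k] ik n' by (simp add: n_def)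
    also have "\<dots> = (\<Sum>j<n. of_int (P i j) * (\<Sum>l<n. of_int (P k l) * (ws' ! j * ws' ! l)))"
      unfolding sum_product by (intro sum.cong refl) (simp add: sum_distrib_left mult_ac)
    finally have ww: "ws ! i * ws ! k =
        (\<Sum>j<n. of_int (P i j) * (\<Sum>l<n. of_int (P k l) * (ws' ! j * ws' ! l)))" .
    have inner: "(\<Sum>l<n. of_int (P k l) * (ws' ! j * ws' ! l)) \<in> F" if "j < n" for j
      by (intro subfield_sum[OF F] subfield_mult[OF F subfield_of_int[OF F]]) (use that wsF in auto)
    have "field_trace F (ws ! i * ws ! k) =
        (\<Sum>j<n. of_int (P i j) * field_trace F (\<Sum>l<n. of_int (P k l) * (ws' ! j * ws' ! l)))"
      unfolding ww by (rule field_trace_int_linear[OF F]) (use inner in auto)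
    also have "\<dots> = (\<Sum>j<n. of_int (P i j) *
        (\<Sum>l<n. of_int (P k l) * field_trace F (ws' ! j * ws' ! l)))"
      by (intro sum.cong refl arg_cong2[of _ _ _ _ "(*)"] field_trace_int_linear[OF F]) (auto simp: wsF)
    finally have "field_trace F (ws ! i * ws ! k) = (\<Sum>j<n. of_int (P i j) *
        (\<Sum>l<n. of_int (P k l) * field_trace F (ws' ! j * ws' ! l)))" .
    then show "trace_matrix F ws $$ (i, k) =
        (MP' * (trace_matrix F ws' * transpose_mat MP')) $$ (i, k)"
      using ik n' by (simp add: n_def[symmetric] scalar_prod_def MP'_def MP_def lessThan_atLeast0 mult.commute)
  qed (use MP' in \<open>auto simp: n_def\<close>)
  then have "det (trace_matrix F ws) = det MP' * (det (trace_matrix F ws') * det MP')"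
    using MP' T' by (simp add: det_mult[of _ n] det_transpose[of _ n])
  also have "\<dots> = of_int (det MP * det MP) * det (trace_matrix F ws')"
    unfolding det' by simp
  finally show ?thesis unfolding sq by simp
qed

text \<open>
  If \<open>x\<close> is nilpotent modulo \<open>p\<close>, so is \<open>x w\<close> for every integral \<open>w\<close>, and its trace is a rational
  integer that is nilpotent modulo \<open>p\<close>, that is, divisible by \<open>p\<close>. So the coordinates of \<open>x\<close> lie in
  the kernel of the trace form modulo \<open>p\<close>; they do not all vanish there if \<open>x\<close> is not divisible
  by \<open>p\<close>. This is the ramification criterion in the form in which it is needed here.
\<close>

lemma prime_dvd_discriminant:
  assumes F: "is_subfield F" and ws: "integral_basis F ws"
    and rat: "\<And>x. x \<in> ring_of_integers F \<Longrightarrow> field_trace F x \<in> \<rat>"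
    and p: "prime p" and x: "x \<in> F" "nil_mod p x" and ndvd: "\<not> algebraic_int (x / of_int p)"
  shows "p dvd field_discriminant F"
proof -
  define n where "n = length ws"
  have wsO: "ws ! i \<in> ring_of_integers F" if "i < n" for i
    using integral_basis_nth[OF ws] that unfolding n_def .
  have wsF: "ws ! i \<in> F" and wsA: "algebraic_int (ws ! i)" if "i < n" for i
    using wsO[OF that] by (auto simp: ring_of_integers_def)
  have "\<exists>t. field_trace F (ws ! i * ws ! j) = of_int t" if ij: "i < n" "j < n" for i j
    using rational_algebraic_int_obtain[OF field_trace_algebraic_int[OF F] rat]
      integers_mult[OF F wsO wsO, OF ij] by blast
  then obtain t where t: "\<And>i j. i < n \<Longrightarrow> j < n \<Longrightarrow> field_trace F (ws ! i * ws ! j) = of_int (t i j)"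
    by metis
  define T where "T = mat n n (\<lambda>(i, j). t i j)"
  have T: "T \<in> carrier_mat n n" unfolding T_def by simp
  have "trace_matrix F ws = map_mat of_int T"
    by (intro eq_matI) (auto simp: T_def n_def[symmetric] t)
  then have det: "of_int (det T) = det (trace_matrix F ws)" by simp
  have "field_discriminant F = det T"
    unfolding field_discriminant_def
  proof (rule the_equality)
    show "\<exists>ws. integral_basis F ws \<and> of_int (det T) = det (trace_matrix F ws)" using ws det by blast
  next
    fix D assume "\<exists>ws. integral_basis F ws \<and> of_int D = det (trace_matrix F ws)"
    then have "(of_int D :: complex) = of_int (det T)"
      using det_trace_matrix_unique[OF F ws] det by metis
    then show "D = det T" by simp
  qed
  moreover have "p dvd det T"
  proof -
    have "x \<in> ring_of_integers F" using x by (simp add: ring_of_integers_def nil_mod_algebraic_int)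
    then obtain c where c: "x = int_comb c ws" using integral_basis_repr[OF ws] by blast
    have p0: "p \<noteq> 0" using p by auto
    \<comment> \<open>\<open>x\<close> is not divisible by \<open>p\<close>, so one of its coordinates is not\<close>
    obtain i where i: "i < n" "\<not> p dvd c i"
    proof (rule ccontr)
      assume "\<not> thesis"
      then have "\<forall>i. \<exists>e. i < n \<longrightarrow> c i = p * e" using that by blast
      then obtain e where e: "\<And>i. i < n \<Longrightarrow> c i = p * e i" by metis
      have "x = of_int p * (\<Sum>i<n. of_int (e i) * ws ! i)"
        unfolding c n_def[symmetric] sum_distrib_left by (intro sum.cong) (auto simp: e)
      then have "x / of_int p = (\<Sum>i<n. of_int (e i) * ws ! i)" using p0 by simp
      moreover have "algebraic_int (\<Sum>i<n. of_int (e i) * ws ! i)"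
        by (intro algebraic_int_sum algebraic_int_mult) (auto simp: wsA)
      ultimately show False using ndvd by simp
    qed
    have "p dvd (\<Sum>j<n. t k j * c j)" if k: "k < n" for k
    proof (rule nil_mod_of_intD[OF p])
      have "of_int (\<Sum>j<n. t k j * c j) = (\<Sum>j<n. of_int (c j) * field_trace F (ws ! k * ws ! j))"
        using k by (simp add: t) (simp add: mult.commute)
      also have "\<dots> = field_trace F (\<Sum>j<n. of_int (c j) * (ws ! k * ws ! j))"
        by (rule field_trace_int_linear[OF F, symmetric]) (use k in \<open>auto intro: subfield_mult F wsF\<close>)
      also have "(\<Sum>j<n. of_int (c j) * (ws ! k * ws ! j)) = ws ! k * x"
        unfolding c n_def[symmetric] sum_distrib_left by (intro sum.cong) auto
      finally show "nil_mod p (of_int (\<Sum>j<n. t k j * c j))"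
        using field_trace_nil_mod[OF F _ nil_mod_mult[OF x(2) wsA[OF k]]] subfield_mult[OF F wsF[OF k] x(1)]
        by simp
    qed
    then obtain s where s: "\<And>k. k < n \<Longrightarrow> (\<Sum>j<n. t k j * c j) = p * s k" unfolding dvd_def by metis
    \<comment> \<open>\<open>T c\<close> vanishes modulo \<open>p\<close>; multiplying by the adjugate of \<open>T\<close> gives \<open>det T \<cdot> c\<close>\<close>
    have adj: "adj_mat T \<in> carrier_mat n n" "adj_mat T * T = det T \<cdot>\<^sub>m 1\<^sub>m n"
      using adj_mat[OF T] by auto
    define v where "v = vec n c"
    have v: "v \<in> carrier_vec n" unfolding v_def by simp
    have "((det T \<cdot>\<^sub>m 1\<^sub>m n) *\<^sub>v v) $ i = (\<Sum>j = 0..<n. det T * (if j = i then 1 else 0) * c j)"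
      using i(1) by (simp add: v_def scalar_prod_def)
    also have "\<dots> = (\<Sum>j = 0..<n. if j = i then det T * c j else 0)"
      by (intro sum.cong) auto
    finally have "det T * c i = ((det T \<cdot>\<^sub>m 1\<^sub>m n) *\<^sub>v v) $ i"
      using i(1) by simp
    also have "(det T \<cdot>\<^sub>m 1\<^sub>m n) *\<^sub>v v = adj_mat T *\<^sub>v (T *\<^sub>v v)"
      unfolding adj(2)[symmetric] by (rule assoc_mult_mat_vec[OF adj(1) T v])
    also have "T *\<^sub>v v = vec n (\<lambda>k. p * s k)"
      by (intro eq_vecI) (auto simp: T_def v_def scalar_prod_def s[symmetric] lessThan_atLeast0)
    also have "(adj_mat T *\<^sub>v vec n (\<lambda>k. p * s k)) $ i = p * (\<Sum>k<n. adj_mat T $$ (i, k) * s k)"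
      using i(1) adj(1) by (simp add: scalar_prod_def lessThan_atLeast0 sum_distrib_left mult.left_commute)
    finally have "p dvd det T * c i" by simp
    then show ?thesis using i(2) p by (simp add: prime_dvd_mult_iff)
  qed
  ultimately show ?thesis by simp
qed

section \<open>The simplest quartic field and its Galois group\<close>

lemma real_if_square_nonneg_real:
  fixes z :: complex
  assumes "z ^ 2 = of_real r" "r \<ge> 0"
  shows "z \<in> \<real>"
proof -
  have "z ^ 2 = (of_real (sqrt r)) ^ 2" using assms by (simp flip: of_real_power)
  then have "z = of_real (sqrt r) \<or> z = - of_real (sqrt r)" by (rule power2_eq_iff[THEN iffD1])
  then show ?thesis by auto
qed

abbreviation quartic_comb :: "complex \<Rightarrow> complex \<Rightarrow> complex \<Rightarrow> complex \<Rightarrow> complex \<Rightarrow> complex \<Rightarrow> complex"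
  where "quartic_comb Y X r s t u \<equiv> r + s * Y + (t + u * Y) * X"

locale simplest_quartic =
  fixes a :: int and \<xi> :: complex
  assumes a_pos: "a > 0" and a_ne_3: "a \<noteq> 3"
    and root: "\<xi> ^ 4 - of_int a * \<xi> ^ 3 - 6 * \<xi> ^ 2 + of_int a * \<xi> + 1 = 0"
begin

text \<open>
  The quadratic subfield is generated by \<open>\<eta> = \<xi> - 1/\<xi>\<close>. The roots of \<open>f\<close> are \<open>\<xi>\<close>,
  \<open>\<xi>' = (\<xi> - 1)/(\<xi> + 1)\<close>, \<open>-1/\<xi> = \<eta> - \<xi>\<close> and \<open>-1/\<xi>'\<close>; below \<open>\<xi>'\<close> is written in the basis
  \<open>1, \<eta>, \<xi>, \<eta> \<xi>\<close> of \<open>L\<close>. The number \<open>\<rho> = \<eta> - \<eta>'\<close> is a square root of \<open>m\<close>. The automorphism \<open>\<sigma>\<close> maps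
  \<open>\<eta>\<close> to \<open>\<eta>'\<close> and \<open>\<xi>\<close> to \<open>\<xi>'\<close>; it is multiplicative because \<open>\<xi>'\<close> satisfies over \<open>\<eta>'\<close> the quadratic
  equation that \<open>\<xi>\<close> satisfies over \<open>\<eta>\<close>.
\<close>

definition m :: int where "m = a ^ 2 + 16"
definition \<eta> :: complex where "\<eta> = \<xi> - 1 / \<xi>"
definition \<eta>' :: complex where "\<eta>' = of_int a - \<eta>"
definition \<xi>' :: complex where "\<xi>' = - 1 - (\<xi> - 1) * \<eta>' / 2"
definition \<rho> :: complex where "\<rho> = 2 * \<eta> - of_int a"

definition L :: "complex set" where
  "L = {quartic_comb \<eta> \<xi> r s t u | r s t u. r \<in> \<rat> \<and> s \<in> \<rat> \<and> t \<in> \<rat> \<and> u \<in> \<rat>}"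

definition \<sigma> :: "complex \<Rightarrow> complex" where
  "\<sigma> x = (THE z. \<exists>r\<in>\<rat>. \<exists>s\<in>\<rat>. \<exists>t\<in>\<rat>. \<exists>u\<in>\<rat>.
     x = quartic_comb \<eta> \<xi> r s t u \<and> z = quartic_comb \<eta>' \<xi>' r s t u)"

lemma m_pos: "m > 0" unfolding m_def by (simp add: add_nonneg_pos)

lemma xi_nonzero: "\<xi> \<noteq> 0" using root by auto

lemma eta_sq: "\<eta> ^ 2 = of_int a * \<eta> + 4"
proof -
  have "\<xi> ^ 2 * (\<eta> ^ 2 - of_int a * \<eta> - 4) =
      \<xi> ^ 4 - of_int a * \<xi> ^ 3 - 6 * \<xi> ^ 2 + of_int a * \<xi> + 1"
    using xi_nonzero unfolding \<eta>_def by (simp add: field_simps power2_eq_square power3_eq_cube power4_eq_xxxx)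
  then have "\<eta> ^ 2 - of_int a * \<eta> - 4 = 0" unfolding root using xi_nonzero by simp
  then show ?thesis by (simp add: algebra_simps)
qed

lemma xi_sq: "\<xi> ^ 2 = \<eta> * \<xi> + 1"
  using xi_nonzero unfolding \<eta>_def by (simp add: field_simps power2_eq_square)

lemma eta_add: "\<eta> + \<eta>' = of_int a" by (simp add: \<eta>'_def)

lemma eta_mult: "\<eta> * \<eta>' = - 4"
  using eta_sq unfolding \<eta>'_def by (simp add: algebra_simps power2_eq_square)

lemma eta'_sq: "\<eta>' ^ 2 = of_int a * \<eta>' + 4"
  using eta_sq unfolding \<eta>'_def by (simp add: algebra_simps power2_eq_square)

lemma xi'_sq: "\<xi>' ^ 2 = \<eta>' * \<xi>' + 1"
proof -
  have "\<xi>' ^ 2 - \<eta>' * \<xi>' - 1 =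
      \<eta>' ^ 2 / 4 * (\<xi> ^ 2 - \<eta> * \<xi> - 1) + \<xi> * \<eta>' / 4 * (\<eta> * \<eta>' + 4)"
    unfolding \<xi>'_def by (simp add: field_simps power2_eq_square)
  then show ?thesis using xi_sq eta_mult by (simp add: algebra_simps)
qed

lemma rho_eq: "\<rho> = \<eta> - \<eta>'" by (simp add: \<rho>_def \<eta>'_def)

lemma rho_sq: "\<rho> ^ 2 = of_int m"
proof -
  have "\<rho> ^ 2 = 4 * (\<eta> ^ 2 - of_int a * \<eta>) + of_int a ^ 2"
    unfolding \<rho>_def by (simp add: algebra_simps power2_eq_square)
  then show ?thesis unfolding eta_sq m_def by simp
qed

lemma norm_eta_sq_plus_4: "(\<eta> ^ 2 + 4) * (\<eta>' ^ 2 + 4) = 4 * of_int m"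
proof -
  have "(\<eta> ^ 2 + 4) * (\<eta>' ^ 2 + 4) = (\<eta> * \<eta>') ^ 2 + 4 * ((\<eta> + \<eta>') ^ 2 - 2 * (\<eta> * \<eta>')) + 16"
    by (simp add: algebra_simps power2_eq_square)
  then show ?thesis unfolding eta_mult eta_add m_def by simp
qed

lemma xi_disc: "(2 * \<xi> - \<eta>) ^ 2 = \<eta> ^ 2 + 4"
proof -
  have "(2 * \<xi> - \<eta>) ^ 2 = 4 * (\<xi> ^ 2 - \<eta> * \<xi>) + \<eta> ^ 2"
    by (simp add: algebra_simps power2_eq_square)
  then show ?thesis unfolding xi_sq by simp
qed

lemma eta_real: "\<eta> \<in> \<real>"
proof -
  have "\<rho> \<in> \<real>"
    by (rule real_if_square_nonneg_real[of _ "real_of_int m"]) (use rho_sq m_pos in auto)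
  then have "(\<rho> + of_int a) / 2 \<in> \<real>" by (intro Reals_divide Reals_add) auto
  then show ?thesis by (simp add: \<rho>_def)
qed

lemma xi_real: "\<xi> \<in> \<real>"
proof -
  obtain e where e: "\<eta> = of_real e" using eta_real by (auto elim: Reals_cases)
  have "2 * \<xi> - \<eta> \<in> \<real>"
    by (rule real_if_square_nonneg_real[of _ "e ^ 2 + 4"]) (use xi_disc e in simp_all)
  then have "(2 * \<xi> - \<eta> + \<eta>) / 2 \<in> \<real>" by (intro Reals_divide Reals_add eta_real) auto
  then show ?thesis by simp
qed

lemma m_not_square: "z ^ 2 \<noteq> of_int m" if "z \<in> \<rat>" for z :: complex
proof
  assume z: "z ^ 2 = of_int m"
  then have "algebraic_int z" by (metis algebraic_int_of_int algebraic_int_sqrt_complex)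
  then obtain k where "z = of_int k" using rational_algebraic_int_obtain \<open>z \<in> \<rat>\<close> by blast
  then have "(of_int (k ^ 2) :: complex) = of_int m" using z by simp
  then have "k ^ 2 = m" by (simp only: of_int_eq_iff)
  define l where "l = \<bar>k\<bar>"
  have l: "l ^ 2 = a ^ 2 + 16" "l \<ge> 0" using \<open>k ^ 2 = m\<close> unfolding m_def l_def by auto
  \<comment> \<open>\<open>(l - a) (l + a) = 16\<close> bounds \<open>a\<close>, and \<open>a = 3\<close> is the only solution\<close>
  have "a ^ 2 < l ^ 2" unfolding l(1) by simp
  then have "l \<ge> a + 1" using power2_less_imp_less[of a l] l(2) by linarith
  then have "l ^ 2 \<ge> (a + 1) ^ 2" using a_pos by (intro power_mono) auto
  then have "a \<le> 7" using l by (simp add: power2_eq_square algebra_simps)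
  then have "a \<in> {1, 2, 4, 5, 6, 7}" using a_pos a_ne_3 by auto
  moreover have "l \<le> 9"
  proof (rule ccontr)
    assume "\<not> l \<le> 9"
    then have "l ^ 2 \<ge> 10 ^ 2" by (intro power_mono) auto
    moreover have "a ^ 2 \<le> 7 ^ 2" using \<open>a \<le> 7\<close> a_pos by (intro power_mono) auto
    ultimately show False using l by simp
  qed
  then have "l = 0 \<or> l = 1 \<or> l = 2 \<or> l = 3 \<or> l = 4 \<or> l = 5 \<or> l = 6 \<or> l = 7 \<or> l = 8 \<or> l = 9"
    using l(2) by presburger
  ultimately show False using l(1) by auto
qed

lemma eta_independent:
  assumes "r \<in> \<rat>" "s \<in> \<rat>" "r + s * \<eta> = 0"
  shows "r = 0 \<and> s = 0"
proof (cases "s = 0")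
  case False
  then have "\<eta> = - r / s" using assms(3) by (simp add: field_simps add_eq_0_iff)
  then have "\<rho> \<in> \<rat>" using assms unfolding \<rho>_def by auto
  then show ?thesis using m_not_square rho_sq by blast
qed (use assms in auto)

text \<open>
  The discriminant \<open>\<eta>\<^sup>2 + 4\<close> of the quadratic equation of \<open>\<xi>\<close> is no square in the quadratic subfield,
  since its norm \<open>4 m\<close> is no rational square.
\<close>

lemma xi_not_in_quadratic:
  assumes "p \<in> \<rat>" "q \<in> \<rat>"
  shows "\<xi> \<noteq> p + q * \<eta>"
proof
  assume "\<xi> = p + q * \<eta>"
  then have pq: "p + q * \<eta> = \<xi>" ..
  define P where "P = 2 * p"
  define Q where "Q = 2 * q - 1"
  have PQ: "P \<in> \<rat>" "Q \<in> \<rat>" using assms unfolding P_def Q_def by auto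
  have "P + Q * \<eta> = 2 * (p + q * \<eta>) - \<eta>" unfolding P_def Q_def by (simp add: algebra_simps)
  then have "P + Q * \<eta> = 2 * \<xi> - \<eta>" unfolding pq .
  then have "(P + Q * \<eta>) ^ 2 = of_int a * \<eta> + 8" using xi_disc eta_sq by simp
  moreover have "(P + Q * \<eta>) ^ 2 = P ^ 2 + 4 * Q ^ 2 + (2 * P * Q + of_int a * Q ^ 2) * \<eta> +
      Q ^ 2 * (\<eta> ^ 2 - of_int a * \<eta> - 4)"
    by (simp add: algebra_simps power2_eq_square)
  ultimately have "(P ^ 2 + 4 * Q ^ 2 - 8) + (2 * P * Q + of_int a * Q ^ 2 - of_int a) * \<eta> = 0"
    using eta_sq by (simp add: algebra_simps)
  then have "P ^ 2 + 4 * Q ^ 2 - 8 = 0 \<and> 2 * P * Q + of_int a * Q ^ 2 - of_int a = 0"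
    by (intro eta_independent) (use PQ in auto)
  then have X: "P ^ 2 + 4 * Q ^ 2 = 8" and Y: "2 * P * Q + of_int a * Q ^ 2 = of_int a" by auto
  \<comment> \<open>the norm of \<open>P + Q \<eta>\<close> is \<open>P\<^sup>2 + a P Q - 4 Q\<^sup>2\<close>, and the norm is multiplicative\<close>
  have "(P ^ 2 + of_int a * P * Q - 4 * Q ^ 2) ^ 2 = (P ^ 2 + 4 * Q ^ 2) ^ 2 +
      of_int a * (P ^ 2 + 4 * Q ^ 2) * (2 * P * Q + of_int a * Q ^ 2) -
      4 * (2 * P * Q + of_int a * Q ^ 2) ^ 2"
    by (simp add: algebra_simps power2_eq_square)
  also have "\<dots> = 4 * of_int m" unfolding X Y m_def by (simp add: power2_eq_square)
  finally have "((P ^ 2 + of_int a * P * Q - 4 * Q ^ 2) / 2) ^ 2 = of_int m"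
    by (simp add: power_divide)
  moreover have "(P ^ 2 + of_int a * P * Q - 4 * Q ^ 2) / 2 \<in> \<rat>" using PQ by auto
  ultimately show False using m_not_square by blast
qed

lemma two_xi_ne_eta: "2 * \<xi> - \<eta> \<noteq> 0"
proof
  assume "2 * \<xi> - \<eta> = 0"
  then have "\<xi> = 0 + 1/2 * \<eta>" by (simp add: field_simps)
  then show False using xi_not_in_quadratic[of 0 "1/2"] by simp
qed

lemma eta_divide:
  assumes "r \<in> \<rat>" "s \<in> \<rat>" "t \<in> \<rat>" "u \<in> \<rat>" "t + u * \<eta> \<noteq> 0"
  shows "\<exists>p\<in>\<rat>. \<exists>q\<in>\<rat>. (r + s * \<eta>) / (t + u * \<eta>) = p + q * \<eta>"
proof -
  define n where "n = t ^ 2 + of_int a * t * u - 4 * u ^ 2"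
  have n: "(t + u * \<eta>) * ((t + of_int a * u) - u * \<eta>) = n"
  proof -
    have "(t + u * \<eta>) * ((t + of_int a * u) - u * \<eta>) = n - u ^ 2 * (\<eta> ^ 2 - of_int a * \<eta> - 4)"
      unfolding n_def by (simp add: algebra_simps power2_eq_square)
    then show ?thesis using eta_sq by simp
  qed
  have "(t + of_int a * u) - u * \<eta> \<noteq> 0"
    using eta_independent[of "t + of_int a * u" "- u"] assms by auto
  then have n0: "n \<noteq> 0" using n assms(5) by (metis mult_eq_0_iff)
  have "(r + s * \<eta>) / (t + u * \<eta>) = (r + s * \<eta>) * ((t + of_int a * u) - u * \<eta>) / n"
    unfolding n[symmetric] using \<open>(t + of_int a * u) - u * \<eta> \<noteq> 0\<close> by simp
  also have "(r + s * \<eta>) * ((t + of_int a * u) - u * \<eta>) =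
      (r * (t + of_int a * u) - 4 * s * u) + (s * t - r * u) * \<eta>
        - s * u * (\<eta> ^ 2 - of_int a * \<eta> - 4)"
    by (simp add: algebra_simps power2_eq_square)
  also have "\<dots> / n = (r * (t + of_int a * u) - 4 * s * u) / n + (s * t - r * u) / n * \<eta>"
    using eta_sq by (simp add: add_divide_distrib)
  finally show ?thesis
    by (intro bexI[of _ "(r * (t + of_int a * u) - 4 * s * u) / n"] bexI[of _ "(s * t - r * u) / n"])
      (use assms in \<open>auto simp: n_def\<close>)
qed

lemma quartic_independent:
  assumes "r \<in> \<rat>" "s \<in> \<rat>" "t \<in> \<rat>" "u \<in> \<rat>" "quartic_comb \<eta> \<xi> r s t u = 0"
  shows "r = 0 \<and> s = 0 \<and> t = 0 \<and> u = 0"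
proof (cases "t + u * \<eta> = 0")
  case True
  then show ?thesis using eta_independent[of t u] eta_independent[of r s] assms by auto
next
  case False
  then have "\<xi> = (- r + (- s) * \<eta>) / (t + u * \<eta>)"
    using assms(5) by (simp add: field_simps add_eq_0_iff)
  then show ?thesis using eta_divide[of "- r" "- s" t u] assms False xi_not_in_quadratic
    by (metis Rats_minus_iff)
qed

lemma quartic_unique:
  assumes "r \<in> \<rat>" "s \<in> \<rat>" "t \<in> \<rat>" "u \<in> \<rat>" "r' \<in> \<rat>" "s' \<in> \<rat>" "t' \<in> \<rat>" "u' \<in> \<rat>"
    and "quartic_comb \<eta> \<xi> r s t u = quartic_comb \<eta> \<xi> r' s' t' u'"
  shows "r = r' \<and> s = s' \<and> t = t' \<and> u = u'"
  using quartic_independent[of "r - r'" "s - s'" "t - t'" "u - u'"] assms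
  by (simp add: algebra_simps)

lemma sigma_comb:
  assumes "r \<in> \<rat>" "s \<in> \<rat>" "t \<in> \<rat>" "u \<in> \<rat>"
  shows "\<sigma> (quartic_comb \<eta> \<xi> r s t u) = quartic_comb \<eta>' \<xi>' r s t u"
  unfolding \<sigma>_def
proof (rule the_equality)
  show "\<exists>r'\<in>\<rat>. \<exists>s'\<in>\<rat>. \<exists>t'\<in>\<rat>. \<exists>u'\<in>\<rat>. quartic_comb \<eta> \<xi> r s t u = quartic_comb \<eta> \<xi> r' s' t' u' \<and>
      quartic_comb \<eta>' \<xi>' r s t u = quartic_comb \<eta>' \<xi>' r' s' t' u'"
    using assms by blast
next
  fix z assume "\<exists>r'\<in>\<rat>. \<exists>s'\<in>\<rat>. \<exists>t'\<in>\<rat>. \<exists>u'\<in>\<rat>.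
    quartic_comb \<eta> \<xi> r s t u = quartic_comb \<eta> \<xi> r' s' t' u' \<and> z = quartic_comb \<eta>' \<xi>' r' s' t' u'"
  then show "z = quartic_comb \<eta>' \<xi>' r s t u" using quartic_unique assms by metis
qed

lemma L_cases:
  assumes "x \<in> L"
  obtains r s t u where "r \<in> \<rat>" "s \<in> \<rat>" "t \<in> \<rat>" "u \<in> \<rat>" "x = quartic_comb \<eta> \<xi> r s t u"
  using assms unfolding L_def by blast

lemma L_intro: "r \<in> \<rat> \<Longrightarrow> s \<in> \<rat> \<Longrightarrow> t \<in> \<rat> \<Longrightarrow> u \<in> \<rat> \<Longrightarrow> quartic_comb \<eta> \<xi> r s t u \<in> L"
  unfolding L_def by blast

lemma quartic_comb_mult:
  assumes "Y ^ 2 = of_int a * Y + 4" "X ^ 2 = Y * X + 1"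
  shows "quartic_comb Y X r1 s1 t1 u1 * quartic_comb Y X r2 s2 t2 u2 = quartic_comb Y X
    (r1*r2 + 4*s1*s2 + t1*t2 + 4*u1*u2)
    (r1*s2 + s1*r2 + of_int a*s1*s2 + t1*u2 + u1*t2 + of_int a*u1*u2)
    (r1*t2 + 4*s1*u2 + t1*r2 + 4*u1*s2 + 4*(t1*u2 + u1*t2 + of_int a*u1*u2))
    (r1*u2 + s1*t2 + of_int a*s1*u2 + t1*s2 + u1*r2 + of_int a*u1*s2 + t1*t2 + 4*u1*u2
       + of_int a*(t1*u2 + u1*t2 + of_int a*u1*u2))" (is "?l = ?r")
proof -
  \<comment> \<open>expand the product and divide with remainder by the two quadratic relations\<close>
  have "?l = ?r + (t1 + u1*Y) * (t2 + u2*Y) * (X^2 - Y*X - 1)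
      + (s1*s2 + u1*u2 + (s1*u2 + u1*s2 + u1*u2*Y + (t1*u2 + u1*t2 + of_int a*u1*u2)) * X)
        * (Y^2 - of_int a*Y - 4)"
    by (simp add: algebra_simps power2_eq_square)
  then show ?thesis using assms by simp
qed

lemma L_Rats: "x \<in> \<rat> \<Longrightarrow> x \<in> L"
  using L_intro[of x 0 0 0] by simp

lemma L_of_int: "of_int k \<in> L" by (rule L_Rats) simp

lemma L_numeral: "numeral k \<in> L" by (rule L_Rats) simp

lemma L_eta: "\<eta> \<in> L"
  using L_intro[of 0 1 0 0] by simp

lemma L_xi: "\<xi> \<in> L"
  using L_intro[of 0 0 1 0] by simp

lemma sigma_Rats: "x \<in> \<rat> \<Longrightarrow> \<sigma> x = x"
  using sigma_comb[of x 0 0 0] by simp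

lemma sigma_eta: "\<sigma> \<eta> = \<eta>'"
  using sigma_comb[of 0 1 0 0] by simp

lemma sigma_xi: "\<sigma> \<xi> = \<xi>'"
  using sigma_comb[of 0 0 1 0] by simp

lemma L_add_sigma_add:
  assumes "x \<in> L" "y \<in> L"
  shows L_add: "x + y \<in> L" and sigma_add: "\<sigma> (x + y) = \<sigma> x + \<sigma> y"
proof -
  obtain r s t u where x: "r \<in> \<rat>" "s \<in> \<rat>" "t \<in> \<rat>" "u \<in> \<rat>" "x = quartic_comb \<eta> \<xi> r s t u"
    using L_cases[OF assms(1)] by blast
  obtain r' s' t' u' where y: "r' \<in> \<rat>" "s' \<in> \<rat>" "t' \<in> \<rat>" "u' \<in> \<rat>" "y = quartic_comb \<eta> \<xi> r' s' t' u'"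
    using L_cases[OF assms(2)] by blast
  have xy: "x + y = quartic_comb \<eta> \<xi> (r + r') (s + s') (t + t') (u + u')"
    unfolding x y by (simp add: algebra_simps)
  show "x + y \<in> L" unfolding xy by (rule L_intro) (use x y in auto)
  have sx: "\<sigma> x = quartic_comb \<eta>' \<xi>' r s t u" and sy: "\<sigma> y = quartic_comb \<eta>' \<xi>' r' s' t' u'"
    using x y sigma_comb by auto
  show "\<sigma> (x + y) = \<sigma> x + \<sigma> y"
    unfolding xy sx sy by (subst sigma_comb) (use x y in \<open>auto simp: algebra_simps\<close>)
qed

lemma L_mult_sigma_mult:
  assumes "x \<in> L" "y \<in> L"
  shows L_mult: "x * y \<in> L" and sigma_mult: "\<sigma> (x * y) = \<sigma> x * \<sigma> y"
proof -
  obtain r s t u where x: "r \<in> \<rat>" "s \<in> \<rat>" "t \<in> \<rat>" "u \<in> \<rat>" "x = quartic_comb \<eta> \<xi> r s t u"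
    using L_cases[OF assms(1)] by blast
  obtain r' s' t' u' where y: "r' \<in> \<rat>" "s' \<in> \<rat>" "t' \<in> \<rat>" "u' \<in> \<rat>" "y = quartic_comb \<eta> \<xi> r' s' t' u'"
    using L_cases[OF assms(2)] by blast
  have sx: "\<sigma> x = quartic_comb \<eta>' \<xi>' r s t u" and sy: "\<sigma> y = quartic_comb \<eta>' \<xi>' r' s' t' u'"
    using x y sigma_comb by auto
  show "x * y \<in> L" unfolding x(5) y(5) quartic_comb_mult[OF eta_sq xi_sq]
    by (rule L_intro) (use x y in auto)
  show "\<sigma> (x * y) = \<sigma> x * \<sigma> y" unfolding sx sy quartic_comb_mult[OF eta'_sq xi'_sq]
    unfolding x(5) y(5) quartic_comb_mult[OF eta_sq xi_sq]
    by (rule sigma_comb) (use x y in auto)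
qed

lemma sigma_minus: "x \<in> L \<Longrightarrow> \<sigma> (- x) = - \<sigma> x"
  using sigma_mult[of "-1" x] L_Rats[of "-1"] sigma_Rats[of "-1"] by simp

lemma L_minus: "x \<in> L \<Longrightarrow> - x \<in> L"
  using L_mult[of "-1" x] L_Rats[of "-1"] by simp

lemma L_diff: "x \<in> L \<Longrightarrow> y \<in> L \<Longrightarrow> x - y \<in> L"
  using L_add[of x "- y"] L_minus by simp

lemma sigma_diff: "x \<in> L \<Longrightarrow> y \<in> L \<Longrightarrow> \<sigma> (x - y) = \<sigma> x - \<sigma> y"
  using sigma_add[of x "- y"] sigma_minus L_minus by simp

lemma L_eta': "\<eta>' \<in> L"
  unfolding \<eta>'_def by (intro L_diff L_of_int L_eta)

lemma L_rho: "\<rho> \<in> L"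
  unfolding rho_eq by (intro L_diff L_eta L_eta')

lemma L_xi': "\<xi>' \<in> L"
proof -
  have "\<xi>' = - 1 - (1/2) * ((\<xi> - 1) * \<eta>')" unfolding \<xi>'_def by simp
  moreover have "\<dots> \<in> L" by (intro L_diff L_mult L_xi L_eta' L_Rats) auto
  ultimately show ?thesis by simp
qed

lemma sigma_eta': "\<sigma> \<eta>' = \<eta>"
  unfolding \<eta>'_def by (subst sigma_diff) (auto simp: L_of_int L_eta sigma_Rats sigma_eta \<eta>'_def)

lemma sigma_xi': "\<sigma> \<xi>' = \<eta> - \<xi>"
proof -
  have *: "\<xi>' = - 1 - (1/2) * ((\<xi> - 1) * \<eta>')" unfolding \<xi>'_def by simp
  have minus_one: "- 1 \<in> L" and half: "1 / 2 \<in> L" by (auto intro!: L_Rats)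
  have mem: "(\<xi> - 1) * \<eta>' \<in> L" by (intro L_mult L_diff L_xi L_eta' L_Rats) auto
  have "\<sigma> ((\<xi> - 1) * \<eta>') = (\<xi>' - 1) * \<eta>"
    by (simp add: sigma_mult sigma_diff L_diff L_xi L_eta' L_Rats sigma_Rats sigma_xi sigma_eta')
  moreover have "\<sigma> \<xi>' = \<sigma> (- 1 - (1/2) * ((\<xi> - 1) * \<eta>'))" by (rule arg_cong[OF *])
  moreover have "\<dots> = \<sigma> (- 1) - \<sigma> (1/2) * \<sigma> ((\<xi> - 1) * \<eta>')"
    by (simp only: sigma_diff[OF minus_one L_mult[OF half mem]] sigma_mult[OF half mem])
  ultimately have "\<sigma> \<xi>' = - 1 - (1/2) * ((\<xi>' - 1) * \<eta>)"
    by (simp only: sigma_Rats Rats_1 Rats_minus_iff Rats_divide Rats_number_of)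
  also have "\<dots> = \<eta> - \<xi> + (\<xi> - 1) / 4 * (\<eta> * \<eta>' + 4)"
    unfolding \<xi>'_def by (simp add: field_simps)
  finally show ?thesis using eta_mult by simp
qed

lemma sigma_L: "x \<in> L \<Longrightarrow> \<sigma> x \<in> L"
  by (elim L_cases) (auto simp: sigma_comb intro!: L_add L_mult L_eta' L_xi' intro: L_Rats)

lemma sigma2_comb:
  assumes "r \<in> \<rat>" "s \<in> \<rat>" "t \<in> \<rat>" "u \<in> \<rat>"
  shows "\<sigma> (\<sigma> (quartic_comb \<eta> \<xi> r s t u)) = quartic_comb \<eta> (\<eta> - \<xi>) r s t u"
  unfolding sigma_comb[OF assms]
  by (simp add: assms sigma_add sigma_mult L_add L_mult L_eta' L_xi' L_Rats sigma_Rats sigma_eta' sigma_xi')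

lemma sigma2_xi: "\<sigma> (\<sigma> \<xi>) = \<eta> - \<xi>"
  by (simp add: sigma_xi sigma_xi')

lemma sigma4: "x \<in> L \<Longrightarrow> \<sigma> (\<sigma> (\<sigma> (\<sigma> x))) = x"
proof -
  assume "x \<in> L"
  then obtain r s t u where x: "r \<in> \<rat>" "s \<in> \<rat>" "t \<in> \<rat>" "u \<in> \<rat>" "x = quartic_comb \<eta> \<xi> r s t u"
    using L_cases by blast
  have e2: "\<sigma> (\<sigma> \<eta>) = \<eta>" by (simp add: sigma_eta sigma_eta')
  have x2: "\<sigma> (\<sigma> (\<eta> - \<xi>)) = \<xi>"
    by (simp add: sigma_diff sigma_L L_eta L_xi e2 sigma2_xi)
  show ?thesis unfolding x(5) sigma2_comb[OF x(1-4)]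
    by (simp add: x(1-4) sigma_add sigma_mult sigma_L L_add L_mult L_diff L_eta L_xi L_Rats sigma_Rats
      e2 x2)
qed

lemma fixed_sigma2:
  assumes "x \<in> L" "\<sigma> (\<sigma> x) = x"
  obtains r s where "r \<in> \<rat>" "s \<in> \<rat>" "x = r + s * \<eta>"
proof -
  obtain r s t u where x: "r \<in> \<rat>" "s \<in> \<rat>" "t \<in> \<rat>" "u \<in> \<rat>" "x = quartic_comb \<eta> \<xi> r s t u"
    using L_cases[OF assms(1)] by blast
  have "(t + u * \<eta>) * (2 * \<xi> - \<eta>) = 0"
    using assms(2) unfolding x(5) sigma2_comb[OF x(1-4)] by (simp add: algebra_simps)
  moreover note two_xi_ne_eta
  ultimately have "t + u * \<eta> = 0" by simp
  then show ?thesis using that[of r s] x by simp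
qed

lemma fixed_sigma:
  assumes "x \<in> L" "\<sigma> x = x"
  shows "x \<in> \<rat>"
proof -
  obtain r s where x: "r \<in> \<rat>" "s \<in> \<rat>" "x = r + s * \<eta>" using fixed_sigma2 assms by metis
  have "\<sigma> x = r + s * \<eta>'" using sigma_comb[of r s 0 0] x by simp
  then have "r + s * \<eta>' = r + s * \<eta>" using assms(2) x(3) by metis
  then have "s * \<eta> - s * \<eta>' = 0" by (metis add_left_cancel diff_self)
  then have "s * \<rho> = 0" unfolding rho_eq right_diff_distrib .
  moreover have "\<rho> \<noteq> 0" using rho_sq m_pos by auto
  ultimately show ?thesis using x by simp
qed

text \<open>The norm of \<open>x\<close> is fixed by \<open>\<sigma>\<close>, hence rational, so that \<open>\<sigma> x \<cdot> \<sigma>\<^sup>2 x \<cdot> \<sigma>\<^sup>3 x\<close> is the inverse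
  of \<open>x\<close> up to a rational factor.\<close>

lemma norm_Rats: "x \<in> L \<Longrightarrow> x * \<sigma> x * \<sigma> (\<sigma> x) * \<sigma> (\<sigma> (\<sigma> x)) \<in> \<rat>"
  by (rule fixed_sigma) (simp_all add: L_mult sigma_L sigma_mult sigma4 mult_ac)

lemma sigma_nonzero: "x \<in> L \<Longrightarrow> x \<noteq> 0 \<Longrightarrow> \<sigma> x \<noteq> 0"
  using sigma4 sigma_Rats[of 0] by force

lemma L_subfield: "is_subfield L"
proof -
  have "inverse x \<in> L" if x: "x \<in> L" for x
  proof (cases "x = 0")
    case False
    let ?n = "x * \<sigma> x * \<sigma> (\<sigma> x) * \<sigma> (\<sigma> (\<sigma> x))"
    have "\<sigma> x * \<sigma> (\<sigma> x) * \<sigma> (\<sigma> (\<sigma> x)) \<noteq> 0"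
      using False x by (simp add: sigma_nonzero sigma_L)
    then have "inverse x = \<sigma> x * \<sigma> (\<sigma> x) * \<sigma> (\<sigma> (\<sigma> x)) * inverse ?n"
      using False by (simp add: field_simps)
    also have "\<dots> \<in> L"
      using L_Rats[OF Rats_inverse[OF norm_Rats[OF x]]] by (intro L_mult sigma_L x)
    finally show ?thesis .
  qed (auto intro: L_Rats)
  then show ?thesis unfolding is_subfield_def
    by (auto intro: L_diff L_mult L_Rats)
qed

lemma L_eq_adjoin: "field_adjoin {\<xi>} = L"
  unfolding field_adjoin_def
proof (rule hull_unique)
  show "{\<xi>} \<subseteq> L" using L_xi by simp
  show "is_subfield L" by (rule L_subfield)
next
  fix F assume F: "{\<xi>} \<subseteq> F" "is_subfield F"
  then have "\<eta> \<in> F" unfolding \<eta>_def by (auto intro: subfield_diff subfield_divide subfield_one)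
  then show "L \<subseteq> F" using F
    by (auto elim!: L_cases intro!: subfield_add subfield_mult intro: subfield_Rats)
qed

lemma L_real: "x \<in> L \<Longrightarrow> x \<in> \<real>"
proof -
  have "q \<in> \<real>" if "q \<in> \<rat>" for q :: complex
    using that by (auto elim!: Rats_cases' intro!: Reals_divide)
  then show "x \<in> L \<Longrightarrow> x \<in> \<real>"
    by (elim L_cases) (auto intro!: Reals_add Reals_mult eta_real xi_real)
qed

lemma sigma_one: "\<sigma> 1 = 1" by (rule sigma_Rats) simp

lemma sigma_hom: "subfield_hom L \<sigma>"
  by unfold_locales (simp_all add: L_subfield sigma_one sigma_add sigma_mult)

lemma sigma_algebraic_int: "x \<in> L \<Longrightarrow> algebraic_int x \<Longrightarrow> algebraic_int (\<sigma> x)"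
  by (rule subfield_hom.hom_algebraic_int[OF sigma_hom])

lemma algebraic_int_eta: "algebraic_int \<eta>"
  by (rule algebraic_int_quadratic[of _ a 4]) (simp add: eta_sq)

lemma algebraic_int_xi: "algebraic_int \<xi>"
  unfolding algebraic_int_altdef_ipoly
  by (intro exI[of _ "[:1, a, -6, -a, 1:]"])
    (use root in \<open>simp add: of_int_hom.map_poly_pCons_hom algebra_simps power2_eq_square power3_eq_cube power4_eq_xxxx\<close>)

lemma algebraic_int_eta': "algebraic_int \<eta>'"
  using sigma_algebraic_int[OF L_eta algebraic_int_eta] by (simp add: sigma_eta)

lemma algebraic_int_rho: "algebraic_int \<rho>"
  unfolding rho_eq by (intro algebraic_int_diff algebraic_int_eta algebraic_int_eta')

end

context simplest_quartic
begin

section \<open>Denominators and the discriminant of the quartic field\<close>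

text \<open>
  Let \<open>J\<close> be a group of elements of \<open>L\<close> that is stable under the Galois group and under
  multiplication by integers of \<open>L\<close>, and whose rational elements are rational integers. Taking traces,
  first down to the quadratic subfield and then to \<open>\<rat>\<close>, bounds the denominators of the
  coordinates of the elements of \<open>J\<close> by \<open>16 m\<^sup>2\<close>.
\<close>

lemma denominators:
  assumes JL: "\<And>x. x \<in> J \<Longrightarrow> x \<in> L"
    and Jadd: "\<And>x y. x \<in> J \<Longrightarrow> y \<in> J \<Longrightarrow> x + y \<in> J"
    and Jmul: "\<And>c x. c \<in> L \<Longrightarrow> algebraic_int c \<Longrightarrow> x \<in> J \<Longrightarrow> c * x \<in> J"
    and Jsig: "\<And>x. x \<in> J \<Longrightarrow> \<sigma> x \<in> J"
    and Jint: "\<And>x. x \<in> J \<Longrightarrow> x \<in> \<rat> \<Longrightarrow> x \<in> \<int>"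
    and x: "x \<in> J"
  shows "\<exists>r s t u. 16 * of_int m ^ 2 * x = quartic_comb \<eta> \<xi> (of_int r) (of_int s) (of_int t) (of_int u)"
proof -
  have Jdiff: "y - z \<in> J" if "y \<in> J" "z \<in> J" for y z
    using Jadd[OF that(1) Jmul[OF L_of_int[of "-1"] _ that(2)]] by simp
  \<comment> \<open>the bound for the elements of \<open>J\<close> in the quadratic subfield\<close>
  have quad: "of_int m * q \<in> \<int> \<and> 2 * of_int m * p \<in> \<int>"
    if pq: "p \<in> \<rat>" "q \<in> \<rat>" and z: "p + q * \<eta> \<in> J" for p q
  proof -
    have sz: "\<sigma> (p + q * \<eta>) = p + q * \<eta>'" using sigma_comb[of p q 0 0] pq by simp
    have "\<rho> * ((p + q * \<eta>) - \<sigma> (p + q * \<eta>)) \<in> J"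
      by (intro Jmul Jdiff Jsig z L_rho algebraic_int_rho)
    moreover have "\<rho> * ((p + q * \<eta>) - \<sigma> (p + q * \<eta>)) = q * \<rho> ^ 2"
      unfolding sz rho_eq by (simp add: algebra_simps power2_eq_square)
    moreover have "q * \<rho> ^ 2 = of_int m * q" unfolding rho_sq by simp
    ultimately have "of_int m * q \<in> J" by simp
    then have mq: "of_int m * q \<in> \<int>" using pq by (intro Jint) auto
    have "(p + q * \<eta>) + \<sigma> (p + q * \<eta>) \<in> J" by (intro Jadd Jsig z)
    moreover have "(p + q * \<eta>) + \<sigma> (p + q * \<eta>) = 2 * p + of_int a * q"
      unfolding sz eta_add[symmetric] by (simp add: algebra_simps)
    ultimately have "2 * p + of_int a * q \<in> \<int>" using pq by (intro Jint) auto
    then have "of_int m * (2 * p + of_int a * q) - of_int a * (of_int m * q) \<in> \<int>"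
      by (rule Ints_diff[OF Ints_mult[OF Ints_of_int] Ints_mult[OF Ints_of_int mq]])
    then show ?thesis using mq by (simp add: algebra_simps)
  qed
  obtain r s t u where c: "r \<in> \<rat>" "s \<in> \<rat>" "t \<in> \<rat>" "u \<in> \<rat>" "x = quartic_comb \<eta> \<xi> r s t u"
    using L_cases[OF JL[OF x]] by blast
  have s2: "\<sigma> (\<sigma> x) = quartic_comb \<eta> (\<eta> - \<xi>) r s t u" unfolding c(5) by (rule sigma2_comb[OF c(1-4)])
  have "(\<eta>' ^ 2 + 4) * ((2 * \<xi> - \<eta>) * (x - \<sigma> (\<sigma> x))) \<in> J"
  proof (intro Jmul Jdiff Jsig x)
    show "\<eta>' ^ 2 + 4 \<in> L" "2 * \<xi> - \<eta> \<in> L"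
      by (auto intro!: L_add L_diff L_mult L_eta' L_xi L_eta L_numeral simp: power2_eq_square)
    show "algebraic_int (\<eta>' ^ 2 + 4)" "algebraic_int (2 * \<xi> - \<eta>)"
      by (intro algebraic_int_add algebraic_int_diff algebraic_int_mult algebraic_int_pow
        algebraic_int_eta' algebraic_int_xi algebraic_int_eta algebraic_int_numeral)+
  qed
  also have "(2 * \<xi> - \<eta>) * (x - \<sigma> (\<sigma> x)) = (t + u * \<eta>) * (2 * \<xi> - \<eta>) ^ 2"
    unfolding s2 unfolding c(5) by (simp add: algebra_simps power2_eq_square)
  also have "(\<eta>' ^ 2 + 4) * ((t + u * \<eta>) * (2 * \<xi> - \<eta>) ^ 2) =
      (t + u * \<eta>) * ((\<eta> ^ 2 + 4) * (\<eta>' ^ 2 + 4))"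
    unfolding xi_disc by simp
  also have "\<dots> = (4 * of_int m * t) + (4 * of_int m * u) * \<eta>"
    unfolding norm_eta_sq_plus_4 by (simp add: algebra_simps)
  finally have "of_int m * (4 * of_int m * u) \<in> \<int> \<and> 2 * of_int m * (4 * of_int m * t) \<in> \<int>"
    by (intro quad) (use c in auto)
  then have U: "4 * of_int m ^ 2 * u \<in> \<int>" and T: "8 * of_int m ^ 2 * t \<in> \<int>"
    by (simp_all add: power2_eq_square mult_ac)
  have "x + \<sigma> (\<sigma> x) \<in> J" by (intro Jadd Jsig x)
  also have "x + \<sigma> (\<sigma> x) = (2 * r + 4 * u) + (2 * s + t + of_int a * u) * \<eta>
      + u * (\<eta> ^ 2 - of_int a * \<eta> - 4)"
    unfolding s2 unfolding c(5) by (simp add: algebra_simps power2_eq_square)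
  also have "\<dots> = (2 * r + 4 * u) + (2 * s + t + of_int a * u) * \<eta>" using eta_sq by simp
  finally have "of_int m * (2 * s + t + of_int a * u) \<in> \<int> \<and> 2 * of_int m * (2 * r + 4 * u) \<in> \<int>"
    by (intro quad) (use c in auto)
  then have S': "of_int m * (2 * s + t + of_int a * u) \<in> \<int>" and R': "2 * of_int m * (2 * r + 4 * u) \<in> \<int>"
    by auto
  have "8 * of_int m * (of_int m * (2 * s + t + of_int a * u)) - 8 * of_int m ^ 2 * t
      - 2 * of_int a * (4 * of_int m ^ 2 * u) \<in> \<int>"
    by (rule Ints_diff[OF Ints_diff[OF Ints_mult[OF _ S'] T] Ints_mult[OF _ U]]) auto
  then have S: "16 * of_int m ^ 2 * s \<in> \<int>" by (simp add: algebra_simps power2_eq_square)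
  have "4 * of_int m * (2 * of_int m * (2 * r + 4 * u)) - 8 * (4 * of_int m ^ 2 * u) \<in> \<int>"
    by (rule Ints_diff[OF Ints_mult[OF _ R'] Ints_mult[OF _ U]]) auto
  then have R: "16 * of_int m ^ 2 * r \<in> \<int>" by (simp add: algebra_simps power2_eq_square)
  have "2 * (8 * of_int m ^ 2 * t) \<in> \<int>" "4 * (4 * of_int m ^ 2 * u) \<in> \<int>"
    using Ints_mult[OF _ T, of 2] Ints_mult[OF _ U, of 4] by auto
  then have "16 * of_int m ^ 2 * t \<in> \<int>" "16 * of_int m ^ 2 * u \<in> \<int>" by (simp_all add: mult.assoc[symmetric])
  with R S obtain r' s' t' u' where *: "16 * of_int m ^ 2 * r = of_int r'" "16 * of_int m ^ 2 * s = of_int s'"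
    "16 * of_int m ^ 2 * t = of_int t'" "16 * of_int m ^ 2 * u = of_int u'" by (metis Ints_cases)
  have "16 * of_int m ^ 2 * x = quartic_comb \<eta> \<xi> (of_int r') (of_int s') (of_int t') (of_int u')"
    unfolding *[symmetric] unfolding c(5) by (simp add: algebra_simps)
  then show ?thesis by blast
qed

lemma L_integral_basis: "\<exists>ws. integral_basis L ws"
proof -
  define v :: "nat \<Rightarrow> complex" where "v i = [1, \<eta>, \<xi>, \<eta> * \<xi>] ! i / (16 * of_int m ^ 2)" for i
  have m0: "(of_int m :: complex) \<noteq> 0" using m_pos by simp
  have comb: "(\<Sum>i<4. of_int (c i) * v i) =
      quartic_comb \<eta> \<xi> (of_int (c 0)) (of_int (c 1)) (of_int (c 2)) (of_int (c 3)) / (16 * of_int m ^ 2)"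
    for c :: "nat \<Rightarrow> int"
    by (simp add: v_def numeral_eq_Suc lessThan_Suc add_divide_distrib algebra_simps)
  let ?O = "ring_of_integers L"
  have "\<exists>ws. set ws \<subseteq> ?O \<and> (\<forall>x\<in>?O. \<exists>c. x = int_comb c ws) \<and>
    (\<forall>c. int_comb c ws = 0 \<longrightarrow> (\<forall>i<length ws. c i = 0))"
  proof (rule subgroup_of_free_group_free[where n = 4 and v = v])
    fix c :: "nat \<Rightarrow> int" assume "(\<Sum>i<4. of_int (c i) * v i) = 0"
    then have "quartic_comb \<eta> \<xi> (of_int (c 0)) (of_int (c 1)) (of_int (c 2)) (of_int (c 3)) = 0"
      unfolding comb using m0 by simp
    then have "c 0 = 0 \<and> c 1 = 0 \<and> c 2 = 0 \<and> c 3 = 0"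
      using quartic_independent[of "of_int (c 0)" "of_int (c 1)" "of_int (c 2)" "of_int (c 3)"] by simp
    then show "\<forall>i<4. c i = 0" by (auto simp: numeral_eq_Suc less_Suc_eq)
  next
    show "0 \<in> ?O" using integers_of_int[OF L_subfield, of 0] by simp
  next
    fix x y assume "x \<in> ?O" "y \<in> ?O"
    then show "x - y \<in> ?O" by (rule integers_diff[OF L_subfield])
  next
    fix x assume x: "x \<in> ?O"
    have "\<exists>r s t u. 16 * of_int m ^ 2 * x =
        quartic_comb \<eta> \<xi> (of_int r) (of_int s) (of_int t) (of_int u)"
      by (rule denominators[where J = ?O])
        (use x in \<open>auto simp: ring_of_integers_def sigma_algebraic_int
          intro: L_add L_mult sigma_L rational_algebraic_int_is_int\<close>)
    then obtain r s t u where *: "16 * of_int m ^ 2 * x =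
        quartic_comb \<eta> \<xi> (of_int r) (of_int s) (of_int t) (of_int u)" by blast
    have "x = (16 * of_int m ^ 2 * x) / (16 * of_int m ^ 2)" using m0 by simp
    also have "\<dots> = (\<Sum>i<4. of_int ([r, s, t, u] ! i) * v i)" unfolding comb * by simp
    finally show "\<exists>c. x = (\<Sum>i<4. of_int (c i) * v i)" by (intro exI[of _ "\<lambda>i. [r, s, t, u] ! i"])
  qed
  then obtain ws where "set ws \<subseteq> ?O" "\<And>x. x \<in> ?O \<Longrightarrow> \<exists>c. x = int_comb c ws"
    "\<And>c. int_comb c ws = 0 \<Longrightarrow> \<forall>i<length ws. c i = 0" by auto
  then show ?thesis by (intro exI[of _ ws] integral_basisI)
qed

text \<open>
  A homomorphism maps \<open>\<eta>\<close> to a root of its quadratic equation, and then \<open>\<xi>\<close> to a root of the quadratic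
  equation over the image of \<open>\<eta>\<close>. These four choices are realized by the powers of \<open>\<sigma>\<close>.
\<close>

lemma hom_eq_power_of_sigma:
  assumes hom: "subfield_hom L g"
  shows "(\<forall>x\<in>L. g x = x) \<or> (\<forall>x\<in>L. g x = \<sigma> x) \<or> (\<forall>x\<in>L. g x = \<sigma> (\<sigma> x)) \<or>
    (\<forall>x\<in>L. g x = \<sigma> (\<sigma> (\<sigma> x)))"
proof -
  interpret subfield_hom L g by (rule hom)
  have rat: "g q = q" if q: "q \<in> \<rat>" for q
  proof -
    obtain l k where kl: "l > 0" "q = of_int k / of_int l" by (rule Rats_cases'[OF q])
    then have "g (q * of_int l) = g (of_int k)" by simp
    then have "g q * of_int l = of_int k"
      unfolding hom_mult[OF L_Rats[OF q] L_of_int] hom_of_int .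
    moreover have "q * of_int l = of_int k" using kl by simp
    ultimately have "g q * of_int l = q * of_int l" by simp
    then show ?thesis using kl(1) by simp
  qed
  have comb: "g (quartic_comb \<eta> \<xi> r s t u) = quartic_comb (g \<eta>) (g \<xi>) r s t u"
    if "r \<in> \<rat>" "s \<in> \<rat>" "t \<in> \<rat>" "u \<in> \<rat>" for r s t u
    using that by (simp add: hom_add hom_mult L_add L_mult L_Rats L_eta L_xi rat)
  have "g \<eta> ^ 2 = of_int a * g \<eta> + 4"
    using arg_cong[OF eta_sq, of g] rat[of 4]
    by (simp add: hom_power hom_add hom_mult L_mult L_of_int L_eta L_numeral hom_of_int)
  then have "(g \<eta> - \<eta>) * (g \<eta> - \<eta>') = 0"
    using eta_sq unfolding \<eta>'_def by (simp add: algebra_simps power2_eq_square)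
  moreover have "g \<xi> ^ 2 = g \<eta> * g \<xi> + 1"
    using arg_cong[OF xi_sq, of g] rat[of 1]
    by (simp add: hom_power hom_add hom_mult L_mult L_eta L_xi L_Rats)
  then have "(g \<xi> - X) * (g \<xi> - (g \<eta> - X)) = 0" if "X ^ 2 = g \<eta> * X + 1" for X
    using that by (simp add: algebra_simps power2_eq_square)
  ultimately consider "g \<eta> = \<eta>" "g \<xi> = \<xi>" | "g \<eta> = \<eta>" "g \<xi> = \<eta> - \<xi>"
    | "g \<eta> = \<eta>'" "g \<xi> = \<xi>'" | "g \<eta> = \<eta>'" "g \<xi> = \<eta>' - \<xi>'"
    using xi_sq xi'_sq by (metis eq_iff_diff_eq_0 mult_eq_0_iff)
  then show ?thesis
  proof cases
    case 1
    then have "\<forall>x\<in>L. g x = x" by (auto elim!: L_cases simp: comb)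
    then show ?thesis by blast
  next
    case 2
    then have "\<forall>x\<in>L. g x = \<sigma> (\<sigma> x)" by (auto elim!: L_cases simp: comb sigma2_comb)
    then show ?thesis by blast
  next
    case 3
    then have "\<forall>x\<in>L. g x = \<sigma> x" by (auto elim!: L_cases simp: comb sigma_comb)
    then show ?thesis by blast
  next
    case 4
    have s3: "\<sigma> (\<sigma> (\<sigma> (quartic_comb \<eta> \<xi> r s t u))) = quartic_comb \<eta>' (\<eta>' - \<xi>') r s t u"
    if "r \<in> \<rat>" "s \<in> \<rat>" "t \<in> \<rat>" "u \<in> \<rat>" for r s t u
    unfolding sigma2_comb[OF that]
    by (simp add: that sigma_add sigma_mult sigma_diff L_add L_mult L_diff L_eta L_xi L_Rats sigma_Rats
      sigma_eta sigma_xi)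
    have "\<forall>x\<in>L. g x = \<sigma> (\<sigma> (\<sigma> x))" by (auto elim!: L_cases simp: comb s3 4)
    then show ?thesis by blast
  qed
qed

lemma L_field_trace:
  assumes "x \<in> L"
  shows "field_trace L x = x + \<sigma> x + \<sigma> (\<sigma> x) + \<sigma> (\<sigma> (\<sigma> x))"
proof -
  define e where "e = [restrict (\<lambda>x. x) L, restrict \<sigma> L, restrict (\<lambda>x. \<sigma> (\<sigma> x)) L,
    restrict (\<lambda>x. \<sigma> (\<sigma> (\<sigma> x))) L]"
  have "embeddings L = set e"
  proof
    show "embeddings L \<subseteq> set e"
    proof
      fix g assume g: "g \<in> embeddings L"
      then have ext: "g = restrict g L" unfolding embeddings_def by (simp add: extensional_restrict)
      from hom_eq_power_of_sigma[OF embedding_subfield_hom[OF L_subfield g]]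
      have "restrict g L \<in> set e"
        unfolding e_def by (auto intro!: restrict_ext)
      then show "g \<in> set e" using ext by simp
    qed
    show "set e \<subseteq> embeddings L"
      unfolding e_def embeddings_def
      by (auto simp: L_Rats L_add L_mult sigma_one sigma_add sigma_mult sigma_L)
  qed
  moreover have "distinct e"
  proof -
    have ee: "\<eta> \<noteq> \<eta>'" using rho_sq m_pos unfolding rho_eq by auto
    have xx: "\<xi> \<noteq> \<eta> - \<xi>" using two_xi_ne_eta by (simp add: algebra_simps)
    have "\<xi>' \<noteq> \<eta>' - \<xi>'"
    proof
      assume *: "\<xi>' = \<eta>' - \<xi>'"
      have "\<sigma> (\<sigma> (\<sigma> \<xi>')) = \<xi>" using sigma4[OF L_xi] by (simp add: sigma_xi)
      moreover have "\<sigma> (\<sigma> (\<sigma> (\<eta>' - \<xi>'))) = \<eta> - \<xi>"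
        using \<open>\<sigma> (\<sigma> (\<sigma> \<xi>')) = \<xi>\<close>
        by (simp add: sigma_diff L_diff sigma_L L_eta' L_eta L_xi' sigma_eta sigma_eta')
      ultimately show False using * xx by metis
    qed
    then have "restrict h L \<noteq> restrict h' L" if "h \<eta> \<noteq> h' \<eta> \<or> h \<xi> \<noteq> h' \<xi>" for h h' :: "complex \<Rightarrow> complex"
      using that L_eta L_xi by (metis restrict_apply')
    moreover note ee xx \<open>\<xi>' \<noteq> \<eta>' - \<xi>'\<close>
    ultimately show ?thesis
      unfolding e_def distinct.simps list.set insert_iff empty_iff de_Morgan_disj
      by (simp add: sigma_eta sigma_eta' sigma_xi sigma_xi' sigma_diff L_eta L_xi)
  qed
  ultimately have "field_trace L x = (\<Sum>g\<leftarrow>e. g x)"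
    unfolding field_trace_def by (simp add: sum_list_distinct_conv_sum_set)
  then show ?thesis using assms unfolding e_def by (simp add: add.assoc)
qed

lemma L_field_trace_Rats: "x \<in> L \<Longrightarrow> field_trace L x \<in> \<rat>"
  unfolding L_field_trace
  by (rule fixed_sigma) (simp_all add: L_add sigma_add sigma_L sigma4)

lemma L_prime_dvd_discriminant:
  assumes "prime p" "x \<in> L" "nil_mod p x" "\<not> algebraic_int (x / of_int p)"
  shows "p dvd field_discriminant L"
proof -
  obtain ws where "integral_basis L ws" using L_integral_basis by blast
  then show ?thesis
    by (rule prime_dvd_discriminant[OF L_subfield _ _ assms(1,2,3,4)])
      (auto simp: ring_of_integers_def L_field_trace_Rats)
qed

lemma algebraic_int_norm:
  "x \<in> L \<Longrightarrow> algebraic_int x \<Longrightarrow> x * \<sigma> x * \<sigma> (\<sigma> x) * \<sigma> (\<sigma> (\<sigma> x)) \<in> \<int>"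
  by (intro rational_algebraic_int_is_int norm_Rats algebraic_int_mult)
    (auto intro: sigma_algebraic_int sigma_L)

text \<open>
  The absolute norm of an element divisible by \<open>p\<close> is divisible by \<open>p\<^sup>4\<close>. It is computed in two steps,
  through the norm \<open>y\<close> to the quadratic subfield.
\<close>

lemma norm_divide_int:
  assumes "x \<in> L" "algebraic_int (x / of_int p)" and "p \<noteq> 0"
    and "x * \<sigma> (\<sigma> x) = y" "y * \<sigma> y = of_int n"
  shows "p ^ 4 dvd n"
proof -
  define z where "z = x / of_int p"
  have z: "z \<in> L" unfolding z_def using subfield_divide[OF L_subfield assms(1) L_of_int] .
  have x: "x = of_int p * z" unfolding z_def using assms(3) by simp
  have sx: "\<sigma> (of_int p * w) = of_int p * \<sigma> w" if "w \<in> L" for w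
    using that by (simp add: sigma_mult L_of_int sigma_Rats)
  have "y * \<sigma> y = of_int p ^ 4 * (z * \<sigma> z * \<sigma> (\<sigma> z) * \<sigma> (\<sigma> (\<sigma> z)))"
    unfolding assms(4)[symmetric] unfolding x
    by (simp add: sx z sigma_L L_mult L_of_int sigma_mult sigma_Rats power4_eq_xxxx mult_ac)
  moreover obtain k where "z * \<sigma> z * \<sigma> (\<sigma> z) * \<sigma> (\<sigma> (\<sigma> z)) = of_int k"
    using algebraic_int_norm[OF z] assms(2) unfolding z_def by (auto elim: Ints_cases)
  ultimately have "(of_int n :: complex) = of_int (p ^ 4 * k)" using assms(5) by simp
  then show ?thesis by (simp only: of_int_eq_iff dvd_triv_left)
qed

lemma xi_plus_1_norm: "(\<xi> + 1) * \<sigma> (\<sigma> (\<xi> + 1)) = \<eta>"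
proof -
  have "\<sigma> (\<sigma> (\<xi> + 1)) = \<eta> - \<xi> + 1"
    by (simp add: sigma_add sigma_one sigma_L L_xi L_Rats sigma2_xi)
  show ?thesis unfolding \<open>\<sigma> (\<sigma> (\<xi> + 1)) = \<eta> - \<xi> + 1\<close> using xi_sq by (simp add: algebra_simps power2_eq_square)
qed

text \<open>
  For even \<open>a\<close> the polynomial of \<open>\<xi>\<close> is the fourth power \<open>(x + 1)\<^sup>4\<close> modulo 2, so \<open>\<xi> + 1\<close> is nilpotent
  modulo 2. Its norm \<open>-4\<close> is not divisible by \<open>2\<^sup>4\<close>.
\<close>

lemma even_discriminant:
  assumes "even a"
  shows "2 dvd field_discriminant L"
proof (rule L_prime_dvd_discriminant)
  show "\<xi> + 1 \<in> L" by (intro L_add L_xi L_Rats) auto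
  obtain b where b: "a = 2 * b" using assms by blast
  have "(\<xi> + 1) ^ 4 = (\<xi> ^ 4 - of_int a * \<xi> ^ 3 - 6 * \<xi> ^ 2 + of_int a * \<xi> + 1)
      + 2 * (of_int (b + 2) * \<xi> ^ 3 + 6 * \<xi> ^ 2 + of_int (2 - b) * \<xi>)"
    unfolding b by (simp add: algebra_simps power2_eq_square power3_eq_cube power4_eq_xxxx)
  then have "(\<xi> + 1) ^ 4 / of_int 2 = of_int (b + 2) * \<xi> ^ 3 + 6 * \<xi> ^ 2 + of_int (2 - b) * \<xi>"
    unfolding root by simp
  moreover have "algebraic_int (of_int (b + 2) * \<xi> ^ 3 + 6 * \<xi> ^ 2 + of_int (2 - b) * \<xi>)"
    by (intro algebraic_int_add algebraic_int_mult algebraic_int_pow algebraic_int_xi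
      algebraic_int_of_int algebraic_int_numeral)
  moreover have "algebraic_int (\<xi> + 1)" by (intro algebraic_int_add algebraic_int_xi algebraic_int_1)
  ultimately show "nil_mod 2 (\<xi> + 1)" unfolding nil_mod_def by metis
  show "\<not> algebraic_int ((\<xi> + 1) / of_int 2)"
  proof
    assume "algebraic_int ((\<xi> + 1) / of_int 2)"
    then have "2 ^ 4 dvd (- 4 :: int)"
      by (rule norm_divide_int[OF \<open>\<xi> + 1 \<in> L\<close> _ _ xi_plus_1_norm]) (simp_all add: sigma_eta eta_mult)
    then show False by (simp add: zdvd_not_zless)
  qed
qed simp

text \<open>
  For an odd prime divisor \<open>p\<close> of \<open>m\<close> the polynomial of \<open>\<xi>\<close> is the fourth power \<open>(x - a/4)\<^sup>4\<close> modulo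
  \<open>p\<close>, so \<open>4 \<xi> - a\<close> is nilpotent modulo \<open>p\<close>. Its norm is \<open>m (16 - 3 a\<^sup>2)\<close>, where \<open>16 - 3 a\<^sup>2 \<equiv> 64\<close>
  modulo \<open>p\<close>; hence \<open>p\<close> divides the norm exactly once.
\<close>

lemma odd_prime_dvd_discriminant:
  assumes p: "prime p" "p \<noteq> 2" and dvd: "p dvd m" and ndvd: "\<not> p ^ 2 dvd m"
  shows "p dvd field_discriminant L"
proof (rule L_prime_dvd_discriminant[OF p(1)])
  have p0: "p \<noteq> 0" using p by auto
  obtain k where k: "m = p * k" using dvd by blast
  show xL: "4 * \<xi> - of_int a \<in> L" by (intro L_diff L_mult L_xi L_numeral L_of_int)
  have "(4 * \<xi> - of_int a) ^ 4 =
      256 * (\<xi> ^ 4 - of_int a * \<xi> ^ 3 - 6 * \<xi> ^ 2 + of_int a * \<xi> + 1)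
      + of_int m * (96 * \<xi> ^ 2 - 16 * of_int a * \<xi> + of_int (a ^ 2 - 16))"
    unfolding m_def by (simp add: algebra_simps power2_eq_square power3_eq_cube power4_eq_xxxx)
  also have "\<dots> = of_int p * (of_int k * (96 * \<xi> ^ 2 - 16 * of_int a * \<xi> + of_int (a ^ 2 - 16)))"
    unfolding root k by simp
  finally have "(4 * \<xi> - of_int a) ^ 4 / of_int p =
      of_int k * (96 * \<xi> ^ 2 - 16 * of_int a * \<xi> + of_int (a ^ 2 - 16))"
    using p0 by simp
  moreover have "algebraic_int (of_int k * (96 * \<xi> ^ 2 - 16 * of_int a * \<xi> + of_int (a ^ 2 - 16)))"
    by (intro algebraic_int_add algebraic_int_diff algebraic_int_mult algebraic_int_pow algebraic_int_xi
      algebraic_int_of_int algebraic_int_numeral)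
  moreover have "algebraic_int (4 * \<xi> - of_int a)"
    by (intro algebraic_int_diff algebraic_int_mult algebraic_int_xi algebraic_int_of_int
      algebraic_int_numeral)
  ultimately show "nil_mod p (4 * \<xi> - of_int a)" unfolding nil_mod_def by metis
  show "\<not> algebraic_int ((4 * \<xi> - of_int a) / of_int p)"
  proof
    assume int: "algebraic_int ((4 * \<xi> - of_int a) / of_int p)"
    define y where "y = of_int (a ^ 2 - 16) - 4 * of_int a * \<eta>"
    have s2: "\<sigma> (\<sigma> (4 * \<xi> - of_int a)) = 4 * (\<eta> - \<xi>) - of_int a"
      by (simp add: sigma_diff sigma_mult sigma_Rats sigma_L L_mult L_xi L_numeral L_of_int sigma2_xi)
    have "(4 * \<xi> - of_int a) * \<sigma> (\<sigma> (4 * \<xi> - of_int a)) = y - 16 * (\<xi> ^ 2 - \<eta> * \<xi> - 1)"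
      unfolding s2 unfolding y_def by (simp add: algebra_simps power2_eq_square)
    then have xy: "(4 * \<xi> - of_int a) * \<sigma> (\<sigma> (4 * \<xi> - of_int a)) = y" using xi_sq by simp
    have sy: "\<sigma> y = of_int (a ^ 2 - 16) - 4 * of_int a * \<eta>'"
      unfolding y_def
      by (simp add: sigma_diff sigma_mult sigma_Rats L_mult L_diff L_eta L_numeral L_of_int L_Rats sigma_eta)
    have "y * \<sigma> y = of_int (a ^ 2 - 16) ^ 2 - 4 * of_int a * of_int (a ^ 2 - 16) * (\<eta> + \<eta>')
        + 16 * of_int a ^ 2 * (\<eta> * \<eta>')"
      unfolding sy unfolding y_def by (simp add: algebra_simps power2_eq_square)
    also have "\<dots> = of_int (m * (16 - 3 * a ^ 2))"
      unfolding eta_add eta_mult m_def by (simp add: algebra_simps power2_eq_square)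
    finally have "p ^ 4 dvd m * (16 - 3 * a ^ 2)"
      using norm_divide_int[OF xL int p0 xy] by blast
    then have "p * p ^ 3 dvd p * (k * (16 - 3 * a ^ 2))"
      unfolding k by (simp add: mult.assoc flip: power_Suc)
    then have "p ^ 3 dvd k * (16 - 3 * a ^ 2)" using p0 by simp
    moreover have "p dvd p ^ 3" by simp
    ultimately have "p dvd k * (16 - 3 * a ^ 2)" using dvd_trans by blast
    moreover have "\<not> p dvd k" using ndvd unfolding k by (auto simp: power2_eq_square)
    ultimately have "p dvd 16 - 3 * a ^ 2" using p(1) by (simp add: prime_dvd_mult_iff)
    moreover have "p dvd 3 * m" using dvd by simp
    ultimately have "p dvd (16 - 3 * a ^ 2) + 3 * m" by (rule dvd_add)
    then have "p dvd 2 ^ 6" unfolding m_def by simp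
    then have "p dvd 2" using p(1) prime_dvd_power by blast
    then show False using p primes_dvd_imp_eq two_is_prime by blast
  qed
qed

end

section \<open>Imaginary quadratic fields\<close>

lemma squarefree_dvd_square:
  fixes d n :: nat
  assumes sf: "squarefree d" and dvd: "d dvd n ^ 2"
  shows "d dvd n"
proof -
  have "d \<noteq> 0" using sf by (intro notI) simp
  then have "gcd d n \<noteq> 0" by simp
  then obtain e k where *: "d = e * gcd d n" "n = k * gcd d n" "coprime e k"
    using gcd_coprime_exists by blast
  define g where "g = gcd d n"
  have dn: "d = e * g" "n = k * g" using *(1,2) unfolding g_def .
  have "g \<noteq> 0" using \<open>gcd d n \<noteq> 0\<close> unfolding g_def .
  have "e * g dvd (k ^ 2 * g) * g" using dvd unfolding dn by (simp add: power2_eq_square mult_ac)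
  then have "e dvd k ^ 2 * g" using \<open>g \<noteq> 0\<close> by simp
  then have "e dvd g" using *(3) by (simp add: coprime_dvd_mult_right_iff)
  then have "e ^ 2 dvd d" unfolding dn by (simp add: power2_eq_square)
  then have "e dvd 1" using sf squarefreeD by blast
  then show ?thesis unfolding dn by simp
qed

locale imaginary_quadratic =
  fixes d :: nat
  assumes d_pos: "d > 0"
begin

definition \<delta> :: complex where "\<delta> = \<i> * of_real (sqrt (real d))"
definition M :: "complex set" where "M = {r + s * \<delta> | r s. r \<in> \<rat> \<and> s \<in> \<rat>}"

lemma delta_sq: "\<delta> ^ 2 = - of_nat d"
  unfolding \<delta>_def by (simp add: power_mult_distrib flip: of_real_power)

lemma delta_mult: "\<delta> * \<delta> = - of_nat d"
  using delta_sq by (simp add: power2_eq_square)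

lemma cnj_delta: "cnj \<delta> = - \<delta>"
  unfolding \<delta>_def by simp

lemma delta_nonzero: "\<delta> \<noteq> 0"
  using delta_sq d_pos by auto

lemma algebraic_int_delta: "algebraic_int \<delta>"
  by (rule algebraic_int_quadratic[of _ 0 "- int d"]) (simp add: delta_sq)

lemma cnj_Rats: "r \<in> \<rat> \<Longrightarrow> cnj r = r"
  by (auto elim!: Rats_cases')

lemma real_independent:
  assumes "x \<in> \<real>" "y \<in> \<real>" "x + y * \<delta> = 0"
  shows "x = 0 \<and> y = 0"
proof -
  have "cnj (x + y * \<delta>) = x - y * \<delta>" using assms(1,2) by (simp add: cnj_delta Reals_cnj_iff)
  then have "x - y * \<delta> = 0" using assms(3) by simp
  then have "x = 0" using assms(3) by (simp add: add_eq_0_iff)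
  then show ?thesis using assms(3) delta_nonzero by simp
qed

lemma M_cases:
  assumes "x \<in> M"
  obtains r s where "r \<in> \<rat>" "s \<in> \<rat>" "x = r + s * \<delta>"
  using assms unfolding M_def by blast

lemma M_intro: "r \<in> \<rat> \<Longrightarrow> s \<in> \<rat> \<Longrightarrow> r + s * \<delta> \<in> M"
  unfolding M_def by blast

lemma M_Rats: "r \<in> \<rat> \<Longrightarrow> r \<in> M"
  using M_intro[of r 0] by simp

lemma M_delta: "\<delta> \<in> M"
  using M_intro[of 0 1] by simp

lemma cnj_M_comb: "r \<in> \<rat> \<Longrightarrow> s \<in> \<rat> \<Longrightarrow> cnj (r + s * \<delta>) = r - s * \<delta>"
  by (simp add: cnj_Rats cnj_delta)

lemma M_subfield: "is_subfield M"
proof -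
  have mult: "x * y \<in> M" if xy: "x \<in> M" "y \<in> M" for x y
  proof -
    obtain r s r' s' where *: "r \<in> \<rat>" "s \<in> \<rat>" "x = r + s * \<delta>" "r' \<in> \<rat>" "s' \<in> \<rat>" "y = r' + s' * \<delta>"
      using M_cases[OF xy(1)] M_cases[OF xy(2)] by metis
    have "x * y = (r * r' + s * s' * (\<delta> * \<delta>)) + (r * s' + s * r') * \<delta>"
      unfolding * by (simp add: algebra_simps)
    also have "\<dots> \<in> M" unfolding delta_mult by (rule M_intro) (use * in auto)
    finally show ?thesis .
  qed
  have diff: "x - y \<in> M" if xy: "x \<in> M" "y \<in> M" for x y
  proof -
    obtain r s r' s' where *: "r \<in> \<rat>" "s \<in> \<rat>" "x = r + s * \<delta>" "r' \<in> \<rat>" "s' \<in> \<rat>" "y = r' + s' * \<delta>"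
      using M_cases[OF xy(1)] M_cases[OF xy(2)] by metis
    have "x - y = (r - r') + (s - s') * \<delta>" unfolding * by (simp add: algebra_simps)
    also have "\<dots> \<in> M" by (rule M_intro) (use * in auto)
    finally show ?thesis .
  qed
  have "inverse x \<in> M" if x: "x \<in> M" for x
  proof (cases "x = 0")
    case False
    obtain r s where *: "r \<in> \<rat>" "s \<in> \<rat>" "x = r + s * \<delta>" using M_cases[OF x] by blast
    have n: "x * cnj x = r ^ 2 + of_nat d * s ^ 2"
      unfolding *(3) cnj_M_comb[OF *(1,2)] using delta_sq by (simp add: algebra_simps power2_eq_square)
    have "inverse x = cnj x * inverse (x * cnj x)" using False by simp
    also have "\<dots> \<in> M" unfolding n unfolding *(3) cnj_M_comb[OF *(1,2)]
      by (rule mult) (use M_intro[of r "- s"] * in \<open>auto intro!: M_Rats\<close>)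
    finally show ?thesis .
  qed (auto intro: M_Rats)
  then show ?thesis unfolding is_subfield_def using mult diff by (auto intro: M_Rats)
qed

lemma M_eq_adjoin: "field_adjoin {\<delta>} = M"
  unfolding field_adjoin_def
proof (rule hull_unique)
  show "{\<delta>} \<subseteq> M" using M_delta by simp
  show "is_subfield M" by (rule M_subfield)
next
  fix F assume "{\<delta>} \<subseteq> F" "is_subfield F"
  then show "M \<subseteq> F"
    by (auto elim!: M_cases intro!: subfield_add subfield_mult intro: subfield_Rats)
qed

lemma M_field_trace_Rats: "field_trace M x \<in> \<rat>" if "x \<in> M"
proof -
  define e where "e = [restrict (\<lambda>x. x) M, restrict cnj M]"
  have "embeddings M = set e"
  proof
    show "embeddings M \<subseteq> set e"
    proof
      fix g assume g: "g \<in> embeddings M"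
      interpret subfield_hom M g by (rule embedding_subfield_hom[OF M_subfield g])
      have rat: "g q = q" if q: "q \<in> \<rat>" for q
      proof -
        obtain l k where kl: "l > 0" "q = of_int k / of_int l" by (rule Rats_cases'[OF q])
        then have "g (q * of_int l) = g (of_int k)" by simp
        then have "g q * of_int l = of_int k"
          unfolding hom_mult[OF M_Rats[OF q] subfield_of_int[OF M_subfield]] hom_of_int .
        moreover have "q * of_int l = of_int k" using kl by simp
        ultimately have "g q * of_int l = q * of_int l" by simp
        then show ?thesis using kl(1) by simp
      qed
      have "g \<delta> ^ 2 = g (- of_nat d)" using hom_power[OF M_delta, of 2] unfolding delta_sq by simp
      then have "g \<delta> ^ 2 = \<delta> ^ 2" using rat[of "- of_nat d"] delta_sq by simp
      then have "g \<delta> = \<delta> \<or> g \<delta> = - \<delta>" by (simp add: power2_eq_iff)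
      moreover have comb: "g (r + s * \<delta>) = r + s * g \<delta>" if "r \<in> \<rat>" "s \<in> \<rat>" for r s
        using that by (simp add: hom_add hom_mult subfield_mult[OF M_subfield] M_Rats M_delta rat)
      ultimately consider "\<forall>r\<in>\<rat>. \<forall>s\<in>\<rat>. g (r + s * \<delta>) = r + s * \<delta>"
        | "\<forall>r\<in>\<rat>. \<forall>s\<in>\<rat>. g (r + s * \<delta>) = r + s * - \<delta>"
        by metis
      then have "(\<forall>x\<in>M. g x = x) \<or> (\<forall>x\<in>M. g x = cnj x)"
        by cases (auto elim!: M_cases simp: cnj_Rats cnj_delta)
      then have "restrict g M \<in> set e" unfolding e_def by (auto intro!: restrict_ext)
      moreover have "g = restrict g M" using g unfolding embeddings_def by (simp add: extensional_restrict)
      ultimately show "g \<in> set e" by simp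
    qed
    show "set e \<subseteq> embeddings M"
      unfolding e_def embeddings_def
      by (auto simp: M_Rats subfield_add[OF M_subfield] subfield_mult[OF M_subfield])
  qed
  moreover have "distinct e"
  proof -
    have "restrict (\<lambda>x. x) M \<noteq> restrict cnj M"
    proof
      assume "restrict (\<lambda>x. x) M = restrict cnj M"
      then have "restrict (\<lambda>x. x) M \<delta> = restrict cnj M \<delta>" by (rule fun_cong)
      then show False using M_delta delta_nonzero by (simp add: cnj_delta)
    qed
    then show ?thesis unfolding e_def by simp
  qed
  ultimately have "field_trace M x = (\<Sum>g\<leftarrow>e. g x)"
    unfolding field_trace_def by (simp add: sum_list_distinct_conv_sum_set)
  then have "field_trace M x = x + cnj x" using that unfolding e_def by simp
  moreover have "x + cnj x \<in> \<rat>" using that by (auto elim!: M_cases simp: cnj_Rats cnj_delta)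
  ultimately show ?thesis by simp
qed

lemma M_integral_basis: "\<exists>ws. integral_basis M ws"
proof -
  define v :: "nat \<Rightarrow> complex" where "v i = [1, \<delta>] ! i / (2 * of_nat d)" for i
  have comb: "(\<Sum>i<2. of_int (c i) * v i) = (of_int (c 0) + of_int (c 1) * \<delta>) / (2 * of_nat d)"
    for c :: "nat \<Rightarrow> int"
    by (simp add: v_def numeral_eq_Suc lessThan_Suc add_divide_distrib algebra_simps)
  let ?O = "ring_of_integers M"
  have "\<exists>ws. set ws \<subseteq> ?O \<and> (\<forall>x\<in>?O. \<exists>c. x = int_comb c ws) \<and>
    (\<forall>c. int_comb c ws = 0 \<longrightarrow> (\<forall>i<length ws. c i = 0))"
  proof (rule subgroup_of_free_group_free[where n = 2 and v = v])
    fix c :: "nat \<Rightarrow> int" assume "(\<Sum>i<2. of_int (c i) * v i) = 0"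
    then have "of_int (c 0) + of_int (c 1) * \<delta> = 0" unfolding comb using d_pos by simp
    then have "c 0 = 0 \<and> c 1 = 0" using real_independent[of "of_int (c 0)" "of_int (c 1)"] by simp
    then show "\<forall>i<2. c i = 0" by (auto simp: numeral_eq_Suc less_Suc_eq)
  next
    show "0 \<in> ?O" using integers_of_int[OF M_subfield, of 0] by simp
  next
    fix x y assume "x \<in> ?O" "y \<in> ?O"
    then show "x - y \<in> ?O" by (rule integers_diff[OF M_subfield])
  next
    fix x assume "x \<in> ?O"
    then have x: "x \<in> M" "algebraic_int x" by (auto simp: ring_of_integers_def)
    obtain r s where *: "r \<in> \<rat>" "s \<in> \<rat>" "x = r + s * \<delta>" using M_cases[OF x(1)] by blast
    have xc: "x + cnj x = 2 * r" "\<delta> * (x - cnj x) = 2 * s * (\<delta> * \<delta>)"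
      unfolding *(3) cnj_M_comb[OF *(1,2)] by (simp_all add: algebra_simps)
    have "algebraic_int (x + cnj x)" "algebraic_int (\<delta> * (x - cnj x))"
      by (intro algebraic_int_add algebraic_int_mult algebraic_int_diff algebraic_int_cnj
        algebraic_int_delta x)+
    then have "algebraic_int (2 * r)" "algebraic_int (- (2 * s * of_nat d))"
      unfolding xc delta_mult by simp_all
    moreover have "2 * r \<in> \<rat>" "- (2 * s * of_nat d) \<in> \<rat>" using * by auto
    ultimately obtain k l where kl: "2 * r = of_int k" "- (2 * s * of_nat d) = of_int l"
      using rational_algebraic_int_obtain by metis
    have "x = (of_int (int d * k) + of_int (- l) * \<delta>) / (2 * of_nat d)"
      using d_pos unfolding *(3) of_int_minus kl(2)[symmetric] of_int_mult kl(1)[symmetric]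
      by (simp add: field_simps)
    also have "\<dots> = (\<Sum>i<2. of_int ([int d * k, - l] ! i) * v i)" unfolding comb by simp
    finally show "\<exists>c. x = (\<Sum>i<2. of_int (c i) * v i)" by (intro exI[of _ "\<lambda>i. [int d * k, - l] ! i"])
  qed
  then obtain ws where "set ws \<subseteq> ?O" "\<And>x. x \<in> ?O \<Longrightarrow> \<exists>c. x = int_comb c ws"
    "\<And>c. int_comb c ws = 0 \<Longrightarrow> \<forall>i<length ws. c i = 0" by auto
  then show ?thesis by (intro exI[of _ ws] integral_basisI)
qed

lemma M_prime_dvd_discriminant:
  assumes "prime p" "x \<in> M" "nil_mod p x" "\<not> algebraic_int (x / of_int p)"
  shows "p dvd field_discriminant M"
proof -
  obtain ws where "integral_basis M ws" using M_integral_basis by blast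
  then show ?thesis
    by (rule prime_dvd_discriminant[OF M_subfield _ _ assms(1,2,3,4)])
      (auto simp: ring_of_integers_def M_field_trace_Rats)
qed

lemma prime_dvd_M_discriminant:
  assumes p: "prime p" "p dvd int d" and ndvd: "\<not> p ^ 2 dvd int d"
  shows "p dvd field_discriminant M"
proof (rule M_prime_dvd_discriminant[OF p(1) M_delta])
  have p0: "p \<noteq> 0" using p by auto
  obtain k where k: "int d = p * k" using p(2) by blast
  have d: "(of_nat d :: complex) = of_int (p * k)" unfolding k[symmetric] by simp
  have "\<delta> ^ 2 / of_int p = of_int (- k)" unfolding delta_sq d using p0 by simp
  then show "nil_mod p \<delta>"
    unfolding nil_mod_def using algebraic_int_delta by (metis algebraic_int_of_int)
  show "\<not> algebraic_int (\<delta> / of_int p)"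
  proof
    assume "algebraic_int (\<delta> / of_int p)"
    then have "algebraic_int ((\<delta> / of_int p) ^ 2)" by (rule algebraic_int_pow)
    then have "algebraic_int (- of_nat d / of_int p ^ 2 :: complex)" by (simp add: power_divide delta_sq)
    moreover have "- of_nat d / of_int p ^ 2 \<in> (\<rat> :: complex set)" by auto
    ultimately obtain l where "- of_nat d / of_int p ^ 2 = (of_int l :: complex)"
      using rational_algebraic_int_obtain by metis
    then have "(of_int (- int d) :: complex) = of_int (l * p ^ 2)" using p0 by (simp add: field_simps)
    then have "- int d = l * p ^ 2" by (simp only: of_int_eq_iff)
    then have "p ^ 2 dvd - int d" by simp
    then show False using ndvd by (simp only: dvd_minus_iff)
  qed
qed

text \<open>
  The element \<open>d + \<delta>\<close> serves for both parities of \<open>d\<close>: its square is \<open>d (d - 1) + 2 d \<delta>\<close>.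
\<close>

lemma nil_mod_2_delta_add: "nil_mod 2 (of_nat d + \<delta>)"
proof -
  have "even (int d ^ 2 - int d)" by simp
  then obtain k where "int d ^ 2 - int d = 2 * k" by blast
  then have k: "(of_nat d :: complex) ^ 2 - of_nat d = 2 * of_int k"
    by (metis of_int_diff of_int_mult of_int_numeral of_int_of_nat_eq of_int_power)
  have "(of_nat d + \<delta>) ^ 2 = (of_nat d ^ 2 - of_nat d) + 2 * of_nat d * \<delta>"
    using delta_sq by (simp add: algebra_simps power2_eq_square)
  then have "(of_nat d + \<delta>) ^ 2 / of_int 2 = of_int k + of_nat d * \<delta>" unfolding k by simp
  moreover have "algebraic_int (of_int k + of_nat d * \<delta>)" "algebraic_int (of_nat d + \<delta>)"
    by (intro algebraic_int_add algebraic_int_mult algebraic_int_delta algebraic_int_of_int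
      algebraic_int_of_nat)+
  ultimately show ?thesis unfolding nil_mod_def by metis
qed

lemma even_M_discriminant:
  assumes "d mod 4 = 1 \<or> d mod 4 = 2"
  shows "2 dvd field_discriminant M"
proof (rule M_prime_dvd_discriminant[OF _ _ nil_mod_2_delta_add])
  show "of_nat d + \<delta> \<in> M" using M_intro[of "of_nat d" 1] by simp
  show "\<not> algebraic_int ((of_nat d + \<delta>) / of_int 2)"
  proof
    let ?x = "(of_nat d + \<delta>) / of_int 2"
    assume "algebraic_int ?x"
    then have "algebraic_int (?x * cnj ?x)" by (intro algebraic_int_mult algebraic_int_cnj)
    moreover have "?x * cnj ?x = of_nat (d * (d + 1)) / 4"
      using delta_sq by (simp add: cnj_delta field_simps power2_eq_square)
    moreover have "of_nat (d * (d + 1)) / 4 \<in> (\<rat> :: complex set)" by (intro Rats_divide) auto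
    ultimately obtain l where "of_nat (d * (d + 1)) / 4 = (of_int l :: complex)"
      using rational_algebraic_int_obtain by metis
    then have "(of_int (int (d * (d + 1))) :: complex) = of_int (4 * l)" by (simp add: field_simps)
    then have "int (d * (d + 1)) = 4 * l" by (simp only: of_int_eq_iff)
    then have "4 dvd d * (d + 1)" by (metis dvd_triv_left int_dvd_int_iff of_nat_numeral)
    then have "d * (d + 1) mod 4 = 0" by (rule dvd_imp_mod_0)
    moreover have "d * (d + 1) mod 4 = (d mod 4) * ((d mod 4 + 1) mod 4) mod 4"
      by (metis mod_mult_eq mod_add_left_eq mod_mod_trivial)
    ultimately show False using assms by (auto simp del: One_nat_def)
  qed
qed simp

text \<open>
  The square of \<open>\<delta> x\<close> is \<open>- d x\<^sup>2\<close>, and a square-free \<open>d\<close> cannot cancel the square of a denominator.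
\<close>

lemma integer_if_delta_mult_integral:
  assumes sf: "squarefree d" and x: "x \<in> \<rat>" "algebraic_int (\<delta> * x)"
  shows "x \<in> \<int>"
proof -
  have "algebraic_int (of_nat d * x)"
    using algebraic_int_mult[OF algebraic_int_minus[OF algebraic_int_delta] x(2)] delta_mult
    by (simp add: mult.assoc[symmetric])
  then obtain n where n: "of_nat d * x = of_int n"
    using x(1) rational_algebraic_int_obtain by (metis Rats_mult Rats_of_nat)
  have "algebraic_int (- ((\<delta> * x) ^ 2))" using x(2) by (intro algebraic_int_minus algebraic_int_pow)
  moreover have "- ((\<delta> * x) ^ 2) = of_nat d * x ^ 2" using delta_sq by (simp add: power_mult_distrib)
  ultimately obtain k where k: "of_nat d * x ^ 2 = of_int k"
    using x(1) rational_algebraic_int_obtain by (metis Rats_mult Rats_of_nat Rats_power)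
  have "of_int (n ^ 2) = (of_nat d * x) ^ 2" unfolding n by simp
  also have "\<dots> = of_nat d * (of_nat d * x ^ 2)" by (simp add: power2_eq_square)
  also have "\<dots> = of_int (int d * k)" unfolding k by simp
  finally have "n ^ 2 = int d * k" by (simp only: of_int_eq_iff)
  then have "int d dvd n ^ 2" by simp
  then have "d dvd nat \<bar>n\<bar> ^ 2"
    by (metis dvd_nat_abs_iff nat_power_eq abs_ge_zero power2_abs int_dvd_int_iff nat_0_le of_nat_power)
  then have "d dvd nat \<bar>n\<bar>" using sf squarefree_dvd_square by blast
  then obtain l where "n = int d * l" by (metis dvd_def int_dvd_int_iff nat_0_le abs_ge_zero dvd_abs_iff)
  then have "x = of_int l" using n d_pos by simp
  then show ?thesis by simp
qed

end

section \<open>The composite field\<close>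

locale composite_octic = simplest_quartic a \<xi> + imaginary_quadratic d for a \<xi> d
begin

definition K :: "complex set" where "K = {u + v * \<delta> | u v. u \<in> L \<and> v \<in> L}"

text \<open>
  The automorphism of \<open>K\<close> that extends \<open>\<sigma>\<close> and fixes \<open>M\<close>. Since \<open>L\<close> is real, complex conjugation recovers
  the components \<open>u\<close> and \<open>v\<close> of \<open>x = u + v \<delta>\<close>.
\<close>

definition \<phi> :: "complex \<Rightarrow> complex" where
  "\<phi> x = \<sigma> ((x + cnj x) / 2) + \<sigma> ((x - cnj x) / (2 * \<delta>)) * \<delta>"

lemma cnj_L: "x \<in> L \<Longrightarrow> cnj x = x"
  using L_real by (simp add: Reals_cnj_iff)

lemma cnj_comb: "u \<in> L \<Longrightarrow> v \<in> L \<Longrightarrow> cnj (u + v * \<delta>) = u - v * \<delta>"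
  by (simp add: cnj_L cnj_delta)

lemma phi_comb: "u \<in> L \<Longrightarrow> v \<in> L \<Longrightarrow> \<phi> (u + v * \<delta>) = \<sigma> u + \<sigma> v * \<delta>"
  unfolding \<phi>_def by (simp add: cnj_comb delta_nonzero del: complex_cnj_add)

lemma K_cases:
  assumes "x \<in> K"
  obtains u v where "u \<in> L" "v \<in> L" "x = u + v * \<delta>"
  using assms unfolding K_def by blast

lemma K_intro: "u \<in> L \<Longrightarrow> v \<in> L \<Longrightarrow> u + v * \<delta> \<in> K"
  unfolding K_def by blast

lemma L_subset_K: "x \<in> L \<Longrightarrow> x \<in> K"
  using K_intro[of x 0] L_Rats by simp

lemma K_delta: "\<delta> \<in> K"
  using K_intro[of 0 1] L_Rats by simp

lemma K_comb_mult:
  "(u + v * \<delta>) * (u' + v' * \<delta>) = (u * u' - of_nat d * (v * v')) + (u * v' + v * u') * \<delta>"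
proof -
  have "(u + v * \<delta>) * (u' + v' * \<delta>) = (u * u' + v * v' * (\<delta> * \<delta>)) + (u * v' + v * u') * \<delta>"
    by (simp add: algebra_simps)
  then show ?thesis unfolding delta_mult by (simp add: algebra_simps)
qed

lemma L_of_nat: "of_nat n \<in> L"
  by (rule L_Rats) simp

lemma K_comb_mult_in_L:
  assumes "u \<in> L" "v \<in> L" "u' \<in> L" "v' \<in> L"
  shows "u * u' - of_nat d * (v * v') \<in> L" "u * v' + v * u' \<in> L"
  using assms by (auto intro!: L_add L_diff L_mult L_of_nat)

lemma K_subfield: "is_subfield K"
proof -
  have mult: "x * y \<in> K" if xy: "x \<in> K" "y \<in> K" for x y
  proof -
    obtain u v u' v' where *: "u \<in> L" "v \<in> L" "x = u + v * \<delta>" "u' \<in> L" "v' \<in> L" "y = u' + v' * \<delta>"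
      using K_cases[OF xy(1)] K_cases[OF xy(2)] by metis
    show ?thesis unfolding *(3,6) K_comb_mult by (rule K_intro) (use * in \<open>auto intro!: K_comb_mult_in_L\<close>)
  qed
  have diff: "x - y \<in> K" if xy: "x \<in> K" "y \<in> K" for x y
  proof -
    obtain u v u' v' where *: "u \<in> L" "v \<in> L" "x = u + v * \<delta>" "u' \<in> L" "v' \<in> L" "y = u' + v' * \<delta>"
      using K_cases[OF xy(1)] K_cases[OF xy(2)] by metis
    have "x - y = (u - u') + (v - v') * \<delta>" unfolding * by (simp add: algebra_simps)
    also have "\<dots> \<in> K" by (rule K_intro) (use * in \<open>auto intro!: L_diff\<close>)
    finally show ?thesis .
  qed
  have "inverse x \<in> K" if x: "x \<in> K" for x
  proof (cases "x = 0")
    case False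
    obtain u v where *: "u \<in> L" "v \<in> L" "x = u + v * \<delta>" using K_cases[OF x] by blast
    have c: "cnj x = u + (- v) * \<delta>" unfolding *(3) by (simp add: cnj_L cnj_delta *)
    have n: "x * cnj x = u * u + of_nat d * (v * v)"
      unfolding c unfolding *(3) K_comb_mult by simp
    have "inverse x = cnj x * inverse (x * cnj x)" using False by simp
    also have "\<dots> \<in> K" unfolding n
    proof (rule mult)
      show "cnj x \<in> K" unfolding c by (rule K_intro) (use * in \<open>auto intro: L_minus\<close>)
      show "inverse (u * u + of_nat d * (v * v)) \<in> K"
        using * by (intro L_subset_K subfield_inverse[OF L_subfield] L_add L_mult L_of_nat)
    qed
    finally show ?thesis .
  next
    case True
    then show ?thesis using L_subset_K[of 0] L_Rats[of 0] by simp
  qed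
  then show ?thesis unfolding is_subfield_def using mult diff by (auto intro!: L_subset_K L_Rats)
qed

lemma K_eq_composite: "composite_field L M = K"
  unfolding composite_field_def field_adjoin_def
proof (rule hull_unique)
  show "L \<union> M \<subseteq> K"
    by (auto elim!: M_cases intro: L_subset_K K_intro L_Rats)
  show "is_subfield K" by (rule K_subfield)
next
  fix F assume "L \<union> M \<subseteq> F" "is_subfield F"
  then show "K \<subseteq> F" using M_delta
    by (auto elim!: K_cases intro!: subfield_add subfield_mult)
qed

lemma phi_K: "x \<in> K \<Longrightarrow> \<phi> x \<in> K"
  by (auto elim!: K_cases simp: phi_comb intro!: K_intro sigma_L)

lemma phi_L: "x \<in> L \<Longrightarrow> \<phi> x = \<sigma> x"
  using phi_comb[of x 0] L_Rats[of 0] sigma_Rats[of 0] by simp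

lemma phi_delta: "\<phi> \<delta> = \<delta>"
  using phi_comb[of 0 1] L_Rats[of 0] L_Rats[of 1] sigma_Rats[of 0] sigma_Rats[of 1] by simp

lemma phi_hom: "subfield_hom K \<phi>"
proof
  show "is_subfield K" by (rule K_subfield)
  show "\<phi> 1 = 1" using phi_L[of 1] L_Rats[of 1] sigma_one by simp
next
  fix x y assume xy: "x \<in> K" "y \<in> K"
  obtain u v u' v' where *: "u \<in> L" "v \<in> L" "x = u + v * \<delta>" "u' \<in> L" "v' \<in> L" "y = u' + v' * \<delta>"
    using K_cases[OF xy(1)] K_cases[OF xy(2)] by metis
  have "x + y = (u + u') + (v + v') * \<delta>" unfolding * by (simp add: algebra_simps)
  then have "\<phi> (x + y) = \<sigma> (u + u') + \<sigma> (v + v') * \<delta>" using * by (simp only: phi_comb L_add)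
  then show "\<phi> (x + y) = \<phi> x + \<phi> y" using * by (simp add: phi_comb sigma_add algebra_simps)
  have "\<phi> (x * y) = \<sigma> (u * u' - of_nat d * (v * v')) + \<sigma> (u * v' + v * u') * \<delta>"
    unfolding *(3,6) K_comb_mult by (rule phi_comb) (use * in \<open>auto intro!: K_comb_mult_in_L\<close>)
  also have "\<dots> = (\<sigma> u * \<sigma> u' - of_nat d * (\<sigma> v * \<sigma> v')) + (\<sigma> u * \<sigma> v' + \<sigma> v * \<sigma> u') * \<delta>"
    using * by (simp add: sigma_add sigma_diff sigma_mult L_mult L_of_nat sigma_Rats)
  also have "\<dots> = \<phi> x * \<phi> y" unfolding K_comb_mult[symmetric] using * by (simp add: phi_comb)
  finally show "\<phi> (x * y) = \<phi> x * \<phi> y" .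
qed

lemma phi4: "x \<in> K \<Longrightarrow> \<phi> (\<phi> (\<phi> (\<phi> x))) = x"
  by (auto elim!: K_cases simp: phi_comb sigma_L sigma4)

lemma fixed_phi: "x \<in> K \<Longrightarrow> \<phi> x = x \<Longrightarrow> x \<in> M"
proof (elim K_cases)
  fix u v assume *: "\<phi> x = x" "u \<in> L" "v \<in> L" "x = u + v * \<delta>"
  then have "(\<sigma> u - u) + (\<sigma> v - v) * \<delta> = 0" by (simp add: phi_comb algebra_simps)
  moreover have "\<sigma> u - u \<in> \<real>" "\<sigma> v - v \<in> \<real>" using * by (auto intro!: L_real L_diff sigma_L)
  ultimately have "\<sigma> u = u \<and> \<sigma> v = v" using real_independent by fastforce
  then show "x \<in> M" using * fixed_sigma by (auto intro: M_intro)
qed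

end

text \<open>
  Since \<open>x\<close> is a polynomial in \<open>\<alpha>\<close> and \<open>g x\<close> is the same polynomial in \<open>g \<alpha>\<close>, this is the divisibility of
  polynomial differences.
\<close>

lemma generator_diff_divides:
  assumes gen: "ring_of_integers F = int_adjoin \<alpha>" and g: "subfield_hom F g"
    and x: "x \<in> F" "algebraic_int x" and \<alpha>: "\<alpha> \<in> F" "algebraic_int \<alpha>"
  shows "\<exists>q. algebraic_int q \<and> x - g x = (\<alpha> - g \<alpha>) * q"
proof -
  interpret subfield_hom F g by (rule g)
  obtain p :: "int poly" where p: "x = poly (map_poly of_int p) \<alpha>"
    using gen x unfolding ring_of_integers_def int_adjoin_def by blast
  then have "g x = poly (map_poly of_int p) (g \<alpha>)" using hom_of_int_poly[OF \<alpha>(1)] by simp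
  then show ?thesis
    using poly_diff_divisible[OF \<alpha>(2) hom_algebraic_int[OF \<alpha>], of p] p by simp
qed

section \<open>The case of odd discriminant of the quadratic field\<close>

lemma coprime_divisor_unit:
  assumes "coprime (k :: int) l" and "algebraic_int (of_int k * x :: complex)" "algebraic_int (of_int l * x)"
  shows "algebraic_int x"
proof -
  obtain s t where st: "k * s + l * t = 1" using assms(1) by (metis bezout_int coprime_imp_gcd_eq_1 mult.commute)
  have "of_int s * (of_int k * x) + of_int t * (of_int l * x) = of_int (k * s + l * t) * x"
    by (simp add: algebra_simps)
  also have "\<dots> = x" unfolding st by simp
  finally have "x = of_int s * (of_int k * x) + of_int t * (of_int l * x)" ..
  also have "algebraic_int \<dots>"
    by (rule algebraic_int_add[OF algebraic_int_mult[OF algebraic_int_of_int assms(2)]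
      algebraic_int_mult[OF algebraic_int_of_int assms(3)]])
  finally show ?thesis .
qed

lemma int_unit_if_inverse_integral:
  assumes "of_int k * x = (1 :: complex)" "algebraic_int x"
  shows "k = 1 \<or> k = -1"
proof -
  have "k \<noteq> 0" using assms(1) by auto
  then have "x = 1 / of_int k" using assms(1) by (simp add: field_simps)
  then have "x \<in> \<rat>" by simp
  then obtain l where "x = of_int l" using rational_algebraic_int_obtain[OF assms(2)] by blast
  then have "(of_int (k * l) :: complex) = of_int 1" using assms(1) by simp
  then have "k * l = 1" by (simp only: of_int_eq_iff)
  then show ?thesis by (simp add: zmult_eq_1_iff) auto
qed

context composite_octic
begin

lemma cnj_hom: "subfield_hom K cnj"
  by unfold_locales (simp_all add: K_subfield)

lemma phi2_hom: "subfield_hom K (\<lambda>x. \<phi> (\<phi> x))"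
  using subfield_hom.hom_add[OF phi_hom] subfield_hom.hom_mult[OF phi_hom] subfield_hom.hom_one[OF phi_hom]
  by unfold_locales (simp_all add: K_subfield phi_K)

lemma cnj_phi2_hom: "subfield_hom K (\<lambda>x. cnj (\<phi> (\<phi> x)))"
  using subfield_hom.hom_add[OF phi2_hom] subfield_hom.hom_mult[OF phi2_hom] subfield_hom.hom_one[OF phi2_hom]
  by unfold_locales (simp_all add: K_subfield)

lemma phi_algebraic_int: "x \<in> K \<Longrightarrow> algebraic_int x \<Longrightarrow> algebraic_int (\<phi> x)"
  by (rule subfield_hom.hom_algebraic_int[OF phi_hom])

text \<open>
  On the one hand \<open>d g = - \<delta> (\<delta> g)\<close> is integral. On the other hand the elements \<open>x\<close> of \<open>L\<close> with integral
  \<open>\<delta> x\<close> form a group to which the bound for denominators applies, so \<open>16 m\<^sup>2 g\<close> is integral. The two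
  multipliers are coprime.
\<close>

lemma integral_component:
  assumes sf: "squarefree d" and cop: "coprime (int d) (2 * m)"
    and g: "g \<in> L" "algebraic_int (\<delta> * g)"
  shows "algebraic_int g"
proof (rule coprime_divisor_unit)
  let ?J = "{x \<in> L. algebraic_int (\<delta> * x)}"
  have "\<exists>r s t u. 16 * of_int m ^ 2 * g = quartic_comb \<eta> \<xi> (of_int r) (of_int s) (of_int t) (of_int u)"
  proof (rule denominators[where J = ?J])
    fix x y assume "x \<in> ?J" "y \<in> ?J"
    then show "x + y \<in> ?J" by (auto simp: ring_distribs intro: L_add)
  next
    fix c x assume *: "c \<in> L" "algebraic_int c" "x \<in> ?J"
    then have "algebraic_int (c * (\<delta> * x))" by auto
    then have "algebraic_int (\<delta> * (c * x))" by (metis mult.left_commute)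
    then show "c * x \<in> ?J" using * by (auto intro: L_mult)
  next
    fix x assume x: "x \<in> ?J"
    have dx: "\<delta> * x \<in> K" using x by (intro subfield_mult[OF K_subfield K_delta] L_subset_K) auto
    have "\<phi> (\<delta> * x) = \<delta> * \<sigma> x"
      using x subfield_hom.hom_mult[OF phi_hom K_delta L_subset_K] by (simp add: phi_delta phi_L)
    then show "\<sigma> x \<in> ?J" using phi_algebraic_int[OF dx] x by (auto intro: sigma_L)
  next
    fix x assume "x \<in> ?J" "x \<in> \<rat>"
    then show "x \<in> \<int>" using integer_if_delta_mult_integral[OF sf] by blast
  qed (use g in auto)
  then obtain r s t u
    where *: "16 * of_int m ^ 2 * g = quartic_comb \<eta> \<xi> (of_int r) (of_int s) (of_int t) (of_int u)" by blast
  have "algebraic_int (quartic_comb \<eta> \<xi> (of_int r) (of_int s) (of_int t) (of_int u))"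
    by (intro algebraic_int_add algebraic_int_mult algebraic_int_eta algebraic_int_xi algebraic_int_of_int)
  then show "algebraic_int (of_int (16 * m ^ 2) * g)" using * by simp
  have "algebraic_int (- (\<delta> * (\<delta> * g)))"
    by (intro algebraic_int_minus algebraic_int_mult algebraic_int_delta g)
  moreover have "- (\<delta> * (\<delta> * g)) = of_int (int d) * g" using delta_mult by (simp add: mult.assoc[symmetric])
  ultimately show "algebraic_int (of_int (int d) * g)" by simp
  have "coprime (int d) 2" "coprime (int d) m" using cop by auto
  then have "coprime (int d) (2 ^ 4 * m ^ 2)"
    by (simp only: coprime_mult_right_iff coprime_power_right_iff) simp
  then show "coprime (16 * m ^ 2) (int d)" by (simp add: coprime_commute)
qed

text \<open>
  An element fixed by \<open>\<sigma>\<^sup>2\<close> lies in the quadratic subfield, so \<open>x \<cdot> \<sigma> x\<close> is its norm; the norm of a unit is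
  a unit of \<open>\<int>\<close>.
\<close>

lemma norm_unit:
  assumes x: "x \<in> L" "algebraic_int x" and y: "x * y = 1" "algebraic_int y"
    and fixed: "\<sigma> (\<sigma> x) = x"
  shows "x * \<sigma> x = 1 \<or> x * \<sigma> x = - 1"
proof -
  have "x * \<sigma> x \<in> \<rat>"
    by (rule fixed_sigma) (simp_all add: x fixed L_mult sigma_L sigma_mult mult.commute)
  moreover have "algebraic_int (x * \<sigma> x)" using x by (intro algebraic_int_mult sigma_algebraic_int)
  ultimately obtain k where k: "x * \<sigma> x = of_int k" using rational_algebraic_int_obtain by metis
  have "y = inverse x" using y(1) by (metis inverse_unique)
  then have yL: "y \<in> L" using subfield_inverse[OF L_subfield x(1)] by simp
  have "\<sigma> x * \<sigma> y = 1" using sigma_mult[OF x(1) yL] y(1) sigma_one by simp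
  then have "(x * \<sigma> x) * (y * \<sigma> y) = 1" using y(1) by (simp add: mult_ac)
  then have "k = 1 \<or> k = -1"
    unfolding k by (rule int_unit_if_inverse_integral) (intro algebraic_int_mult y sigma_algebraic_int yL)
  then show ?thesis using k by auto
qed

text \<open>
  Write \<open>\<alpha> = u + v \<delta>\<close> with \<open>u\<close>, \<open>v\<close> in \<open>L\<close>, and let \<open>\<gamma> = 2 v\<close>. Complex conjugation shows that \<open>\<gamma>\<close> is a
  unit. The automorphism \<open>g = cnj \<circ> \<phi>\<^sup>2\<close> belongs to no inertia group, since the ramified primes of \<open>L\<close> and
  of \<open>M\<close> lie above different rational primes; so \<open>\<epsilon> = \<alpha> - g \<alpha>\<close> is a unit as well, and \<open>4 |\<epsilon>|\<^sup>2 = b\<^sup>2 + d c\<^sup>2\<close> with \<open>c = \<gamma> + \<sigma>\<^sup>2 \<gamma>\<close> in the quadratic subfield. Its norm is 16, so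
  positivity leaves only \<open>c = 0\<close> once \<open>d\<^sup>2 > 16\<close>. But then \<open>\<gamma> \<cdot> \<sigma> \<gamma> = \<plusminus> 1\<close>, whereas
  \<open>\<sigma> (\<gamma> \<cdot> \<sigma> \<gamma>) = - \<gamma> \<cdot> \<sigma> \<gamma>\<close>.
\<close>

lemma not_monogenic_if_3_mod_4:
  assumes sf: "squarefree d" and d34: "d mod 4 = 3" and d7: "d \<ge> 7" and cop: "coprime (int d) m"
  shows "\<not> monogenic K"
proof
  assume "monogenic K"
  then obtain \<alpha> where "\<alpha> \<in> ring_of_integers K" and gen: "ring_of_integers K = int_adjoin \<alpha>"
    unfolding monogenic_def by blast
  then have \<alpha>: "\<alpha> \<in> K" "algebraic_int \<alpha>" by (auto simp: ring_of_integers_def)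
  obtain u v where uv: "u \<in> L" "v \<in> L" "\<alpha> = u + v * \<delta>" using K_cases[OF \<alpha>(1)] by blast
  have "odd d" using d34 by presburger
  then have cop2: "coprime (int d) (2 * m)" using cop by simp
  define \<omega> where "\<omega> = (1 + \<delta>) / 2"
  have \<omega>K: "\<omega> \<in> K"
    using K_intro[of "1/2" "1/2"] L_Rats[of "1/2"] unfolding \<omega>_def by (simp add: add_divide_distrib)
  have "\<exists>e. 1 + int d = 4 * e" using d34 by presburger
  then obtain e where "1 + int d = 4 * e" by blast
  then have "1 + of_nat d = (4 * of_int e :: complex)"
    by (metis of_int_1 of_int_add of_int_mult of_int_numeral of_int_of_nat_eq)
  then have e: "of_int e = (1 + of_nat d) / (4 :: complex)" by simp
  have "\<omega> ^ 2 = of_int 1 * \<omega> + of_int (- e)"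
    using delta_sq unfolding \<omega>_def of_int_minus e by (simp add: field_simps power2_eq_square)
  then have \<omega>int: "algebraic_int \<omega>" by (rule algebraic_int_quadratic)
  have \<omega>phi: "\<phi> \<omega> = \<omega>"
    using phi_comb[of "1/2" "1/2"] L_Rats[of "1/2"] sigma_Rats[of "1/2"]
    unfolding \<omega>_def by (simp add: add_divide_distrib)
  have \<omega>cnj: "\<omega> - cnj \<omega> = \<delta>" unfolding \<omega>_def by (simp add: cnj_delta field_simps)

  \<comment> \<open>\<open>\<delta> \<gamma> = \<alpha> - cnj \<alpha>\<close> divides \<open>\<omega> - cnj \<omega> = \<delta>\<close>, so the inverse \<open>q\<close> of \<open>\<gamma>\<close> is integral, too\<close>
  define \<gamma> where "\<gamma> = 2 * v"
  have \<gamma>L: "\<gamma> \<in> L" unfolding \<gamma>_def by (intro L_mult L_numeral uv)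
  have \<alpha>cnj: "\<alpha> - cnj \<alpha> = \<delta> * \<gamma>"
    unfolding \<gamma>_def uv(3) by (simp add: cnj_L uv cnj_delta)
  have "algebraic_int (\<delta> * \<gamma>)"
    unfolding \<alpha>cnj[symmetric] using \<alpha>(2) by (intro algebraic_int_diff algebraic_int_cnj)
  then have \<gamma>int: "algebraic_int \<gamma>" by (rule integral_component[OF sf cop2 \<gamma>L])
  obtain q where q: "algebraic_int q" "\<omega> - cnj \<omega> = (\<alpha> - cnj \<alpha>) * q"
    using generator_diff_divides[OF gen cnj_hom \<omega>K \<omega>int \<alpha>] by blast
  have "\<delta> = \<delta> * (\<gamma> * q)" using q(2) unfolding \<omega>cnj \<alpha>cnj by (simp add: mult.assoc)
  then have \<gamma>q: "\<gamma> * q = 1" using delta_nonzero by simp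

  \<comment> \<open>\<open>\<epsilon>\<close> divides \<open>\<omega> - g \<omega> = \<delta>\<close> and \<open>\<xi> - g \<xi> = 2 \<xi> - \<eta>\<close>, hence the coprime integers \<open>d\<close> and \<open>4 m\<close>\<close>
  define \<epsilon> where "\<epsilon> = \<alpha> - cnj (\<phi> (\<phi> \<alpha>))"
  have \<epsilon>int: "algebraic_int \<epsilon>"
    unfolding \<epsilon>_def by (intro algebraic_int_diff algebraic_int_cnj phi_algebraic_int phi_K \<alpha>)
  obtain q1 where q1: "algebraic_int q1" "\<omega> - cnj (\<phi> (\<phi> \<omega>)) = \<epsilon> * q1"
    using generator_diff_divides[OF gen cnj_phi2_hom \<omega>K \<omega>int \<alpha>] unfolding \<epsilon>_def by blast
  then have \<delta>q1: "\<delta> = \<epsilon> * q1" by (simp add: \<omega>phi \<omega>cnj)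
  obtain q2 where q2: "algebraic_int q2" "\<xi> - cnj (\<phi> (\<phi> \<xi>)) = \<epsilon> * q2"
    using generator_diff_divides[OF gen cnj_phi2_hom L_subset_K[OF L_xi] algebraic_int_xi \<alpha>]
    unfolding \<epsilon>_def by blast
  have "cnj (\<phi> (\<phi> \<xi>)) = \<eta> - \<xi>"
    by (simp add: phi_L L_xi sigma_L sigma2_xi cnj_L L_eta)
  then have \<xi>q2: "2 * \<xi> - \<eta> = \<epsilon> * q2" using q2(2) by simp
  have \<epsilon>0: "\<epsilon> \<noteq> 0" using \<delta>q1 delta_nonzero by auto
  have \<epsilon>inv: "algebraic_int (inverse \<epsilon>)"
  proof (rule coprime_divisor_unit)
    have "- (\<delta> * q1) * \<epsilon> = of_int (int d)" using \<delta>q1 delta_mult by (simp add: mult_ac)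
    then have "of_int (int d) * inverse \<epsilon> = - (\<delta> * q1)" using \<epsilon>0 by (simp add: field_simps)
    then show "algebraic_int (of_int (int d) * inverse \<epsilon>)"
      using algebraic_int_minus[OF algebraic_int_mult[OF algebraic_int_delta q1(1)]] by simp
    have "of_int (4 * m) = (2 * \<xi> - \<eta>) ^ 2 * (\<eta>' ^ 2 + 4)"
      unfolding xi_disc norm_eta_sq_plus_4 by simp
    also have "\<dots> = (2 * \<xi> - \<eta>) * q2 * (\<eta>' ^ 2 + 4) * \<epsilon>"
      unfolding \<xi>q2 by (simp add: power2_eq_square mult_ac)
    finally have "of_int (4 * m) * inverse \<epsilon> = (2 * \<xi> - \<eta>) * q2 * (\<eta>' ^ 2 + 4)" using \<epsilon>0 by simp
    also have "algebraic_int \<dots>"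
      by (intro algebraic_int_mult algebraic_int_add algebraic_int_diff algebraic_int_pow q2(1)
        algebraic_int_eta algebraic_int_eta' algebraic_int_xi algebraic_int_numeral)
    finally show "algebraic_int (of_int (4 * m) * inverse \<epsilon>)" .
    have "coprime (int d) 2" using cop2 by simp
    then have "coprime (int d) (2 ^ 2 * m)"
      using cop by (simp only: coprime_mult_right_iff coprime_power_right_iff) simp
    then show "coprime (int d) (4 * m)" by simp
  qed

  \<comment> \<open>\<open>w = |\<epsilon>|\<^sup>2\<close> is a unit of the quadratic subfield, because \<open>\<sigma>\<^sup>2\<close> changes the sign of \<open>b\<close> and fixes \<open>c\<close>\<close>
  define b where "b = 2 * (u - \<sigma> (\<sigma> u))"
  define c where "c = \<gamma> + \<sigma> (\<sigma> \<gamma>)"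
  have bL: "b \<in> L" and cL: "c \<in> L"
    unfolding b_def c_def using uv \<gamma>L by (auto intro!: L_mult L_diff L_add sigma_L L_numeral)
  have double: "\<sigma> (\<sigma> (2 * z)) = 2 * \<sigma> (\<sigma> z)" if "z \<in> L" for z
    using that by (simp add: sigma_mult L_numeral sigma_L sigma_Rats)
  have \<alpha>2: "cnj (\<phi> (\<phi> \<alpha>)) = \<sigma> (\<sigma> u) - \<sigma> (\<sigma> v) * \<delta>"
    unfolding uv(3) by (simp add: phi_comb uv sigma_L cnj_L cnj_delta)
  have \<epsilon>bc: "2 * \<epsilon> = b + c * \<delta>"
    unfolding \<epsilon>_def \<alpha>2 b_def c_def \<gamma>_def double[OF uv(2)] unfolding uv(3) by (simp add: algebra_simps)
  have "\<sigma> (\<sigma> b) = 2 * \<sigma> (\<sigma> (u - \<sigma> (\<sigma> u)))"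
    unfolding b_def by (rule double) (intro L_diff sigma_L uv)
  then have b2: "\<sigma> (\<sigma> b) = - b"
    unfolding b_def by (simp add: sigma_diff uv sigma_L sigma4)
  have c2: "\<sigma> (\<sigma> c) = c"
    unfolding c_def by (simp add: sigma_add \<gamma>L sigma_L sigma4)
  define w where "w = \<epsilon> * cnj \<epsilon>"
  have "4 * w = (2 * \<epsilon>) * cnj (2 * \<epsilon>)" unfolding w_def by simp
  also have "\<dots> = (b + c * \<delta>) * (b - c * \<delta>)"
    unfolding \<epsilon>bc by (simp add: cnj_L bL cL cnj_delta)
  also have "\<dots> = b ^ 2 - c ^ 2 * (\<delta> * \<delta>)" by (simp add: algebra_simps power2_eq_square)
  finally have w4: "4 * w = b ^ 2 + of_nat d * c ^ 2" unfolding delta_mult by simp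
  then have w_eq: "w = (1/4) * (b ^ 2 + of_nat d * c ^ 2)" by (simp add: w4[symmetric])
  have wL: "w \<in> L" unfolding w_eq power2_eq_square
    by (intro L_mult L_add L_of_nat bL cL L_Rats) auto
  have sw: "\<sigma> w = (1/4) * ((\<sigma> b) ^ 2 + of_nat d * (\<sigma> c) ^ 2)"
    unfolding w_eq power2_eq_square
    by (simp only: sigma_mult sigma_add L_mult L_add L_of_nat bL cL L_Rats sigma_Rats Rats_of_nat
      Rats_divide Rats_1 Rats_number_of)
  have sww: "\<sigma> (\<sigma> w) = w"
    unfolding sw unfolding w_eq power2_eq_square
    by (simp only: sigma_mult sigma_add L_mult L_add L_of_nat bL cL L_Rats sigma_Rats Rats_of_nat
      Rats_divide Rats_1 Rats_number_of sigma_L b2 c2 mult_minus_left mult_minus_right minus_minus)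
  have w_inv: "w * (inverse \<epsilon> * cnj (inverse \<epsilon>)) = 1"
    unfolding w_def using \<epsilon>0 by (simp add: field_simps)
  have "algebraic_int w" "algebraic_int (inverse \<epsilon> * cnj (inverse \<epsilon>))"
    unfolding w_def by (intro algebraic_int_mult algebraic_int_cnj \<epsilon>int \<epsilon>inv)+
  then have "w * \<sigma> w = 1 \<or> w * \<sigma> w = - 1"
    by (intro norm_unit[OF wL _ w_inv] sww)
  then have norm_w: "(4 * w) * (4 * \<sigma> w) = 16 \<or> (4 * w) * (4 * \<sigma> w) = - 16" by auto

  \<comment> \<open>\<open>c \<cdot> \<sigma> c\<close> is a rational integer \<open>n\<close> with \<open>d\<^sup>2 n\<^sup>2 \<le> 16\<close>, because all summands are nonnegative\<close>
  have "c * \<sigma> c \<in> \<rat>"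
    by (rule fixed_sigma) (simp_all add: cL c2 L_mult sigma_L sigma_mult mult.commute)
  moreover have "algebraic_int (c * \<sigma> c)"
    by (intro algebraic_int_mult sigma_algebraic_int cL)
      (auto simp: c_def intro!: algebraic_int_add \<gamma>int sigma_algebraic_int sigma_L \<gamma>L)
  ultimately obtain n where n: "c * \<sigma> c = of_int n" using rational_algebraic_int_obtain by metis
  obtain b0 c0 b1 c1 where re: "b = of_real b0" "c = of_real c0" "\<sigma> b = of_real b1" "\<sigma> c = of_real c1"
    using L_real[OF bL] L_real[OF cL] L_real[OF sigma_L[OF bL]] L_real[OF sigma_L[OF cL]]
    by (metis Reals_cases)
  have "of_real ((b0 ^ 2 + d * c0 ^ 2) * (b1 ^ 2 + d * c1 ^ 2)) = (4 * w) * (4 * \<sigma> w)"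
    unfolding w4 sw re(3,4) unfolding re(1,2) by simp
  then have "(of_real ((b0 ^ 2 + d * c0 ^ 2) * (b1 ^ 2 + d * c1 ^ 2)) :: complex) = of_real 16 \<or>
      (of_real ((b0 ^ 2 + d * c0 ^ 2) * (b1 ^ 2 + d * c1 ^ 2)) :: complex) = of_real (- 16)"
    using norm_w by simp
  then have "(b0 ^ 2 + d * c0 ^ 2) * (b1 ^ 2 + d * c1 ^ 2) \<le> 16"
    unfolding of_real_eq_iff by linarith
  moreover have "(d * c0 ^ 2) * (d * c1 ^ 2) \<le> (b0 ^ 2 + d * c0 ^ 2) * (b1 ^ 2 + d * c1 ^ 2)"
    by (intro mult_mono) auto
  moreover have "(d * c0 ^ 2) * (d * c1 ^ 2) = d ^ 2 * (c0 * c1) ^ 2"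
    by (simp add: power2_eq_square mult_ac)
  moreover have "c0 * c1 = of_int n"
  proof -
    have "(of_real (c0 * c1) :: complex) = of_real (of_int n)" using n unfolding re(4) unfolding re(2) by simp
    then show ?thesis by (simp only: of_real_eq_iff)
  qed
  ultimately have "real_of_int (int d ^ 2 * n ^ 2) \<le> real_of_int 16" by simp
  then have "int d ^ 2 * n ^ 2 \<le> 16" by (simp only: of_int_le_iff)
  moreover have "7 ^ 2 \<le> int d ^ 2" using d7 by (intro power_mono) auto
  moreover have "n ^ 2 \<ge> 1" if "n \<noteq> 0" using that by (simp add: int_one_le_iff_zero_less)
  ultimately have "n = 0" using mult_mono[of "7 ^ 2" "int d ^ 2" 1 "n ^ 2"] by fastforce
  then have "c = 0" using n sigma_nonzero[OF cL] by auto
  then have s\<gamma>: "\<sigma> (\<sigma> \<gamma>) = - \<gamma>" unfolding c_def by (simp add: add_eq_0_iff)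

  \<comment> \<open>\<open>\<gamma> \<cdot> \<sigma> \<gamma>\<close> is rational, being a square root of \<open>1\<close> in a real field\<close>
  have "\<gamma> * \<sigma> \<gamma> \<in> L" by (intro L_mult sigma_L \<gamma>L)
  have "\<gamma> ^ 2 * \<sigma> (\<gamma> ^ 2) = 1 \<or> \<gamma> ^ 2 * \<sigma> (\<gamma> ^ 2) = - 1"
  proof (rule norm_unit)
    show "\<gamma> ^ 2 \<in> L" unfolding power2_eq_square by (intro L_mult \<gamma>L)
    show "algebraic_int (\<gamma> ^ 2)" "algebraic_int (q ^ 2)" using \<gamma>int q by auto
    show "\<gamma> ^ 2 * q ^ 2 = 1" using \<gamma>q by (simp add: power_mult_distrib[symmetric])
    show "\<sigma> (\<sigma> (\<gamma> ^ 2)) = \<gamma> ^ 2" by (simp add: power2_eq_square sigma_mult sigma_L \<gamma>L s\<gamma>)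
  qed
  moreover have "\<gamma> ^ 2 * \<sigma> (\<gamma> ^ 2) = (\<gamma> * \<sigma> \<gamma>) ^ 2"
    by (simp add: power2_eq_square sigma_mult \<gamma>L mult_ac)
  moreover obtain g where g: "\<gamma> * \<sigma> \<gamma> = of_real g"
    using L_real[OF \<open>\<gamma> * \<sigma> \<gamma> \<in> L\<close>] by (auto elim: Reals_cases)
  ultimately have "(of_real (g ^ 2) :: complex) = of_real 1 \<or> (of_real (g ^ 2) :: complex) = of_real (- 1)"
    by simp
  then have "g ^ 2 = 1 \<or> g ^ 2 = - 1" by (simp only: of_real_eq_iff)
  then have "g ^ 2 = 1" using zero_le_power2[of g] by linarith
  then have "g = 1 \<or> g = - 1" by (simp add: power2_eq_1_iff)
  then have gs: "\<gamma> * \<sigma> \<gamma> = 1 \<or> \<gamma> * \<sigma> \<gamma> = - 1" unfolding g by auto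
  then have "\<sigma> (\<gamma> * \<sigma> \<gamma>) = \<gamma> * \<sigma> \<gamma>" using sigma_Rats[of 1] sigma_Rats[of "- 1"] by auto
  moreover have "\<sigma> (\<gamma> * \<sigma> \<gamma>) = - (\<gamma> * \<sigma> \<gamma>)" by (simp add: sigma_mult sigma_L \<gamma>L s\<gamma>)
  ultimately show False using gs by auto
qed

section \<open>The case of even discriminant of the quadratic field\<close>

text \<open>The equation \<open>e u = 1 + 2 v\<close> says that \<open>e\<close> is a unit modulo 2; such factors can be cancelled.\<close>

lemma nil_mod_2_cancel:
  assumes "algebraic_int x" "algebraic_int u" "algebraic_int v" "e * u = 1 + 2 * v" "nil_mod 2 (e * x)"
  shows "nil_mod 2 x"
proof -
  have "(e * u) * x = (1 + 2 * v) * x" unfolding assms(4) ..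
  then have "x = u * (e * x) - of_int 2 * (v * x)" by (simp add: algebra_simps)
  moreover have "nil_mod 2 (u * (e * x) - of_int 2 * (v * x))"
    by (intro nil_mod_diff nil_mod_mult nil_mod_multiple algebraic_int_mult assms)
  ultimately show ?thesis by simp
qed

text \<open>
  Under the congruence condition on \<open>d\<close> the integers of \<open>M\<close> are \<open>i + j \<delta>\<close> with rational integers \<open>i\<close>, \<open>j\<close>.
  Modulo the radical of 2 one has \<open>\<delta> \<equiv> d\<close>, so they reduce to the field with two elements.
\<close>

lemma M_integer_idempotent:
  assumes sf: "squarefree d" and d12: "d mod 4 = 1 \<or> d mod 4 = 2" and w: "w \<in> M" "algebraic_int w"
  shows "nil_mod 2 (w ^ 2 - w)"
proof -
  obtain r s where rs: "r \<in> \<rat>" "s \<in> \<rat>" "w = r + s * \<delta>" using M_cases[OF w(1)] by blast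
  have cw: "cnj w = r - s * \<delta>" unfolding rs(3) using rs by (simp add: cnj_Rats cnj_delta)
  have "w + cnj w = 2 * r" "w - cnj w = \<delta> * (2 * s)" "w * cnj w = r ^ 2 - s ^ 2 * \<delta> ^ 2"
    unfolding cw unfolding rs(3) by (simp_all add: algebra_simps power2_eq_square)
  then have *: "algebraic_int (2 * r)" "algebraic_int (\<delta> * (2 * s))" "algebraic_int (r ^ 2 + of_nat d * s ^ 2)"
    using w(2) delta_sq by (metis algebraic_int_add algebraic_int_cnj, metis algebraic_int_diff algebraic_int_cnj,
      metis algebraic_int_mult algebraic_int_cnj mult.commute diff_minus_eq_add mult_minus_right)
  obtain R where R: "2 * r = of_int R" using rational_algebraic_int_obtain[OF *(1)] rs by auto
  have "2 * s \<in> \<int>" by (rule integer_if_delta_mult_integral[OF sf _ *(2)]) (use rs in auto)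
  then obtain S where S: "2 * s = of_int S" by (auto elim: Ints_cases)
  obtain n where n: "r ^ 2 + of_nat d * s ^ 2 = of_int n"
    using rational_algebraic_int_obtain[OF *(3)] rs by auto
  have "of_int (R ^ 2 + int d * S ^ 2) = (2 * r) ^ 2 + of_nat d * (2 * s) ^ 2"
    unfolding R S by simp
  also have "\<dots> = of_int (4 * n)" unfolding of_int_mult n[symmetric] by (simp add: algebra_simps power2_eq_square)
  finally have RS: "R ^ 2 + int d * S ^ 2 = 4 * n" by (simp only: of_int_eq_iff)
  have "even R \<and> even S"
  proof (rule ccontr)
    assume not_even: "\<not> (even R \<and> even S)"
    have sq: "x ^ 2 mod 4 = (if even x then 0 else 1)" for x :: int
    proof (cases "even x")
      case False
      then obtain k where "x = 2 * k + 1" by (elim oddE)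
      then have "x ^ 2 = 4 * (k ^ 2 + k) + 1" by (simp add: power2_eq_square algebra_simps)
      then show ?thesis using False by presburger
    qed (auto simp: power2_eq_square)
    have "int d mod 4 = 1 \<or> int d mod 4 = 2" using d12 by presburger
    moreover have "(R ^ 2 mod 4 + ((int d mod 4) * (S ^ 2 mod 4)) mod 4) mod 4 = 0"
      using RS by (metis mod_add_eq mod_mult_eq mod_mult_self1_is_0)
    ultimately show False using not_even unfolding sq by (auto split: if_splits)
  qed
  then obtain i j where "R = 2 * i" "S = 2 * j" by blast
  then have ij: "r = of_int i" "s = of_int j" using R S by auto
  have "even (i ^ 2 - i)" "even (j ^ 2 - j)" by simp_all
  then obtain k l where kl: "i ^ 2 - i = 2 * k" "j ^ 2 - j = 2 * l" by blast
  have kl': "of_int i ^ 2 - of_int i = (2 * of_int k :: complex)" "of_int j ^ 2 - of_int j = (2 * of_int l :: complex)"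
    using arg_cong[OF kl(1), of "of_int :: int \<Rightarrow> complex"] arg_cong[OF kl(2), of "of_int :: int \<Rightarrow> complex"]
    by simp_all
  have "w ^ 2 - w = (of_int i ^ 2 - of_int i) - of_nat d * (of_int j ^ 2 - of_int j) + 2 * of_int i * of_int j * \<delta>
      - of_int j * (of_nat d + \<delta>) + of_int j ^ 2 * (\<delta> ^ 2 + of_nat d)"
    unfolding rs(3) ij by (simp add: algebra_simps power2_eq_square)
  also have "\<dots> = of_int 2 * (of_int k - of_nat d * of_int l + of_int i * of_int j * \<delta>)
      - of_int j * (of_nat d + \<delta>)"
    unfolding kl' delta_sq by (simp add: algebra_simps)
  also have "nil_mod 2 \<dots>"
    by (intro nil_mod_diff nil_mod_multiple nil_mod_mult nil_mod_2_delta_add algebraic_int_add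
      algebraic_int_diff algebraic_int_mult algebraic_int_delta algebraic_int_of_int algebraic_int_of_nat)
  finally show ?thesis .
qed

text \<open>
  For odd \<open>a\<close> the numbers \<open>\<eta>\<close> and \<open>\<eta>'\<close> are complementary idempotents modulo 2. They glue \<open>s\<close> and its
  conjugate to an element \<open>w = Y s + Y' \<phi> s\<close> of \<open>M\<close>, which is idempotent modulo the radical of 2; and
  \<open>Y s \<equiv> Y w\<close> modulo 2. This expresses that 2 splits in the quadratic subfield.
\<close>

lemma phi2_fixed_idempotent:
  assumes sf: "squarefree d" and d12: "d mod 4 = 1 \<or> d mod 4 = 2" and a: "odd a"
    and s: "s \<in> K" "algebraic_int s" "\<phi> (\<phi> s) = s"
  shows "nil_mod 2 (s ^ 2 - s)"
proof -
  interpret phi: subfield_hom K \<phi> by (rule phi_hom)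
  obtain k where k: "a = 2 * k + 1" using a by (elim oddE)
  have half: "nil_mod 2 (Y * (s ^ 2 - s))"
    if Y: "Y \<in> L" "Y' \<in> L" "algebraic_int Y" "algebraic_int Y'" "\<sigma> Y = Y'" "\<sigma> Y' = Y"
      "Y ^ 2 = of_int a * Y + 4" "Y * Y' = - 4" for Y Y'
  proof -
    define w where "w = Y * s + Y' * \<phi> s"
    have mem: "Y * s \<in> K" "Y' * \<phi> s \<in> K"
      by (intro subfield_mult[OF K_subfield] L_subset_K phi_K Y s)+
    have wK: "w \<in> K" unfolding w_def by (intro subfield_add[OF K_subfield] mem)
    have w: "algebraic_int w"
      unfolding w_def by (intro algebraic_int_add algebraic_int_mult phi_algebraic_int Y s)
    have "\<phi> w = w"
      unfolding w_def by (simp add: phi.hom_add phi.hom_mult mem L_subset_K Y s phi_K phi_L)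
    then have idem: "nil_mod 2 (w ^ 2 - w)" using M_integer_idempotent[OF sf d12 fixed_phi[OF wK] w] by simp
    define D where "D = of_int k * Y * s + 2 * s - 2 * \<phi> s"
    define E where "E = (\<lambda>z. of_int k * Y * z ^ 2 + 2 * z ^ 2)"
    have "Y * w - Y * s = (Y ^ 2 - Y) * s + (Y * Y') * \<phi> s"
      unfolding w_def by (simp add: algebra_simps power2_eq_square)
    then have Yw: "Y * w - Y * s = 2 * D" unfolding Y(7,8) D_def k by (simp add: algebra_simps)
    have E: "(Y * z) ^ 2 - Y * z - Y * (z ^ 2 - z) = 2 * E z" for z
    proof -
      have "(Y * z) ^ 2 - Y * z - Y * (z ^ 2 - z) = (Y ^ 2 - Y) * z ^ 2"
        by (simp add: algebra_simps power2_eq_square)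
      then show ?thesis unfolding Y(7) E_def k by (simp add: algebra_simps)
    qed
    have int: "algebraic_int (E z)" if "algebraic_int z" for z
      unfolding E_def by (intro algebraic_int_add algebraic_int_mult algebraic_int_pow Y that) auto
    have Dint: "algebraic_int D"
      unfolding D_def
      by (intro algebraic_int_add algebraic_int_diff algebraic_int_mult phi_algebraic_int Y s) auto
    have "x = z + of_int 2 * (e - f - c * (P + Q) + c)"
      if "P - Q = 2 * c" "P ^ 2 - P - z = 2 * e" "Q ^ 2 - Q - x = 2 * f" for P Q c e f x z :: complex
    proof -
      have "x - (z + of_int 2 * (e - f - c * (P + Q) + c)) = (P ^ 2 - P - z - 2 * e)
          - (Q ^ 2 - Q - x - 2 * f) - (P - Q - 2 * c) * (P + Q) + (P - Q - 2 * c)"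
        by (simp add: algebra_simps power2_eq_square)
      then show ?thesis unfolding that by simp
    qed
    from this[OF Yw E E]
    have "Y * (s ^ 2 - s) = Y * (w ^ 2 - w) + of_int 2 * (E w - E s - D * (Y * w + Y * s) + D)" .
    also have "nil_mod 2 \<dots>"
      by (intro nil_mod_add nil_mod_mult idem nil_mod_multiple algebraic_int_add algebraic_int_diff
        algebraic_int_mult int Dint w Y s)
    finally show ?thesis .
  qed
  have "nil_mod 2 (\<eta> * (s ^ 2 - s))"
    by (rule half[of \<eta> \<eta>'])
      (simp_all add: L_eta L_eta' algebraic_int_eta algebraic_int_eta' sigma_eta sigma_eta' eta_sq eta_mult)
  moreover have "nil_mod 2 (\<eta>' * (s ^ 2 - s))"
    by (rule half[of \<eta>' \<eta>])
      (simp_all add: L_eta L_eta' algebraic_int_eta algebraic_int_eta' sigma_eta sigma_eta' eta'_sq eta_mult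
        mult.commute[of \<eta>' \<eta>])
  ultimately have "nil_mod 2 (\<eta> * (s ^ 2 - s) + \<eta>' * (s ^ 2 - s))" by (rule nil_mod_add)
  then have nil: "nil_mod 2 (of_int a * (s ^ 2 - s))" unfolding eta_add[symmetric] distrib_right .
  show ?thesis
    by (rule nil_mod_2_cancel[OF _ _ _ _ nil, of 1 "of_int k"])
      (use s in \<open>auto simp: k intro!: algebraic_int_diff algebraic_int_pow\<close>)
qed

text \<open>
  An element \<open>\<theta>\<close> with \<open>\<theta>\<^sup>2 + \<theta> + 1 \<equiv> 0\<close> modulo 2 generates a field with four elements modulo every prime
  above 2. If \<open>\<theta>\<close> is a polynomial in \<open>\<beta>\<close>, then \<open>\<beta>\<close> avoids the residue classes of rational integers, for
  \<open>t\<^sup>2 + t + 1\<close> is odd for every integer \<open>t\<close>.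
\<close>

lemma unit_mod_2:
  fixes \<beta> :: complex and p :: "int poly"
  assumes \<beta>: "algebraic_int \<beta>" and \<theta>: "\<theta> = poly (map_poly of_int p) \<beta>"
    and R: "algebraic_int R" "\<theta> ^ 2 + \<theta> + 1 = 2 * R"
  shows "\<exists>u v. algebraic_int u \<and> algebraic_int v \<and> (\<beta> - of_int c) * u = 1 + 2 * v"
proof -
  define t where "t = poly p c"
  have pc: "poly (map_poly of_int p) (of_int c) = (of_int t :: complex)"
    unfolding t_def by simp
  obtain q where q: "algebraic_int q" "\<theta> - of_int t = (\<beta> - of_int c) * q"
    using poly_diff_divisible[OF \<beta> algebraic_int_of_int[of c], of p] unfolding \<theta> pc[symmetric] by auto
  have "odd (t ^ 2 + t + 1)" by simp
  then obtain k where tk: "t ^ 2 + t + 1 = 2 * k + 1" by (elim oddE)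
  have "(of_int (t ^ 2 + t + 1) :: complex) = of_int (2 * k + 1)" unfolding tk ..
  then have k: "of_int t ^ 2 + of_int t + 1 = (2 * of_int k + 1 :: complex)"
    by (simp only: of_int_add of_int_mult of_int_power of_int_1 of_int_numeral)
  have \<theta>q: "\<theta> = of_int t + (\<beta> - of_int c) * q" using q(2) by (simp add: algebra_simps)
  have "2 * R = (of_int t ^ 2 + of_int t + 1)
      + (\<beta> - of_int c) * (q * (2 * of_int t + (\<beta> - of_int c) * q + 1))"
    unfolding R(2)[symmetric] \<theta>q by (simp add: algebra_simps power2_eq_square)
  then have "(\<beta> - of_int c) * (- (q * (2 * of_int t + (\<beta> - of_int c) * q + 1))) = 1 + 2 * (of_int k - R)"
    unfolding k by (simp add: algebra_simps)
  moreover have "algebraic_int (- (q * (2 * of_int t + (\<beta> - of_int c) * q + 1)))"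
    using \<beta> q(1) by (intro algebraic_int_minus algebraic_int_mult algebraic_int_add algebraic_int_diff) auto
  moreover have "algebraic_int (of_int k - R)" using R by auto
  ultimately show ?thesis by blast
qed

text \<open>
  Where the idempotent \<open>\<eta>\<close> is 1, the relation \<open>\<xi>\<^sup>2 = \<eta> \<xi> + 1\<close> makes \<open>\<xi>\<close> a root of \<open>x\<^sup>2 + x + 1\<close> modulo 2, and where
  \<open>\<eta>'\<close> is 1 the same holds for \<open>\<xi>'\<close>. The element \<open>\<eta> \<xi> + \<eta>' \<xi>'\<close> combines the two.
\<close>

lemma primitive_cube_root_mod_2:
  assumes "odd a"
  obtains \<theta> R where "\<theta> \<in> L" "algebraic_int \<theta>" "R \<in> L" "algebraic_int R" "\<theta> ^ 2 + \<theta> + 1 = 2 * R"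
proof -
  obtain k where k: "a = 2 * k + 1" using assms by (elim oddE)
  then have ka: "of_int a = (2 * of_int k + 1 :: complex)" by simp
  define \<theta> where "\<theta> = \<eta> * \<xi> + \<eta>' * \<xi>'"
  define R where "R = of_int (2 * k ^ 2 + 2 * k + 3) * \<theta> + of_int (2 * k ^ 2 + 2 * k + 5)
    + 2 * of_int a * (\<xi> + \<xi>') - 4 * (\<xi> * \<xi>')"
  have xi'_int: "algebraic_int \<xi>'" using sigma_algebraic_int[OF L_xi algebraic_int_xi] by (simp add: sigma_xi)
  have \<theta>: "\<theta> \<in> L" "algebraic_int \<theta>"
    unfolding \<theta>_def
    by (intro L_add L_mult L_eta L_xi L_eta' L_xi' algebraic_int_add algebraic_int_mult
      algebraic_int_eta algebraic_int_xi algebraic_int_eta' xi'_int)+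
  have R: "R \<in> L" "algebraic_int R"
    unfolding R_def
    by (intro L_add L_diff L_mult L_xi L_xi' \<theta> L_of_int L_numeral algebraic_int_add algebraic_int_diff
      algebraic_int_mult algebraic_int_xi xi'_int algebraic_int_of_int algebraic_int_numeral)+
  have comp: "(Y * X) ^ 2 = (of_int a ^ 2 + 4) * (Y * X) + of_int a * Y + 4 * of_int a * X + 4"
    if "Y ^ 2 = of_int a * Y + 4" "X ^ 2 = Y * X + 1" for X Y :: complex
  proof -
    have "(Y * X) ^ 2 = (of_int a ^ 2 + 4) * (Y * X) + of_int a * Y + 4 * of_int a * X + 4
        + (X ^ 2 - Y * X - 1) * Y ^ 2 + (Y ^ 2 - of_int a * Y - 4) * (Y * X + 1 + of_int a * X)"
      by (simp add: algebra_simps power2_eq_square)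
    then show ?thesis using that by simp
  qed
  have "\<theta> ^ 2 = (\<eta> * \<xi>) ^ 2 + 2 * (\<eta> * \<eta>') * (\<xi> * \<xi>') + (\<eta>' * \<xi>') ^ 2"
    unfolding \<theta>_def by (simp add: algebra_simps power2_eq_square)
  also have "\<dots> = (of_int a ^ 2 + 4) * \<theta> + of_int a * (\<eta> + \<eta>') + 4 * of_int a * (\<xi> + \<xi>') + 8 - 8 * (\<xi> * \<xi>')"
    unfolding comp[OF eta_sq xi_sq] comp[OF eta'_sq xi'_sq] eta_mult \<theta>_def by (simp add: algebra_simps)
  finally have "\<theta> ^ 2 + \<theta> + 1 = 2 * R"
    unfolding eta_add R_def ka by (simp add: algebra_simps power2_eq_square)
  then show ?thesis using that \<theta> R by blast
qed

text \<open>
  Modulo the radical of 2, the trace \<open>s\<close> and the norm \<open>n\<close> of \<open>\<beta>\<close> over the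
  fixed field of \<open>\<phi>\<^sup>2\<close> are idempotent, and both are units: \<open>\<beta>\<close> and \<open>\<beta> + 1\<close>
  are units modulo 2, and so are their norms \<open>n\<close> and \<open>n + s + 1\<close>. Hence both are 1, and
  \<open>\<beta>\<close> is a root of \<open>x\<^sup>2 + x + 1\<close>, the only irreducible quadratic polynomial over the field with two elements.
\<close>

lemma generator_mod_2:
  assumes sf: "squarefree d" and d12: "d mod 4 = 1 \<or> d mod 4 = 2" and a: "odd a"
    and \<beta>: "\<beta> \<in> K" "algebraic_int \<beta>"
    and \<theta>: "\<theta> \<in> K" "\<theta> = poly (map_poly of_int p) \<beta>"
    and R: "R \<in> K" "algebraic_int R" "\<theta> ^ 2 + \<theta> + 1 = 2 * R"
  shows "nil_mod 2 (\<beta> + \<phi> (\<phi> \<beta>) - 1) \<and> nil_mod 2 (\<beta> ^ 2 - \<beta> + 1)"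
proof -
  interpret phi2: subfield_hom K "\<lambda>x. \<phi> (\<phi> x)" by (rule phi2_hom)
  interpret phi: subfield_hom K \<phi> by (rule phi_hom)
  define \<beta>2 where "\<beta>2 = \<phi> (\<phi> \<beta>)"
  have \<beta>2: "\<beta>2 \<in> K" "algebraic_int \<beta>2"
    unfolding \<beta>2_def by (intro phi_K phi_algebraic_int \<beta>)+
  have \<beta>22: "\<phi> (\<phi> \<beta>2) = \<beta>" unfolding \<beta>2_def by (rule phi4[OF \<beta>(1)])
  have \<theta>2: "\<phi> (\<phi> \<theta>) = poly (map_poly of_int p) \<beta>2"
    unfolding \<theta>(2) \<beta>2_def by (rule phi2.hom_of_int_poly[OF \<beta>(1)])
  have "\<phi> (\<phi> (\<theta> ^ 2 + \<theta> + 1)) = \<phi> (\<phi> (of_int 2 * R))" using R(3) by simp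
  then have R2: "(\<phi> (\<phi> \<theta>)) ^ 2 + \<phi> (\<phi> \<theta>) + 1 = 2 * \<phi> (\<phi> R)"
    using \<theta>(1) R(1)
    by (simp only: phi2.hom_add phi2.hom_mult phi2.hom_power phi2.hom_one phi2.hom_of_int
      subfield_add[OF K_subfield] subfield_mult[OF K_subfield] subfield_power[OF K_subfield]
      subfield_one[OF K_subfield] subfield_of_int[OF K_subfield]) simp
  have R2int: "algebraic_int (\<phi> (\<phi> R))" by (intro phi_algebraic_int phi_K R)
  define s where "s = \<beta> + \<beta>2"
  define n where "n = \<beta> * \<beta>2"
  have sK: "s \<in> K" "algebraic_int s" and nK: "n \<in> K" "algebraic_int n"
    unfolding s_def n_def
    by (intro subfield_add[OF K_subfield] subfield_mult[OF K_subfield] algebraic_int_add algebraic_int_mult \<beta> \<beta>2)+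
  have "\<phi> (\<phi> s) = s" unfolding s_def using \<beta> \<beta>2 by (simp add: phi2.hom_add \<beta>22 \<beta>2_def[symmetric])
  then have sidem: "nil_mod 2 (s ^ 2 - s)" by (rule phi2_fixed_idempotent[OF sf d12 a sK])
  have "\<phi> (\<phi> n) = n" unfolding n_def using \<beta> \<beta>2 by (simp add: phi2.hom_mult \<beta>22 \<beta>2_def[symmetric])
  then have nidem: "nil_mod 2 (n ^ 2 - n)" by (rule phi2_fixed_idempotent[OF sf d12 a nK])
  have prod: "\<exists>u v. algebraic_int u \<and> algebraic_int v \<and> ((\<beta> - of_int c) * (\<beta>2 - of_int c)) * u = 1 + 2 * v"
    for c
  proof -
    obtain u v where u: "algebraic_int u" "algebraic_int v" "(\<beta> - of_int c) * u = 1 + 2 * v"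
      using unit_mod_2[OF \<beta>(2) \<theta>(2) R(2,3)] by blast
    obtain u' v' where u': "algebraic_int u'" "algebraic_int v'" "(\<beta>2 - of_int c) * u' = 1 + 2 * v'"
      using unit_mod_2[OF \<beta>2(2) \<theta>2 R2int R2] by blast
    have "((\<beta> - of_int c) * (\<beta>2 - of_int c)) * (u * u') = ((\<beta> - of_int c) * u) * ((\<beta>2 - of_int c) * u')"
      by simp
    also have "\<dots> = 1 + 2 * (v + v' + 2 * v * v')" unfolding u(3) u'(3) by (simp add: algebra_simps)
    finally show ?thesis using u u'
      by (intro exI[of _ "u * u'"] exI[of _ "v + v' + 2 * v * v'"])
        (auto intro!: algebraic_int_add algebraic_int_mult)
  qed
  obtain u v where u: "algebraic_int u" "algebraic_int v" "n * u = 1 + 2 * v"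
    using prod[of 0] unfolding n_def by auto
  have "nil_mod 2 (n * (n - 1))" using nidem by (simp add: algebra_simps power2_eq_square)
  from nil_mod_2_cancel[OF _ u this] have n1: "nil_mod 2 (n - 1)" using nK by auto
  obtain u' v' where u': "algebraic_int u'" "algebraic_int v'" "(n + s + 1) * u' = 1 + 2 * v'"
    using prod[of "-1"] unfolding n_def s_def by (auto simp: algebra_simps)
  have "nil_mod 2 ((s ^ 2 - s) + (s - 1) * (n - 1) + of_int 2 * (s - 1))"
    by (intro nil_mod_add sidem nil_mod_mult n1 nil_mod_multiple algebraic_int_diff sK) auto
  moreover have "(s ^ 2 - s) + (s - 1) * (n - 1) + of_int 2 * (s - 1) = (n + s + 1) * (s - 1)"
    by (simp add: algebra_simps power2_eq_square)
  ultimately have "nil_mod 2 ((n + s + 1) * (s - 1))" by simp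
  from nil_mod_2_cancel[OF _ u' this] have s1: "nil_mod 2 (s - 1)" using sK by auto
  have "nil_mod 2 (\<beta> * (s - 1) - (n - 1))" by (intro nil_mod_diff nil_mod_mult s1 n1 \<beta>)
  moreover have "\<beta> * (s - 1) - (n - 1) = \<beta> ^ 2 - \<beta> + 1"
    unfolding s_def n_def by (simp add: algebra_simps power2_eq_square)
  ultimately show ?thesis using s1 unfolding s_def \<beta>2_def by simp
qed

text \<open>
  The difference \<open>\<alpha> - \<phi> \<alpha>\<close> divides \<open>\<eta> - \<eta>' = \<rho>\<close>, so it is a unit modulo 2 because \<open>\<rho>\<^sup>2 = m\<close> is odd. Modulo
  the radical of 2 both \<open>\<alpha>\<close> and \<open>\<phi> \<alpha>\<close> are roots of \<open>x\<^sup>2 + x + 1\<close>; as their difference is a unit, their sum is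
  1. But \<open>\<alpha> + \<phi>\<^sup>2 \<alpha>\<close> is 1 as well, so \<open>\<phi> \<alpha> - \<phi>\<^sup>2 \<alpha>\<close> vanishes, although it is the conjugate of a unit.
\<close>

lemma not_monogenic_if_1_2_mod_4:
  assumes sf: "squarefree d" and d12: "d mod 4 = 1 \<or> d mod 4 = 2" and a: "odd a"
  shows "\<not> monogenic K"
proof
  assume "monogenic K"
  then obtain \<alpha> where "\<alpha> \<in> ring_of_integers K" and gen: "ring_of_integers K = int_adjoin \<alpha>"
    unfolding monogenic_def by blast
  then have \<alpha>: "\<alpha> \<in> K" "algebraic_int \<alpha>" by (auto simp: ring_of_integers_def)
  interpret phi: subfield_hom K \<phi> by (rule phi_hom)
  define \<alpha>1 where "\<alpha>1 = \<phi> \<alpha>"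
  define \<alpha>2 where "\<alpha>2 = \<phi> \<alpha>1"
  have \<alpha>1: "\<alpha>1 \<in> K" "algebraic_int \<alpha>1" unfolding \<alpha>1_def by (intro phi_K phi_algebraic_int \<alpha>)+
  have \<alpha>2: "\<alpha>2 \<in> K" "algebraic_int \<alpha>2" unfolding \<alpha>2_def by (intro phi_K phi_algebraic_int \<alpha>1)+
  obtain \<theta> R where \<theta>: "\<theta> \<in> L" "algebraic_int \<theta>" "R \<in> L" "algebraic_int R" "\<theta> ^ 2 + \<theta> + 1 = 2 * R"
    using primitive_cube_root_mod_2[OF a] by blast
  have \<theta>K: "\<theta> \<in> K" "R \<in> K" using \<theta> L_subset_K by auto
  obtain p :: "int poly" where p: "\<theta> = poly (map_poly of_int p) \<alpha>"
    using gen \<theta>(2) \<theta>K(1) unfolding ring_of_integers_def int_adjoin_def by blast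
  have g0: "nil_mod 2 (\<alpha> + \<alpha>2 - 1)" "nil_mod 2 (\<alpha> ^ 2 - \<alpha> + 1)"
    using generator_mod_2[OF sf d12 a \<alpha> \<theta>K(1) p \<theta>K(2) \<theta>(4,5)] unfolding \<alpha>2_def \<alpha>1_def by auto
  have "nil_mod 2 (\<phi> (\<alpha> ^ 2 - \<alpha> + 1))"
    by (rule phi.hom_nil_mod[OF _ g0(2)])
      (intro subfield_add[OF K_subfield] subfield_diff[OF K_subfield] subfield_power[OF K_subfield]
        subfield_one[OF K_subfield] \<alpha>)
  then have g1: "nil_mod 2 (\<alpha>1 ^ 2 - \<alpha>1 + 1)"
    unfolding \<alpha>1_def
    by (simp add: phi.hom_add phi.hom_diff phi.hom_power phi.hom_one subfield_diff[OF K_subfield]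
      subfield_power[OF K_subfield] subfield_one[OF K_subfield] \<alpha>)
  obtain q where q: "algebraic_int q" "\<eta> - \<phi> \<eta> = (\<alpha> - \<alpha>1) * q"
    using generator_diff_divides[OF gen phi_hom L_subset_K[OF L_eta] algebraic_int_eta \<alpha>]
    unfolding \<alpha>1_def by blast
  have "\<eta> - \<phi> \<eta> = \<rho>" by (simp add: phi_L L_eta sigma_eta rho_eq)
  then have \<rho>q: "\<rho> = (\<alpha> - \<alpha>1) * q" using q(2) by simp
  have qK: "q \<in> K"
  proof (cases "\<alpha> = \<alpha>1")
    case True
    then have "\<rho> = 0" using \<rho>q by simp
    then show ?thesis using rho_sq m_pos by simp
  next
    case False
    then have "q = \<rho> / (\<alpha> - \<alpha>1)" using \<rho>q by (simp add: field_simps)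
    then show ?thesis
      using subfield_divide[OF K_subfield L_subset_K[OF L_rho] subfield_diff[OF K_subfield \<alpha>(1) \<alpha>1(1)]] by simp
  qed
  have "odd m" using a unfolding m_def by simp
  then obtain k where k: "m = 2 * k + 1" by (elim oddE)
  have unit: "(\<alpha> - \<alpha>1) * (q * \<rho>) = 1 + 2 * of_int k"
    using rho_sq \<rho>q k by (simp add: power2_eq_square mult.assoc)
  have "nil_mod 2 ((\<alpha> ^ 2 - \<alpha> + 1) - (\<alpha>1 ^ 2 - \<alpha>1 + 1))" by (intro nil_mod_diff g0 g1)
  moreover have "(\<alpha> ^ 2 - \<alpha> + 1) - (\<alpha>1 ^ 2 - \<alpha>1 + 1) = (\<alpha> - \<alpha>1) * (\<alpha> + \<alpha>1 - 1)"
    by (simp add: algebra_simps power2_eq_square)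
  ultimately have nil1: "nil_mod 2 ((\<alpha> - \<alpha>1) * (\<alpha> + \<alpha>1 - 1))" by simp
  have "nil_mod 2 (\<alpha> + \<alpha>1 - 1)"
    by (rule nil_mod_2_cancel[OF _ _ _ unit nil1])
      (auto intro!: algebraic_int_add algebraic_int_diff algebraic_int_mult \<alpha> \<alpha>1 q algebraic_int_rho)
  then have "nil_mod 2 ((\<alpha> + \<alpha>1 - 1) - (\<alpha> + \<alpha>2 - 1))" using g0(1) by (rule nil_mod_diff)
  moreover have "(\<alpha> + \<alpha>1 - 1) - (\<alpha> + \<alpha>2 - 1) = (\<alpha>1 - \<alpha>2) * 1" by simp
  ultimately have nil: "nil_mod 2 ((\<alpha>1 - \<alpha>2) * 1)" by simp
  have mem: "\<alpha> - \<alpha>1 \<in> K" "q * \<rho> \<in> K"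
    by (intro subfield_diff[OF K_subfield] subfield_mult[OF K_subfield] \<alpha> \<alpha>1 qK L_subset_K[OF L_rho])+
  have "(\<alpha>1 - \<alpha>2) * (\<phi> q * \<phi> \<rho>) = \<phi> ((\<alpha> - \<alpha>1) * (q * \<rho>))"
    unfolding phi.hom_mult[OF mem] phi.hom_mult[OF qK L_subset_K[OF L_rho]] phi.hom_diff[OF \<alpha>(1) \<alpha>1(1)]
      \<alpha>2_def unfolding \<alpha>1_def ..
  also have "\<dots> = \<phi> (of_int (1 + 2 * k))" unfolding unit by simp
  finally have unit2: "(\<alpha>1 - \<alpha>2) * (\<phi> q * \<phi> \<rho>) = 1 + 2 * of_int k" unfolding phi.hom_of_int by simp
  have "nil_mod 2 1"
    by (rule nil_mod_2_cancel[OF _ _ _ unit2 nil])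
      (auto intro!: algebraic_int_mult phi_algebraic_int q qK algebraic_int_rho L_subset_K L_rho)
  then show False using nil_mod_of_intD[of 2 1] by simp
qed

end

theorem theorem6:
  fixes a :: int and d :: nat and \<xi> :: complex and L M K :: "complex set"
  assumes "a > 0" and "a \<noteq> 3"
    and "\<And>b :: int. odd b \<Longrightarrow> b > 1 \<Longrightarrow> \<not> b ^ 2 dvd a ^ 2 + 16"
    and "\<xi> ^ 4 - of_int a * \<xi> ^ 3 - 6 * \<xi> ^ 2 + of_int a * \<xi> + 1 = 0"
    and "L = field_adjoin {\<xi>}"
    and "d > 0" and "squarefree d"
    and "M = field_adjoin {\<i> * of_real (sqrt (real d))}"
    and "gcd (field_discriminant M) (field_discriminant L) = 1"
    and "K = composite_field L M"
    and "d \<noteq> 3"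
  shows "\<not> monogenic K"
proof -
  interpret F: composite_octic a \<xi> d by unfold_locales (use assms in auto)
  have LM: "L = F.L" "M = F.M" using assms(5,8) F.L_eq_adjoin F.M_eq_adjoin unfolding F.\<delta>_def by auto
  then have K: "K = F.K" using assms(10) F.K_eq_composite by simp
  \<comment> \<open>no rational prime ramifies in both fields\<close>
  have disc: "\<not> (p dvd field_discriminant F.M \<and> p dvd field_discriminant F.L)" if "prime p" for p :: int
  proof
    assume "p dvd field_discriminant F.M \<and> p dvd field_discriminant F.L"
    then have "p dvd gcd (field_discriminant F.M) (field_discriminant F.L)" by simp
    then have "p dvd 1" using assms(9) unfolding LM by metis
    then show False using that not_prime_unit by blast
  qed
  have "d mod 4 \<noteq> 0"
  proof
    assume "d mod 4 = 0"
    then have "4 dvd d" by (rule mod_0_imp_dvd)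
    then have "2 ^ 2 dvd d" by simp
    then have "2 dvd (1 :: nat)" by (rule squarefreeD[OF assms(7)])
    then show False by simp
  qed
  then consider "d mod 4 = 1 \<or> d mod 4 = 2" | "d mod 4 = 3" by linarith
  then show ?thesis
  proof cases
    case 1
    then have "odd a" using F.even_discriminant F.even_M_discriminant disc[of 2] by auto
    then show ?thesis unfolding K by (rule F.not_monogenic_if_1_2_mod_4[OF assms(7) 1])
  next
    case 2
    then have "odd d" by presburger
    have "d \<ge> 7" using 2 assms(11) by presburger
    have "coprime (int d) F.m"
    proof (rule ccontr)
      assume "\<not> coprime (int d) F.m"
      then obtain p where p: "prime p" "p dvd int d" "p dvd F.m"
        using prime_factor_int[of "gcd (int d) F.m"] by (auto simp: coprime_iff_gcd_eq_1)
      have "odd p" using p(2) \<open>odd d\<close> by (metis dvd_trans even_of_nat)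
      have "p > 1" using p(1) by (simp add: prime_gt_1_int)
      have "\<not> p ^ 2 dvd F.m" unfolding F.m_def by (rule assms(3)[OF \<open>odd p\<close> \<open>p > 1\<close>])
      then have "p dvd field_discriminant F.L"
        using F.odd_prime_dvd_discriminant[OF p(1) _ p(3)] \<open>odd p\<close> by fastforce
      moreover have "\<not> p ^ 2 dvd int d"
      proof
        assume "p ^ 2 dvd int d"
        moreover have "p = int (nat p)" using \<open>p > 1\<close> by simp
        ultimately have "nat p ^ 2 dvd d" by (metis int_dvd_int_iff of_nat_power)
        then have "nat p dvd 1" by (rule squarefreeD[OF assms(7)])
        then show False using \<open>p > 1\<close> by simp
      qed
      then have "p dvd field_discriminant F.M" by (rule F.prime_dvd_M_discriminant[OF p(1,2)])
      ultimately show False using disc[OF p(1)] by blast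
    qed
    then show ?thesis unfolding K by (rule F.not_monogenic_if_3_mod_4[OF assms(7) 2 \<open>d \<ge> 7\<close>])
  qed
qed

end
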